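(* Let $T$ be the quasi-nilpotent DT-operator, let $\lambda\in\mathbb C$ and put $T_\lambda=T-\lambda 1$. (a) Let $(Q_n)_{n\ge 0}$ be the sequence of polynomials on $\mathbb R$ uniquely determined by the recursion $$Q_0(x)=1,\qquad Q_{n+1}(x)=|\lambda|^2Q_n(x+1)+\int_0^xQ_n(y+1)\,dy\quad (n\ge 0).$$ Then $$E_{\mathcal D}\big((T_\lambda^*T_\lambda)^n\big)(x)=Q_n(x),\qquad x\in[0,1],\ n\in\mathbb N .$$ (b) For all $n\in\mathbb N$, $$\tau\big((T_\lambda^*T_\lambda)^n\big)=\sum_{k=0}^n\frac{n^k}{(k+1)!}\binom nk|\lambda|^{2n-2k}.$$
   Context: The quasi-nilpotent DT-operator $T$ is realized as follows. Let $(M,\tau)$ be a von Neumann algebra with faithful normal tracial state, containing a pair $(D_0,X)$ of free selfadjoint elements such that $D_0$ has the uniform distribution on $[0,1]$ and $X$ is standard semicircular (distribution $\frac1{2\pi}\sqrt{4-t^2}\,1_{[-2,2]}(t)\,dt$). For $N\in\mathbb N$ put $T_N=\sum_{j=1}^{2^N}p_{N,j}Xq_{N,j}$ with $p_{N,j}=1_{[\frac{j-1}{2^N},\frac{j}{2^N}]}(D_0)$ and $q_{N,j}=1_{[\frac{j}{2^N},1]}(D_0)$. Then $(T_N)$ converges in norm and $T$ is its limit. Put $\mathcal D=W^*(D_0)$, identified with $L^\infty([0,1])$ via $f\mapsto f(D_0)$ (so $\tau(f)=\int_0^1f(t)\,dt$); elements of $\mathcal D$ are regarded as functions of $x\in[0,1]$,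 and equalities between them are in $L^\infty([0,1])$. $E_{\mathcal D}$ denotes the trace-preserving conditional expectation of $W^*(D_0,X)$ onto $\mathcal D$. *)

theory Defs
  imports "HOL-Probability.Probability" "HOL-Computational_Algebra.Polynomial"
begin

section \<open>Complex Hilbert spaces and their bounded operators\<close>

class complex_hilbert = banach +
  fixes scaleC :: "complex \<Rightarrow> 'a \<Rightarrow> 'a"
    and cinner :: "'a \<Rightarrow> 'a \<Rightarrow> complex"
  assumes scaleC_add_right: "scaleC a (x + y) = scaleC a x + scaleC a y"
    and scaleC_add_left: "scaleC (a + b) x = scaleC a x + scaleC b x"
    and scaleC_scaleC: "scaleC a (scaleC b x) = scaleC (a * b) x"
    and scaleC_of_real: "scaleC (complex_of_real r) x = scaleR r x"
    and cinner_commute: "cinner x y = cnj (cinner y x)"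
    and cinner_add_left: "cinner (x + y) z = cinner x z + cinner y z"
    and cinner_scaleC_left: "cinner (scaleC a x) y = a * cinner x y"
    and cinner_self: "cinner x x = complex_of_real ((norm x)\<^sup>2)"

text \<open>Real-linear bounded operators, with the operator norm; the complex-linear ones form the
  set \<open>clinear_ops\<close>.\<close>
type_synonym 'h op = "'h \<Rightarrow>\<^sub>L 'h"

definition clinear_ops :: "('h::complex_hilbert) op set" where
  "clinear_ops = {A. \<forall>c x. blinfun_apply A (scaleC c x) = scaleC c (blinfun_apply A x)}"

definition scalar_op :: "complex \<Rightarrow> ('h::complex_hilbert) op" where
  "scalar_op c = Blinfun (scaleC c)"

lemma norm_scaleC: "norm (scaleC c (x::'h::complex_hilbert)) = cmod c * norm x"
proof -
  have "cinner (scaleC c x) (scaleC c x) = c * cnj (c * cinner x x)"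
    by (metis cinner_commute cinner_scaleC_left)
  also have "\<dots> = complex_of_real ((cmod c * norm x)\<^sup>2)"
    by (simp add: cinner_self power_mult_distrib complex_norm_square[symmetric]
        del: of_real_power)
  finally have "(norm (scaleC c x))\<^sup>2 = (cmod c * norm x)\<^sup>2"
    by (simp only: cinner_self of_real_eq_iff)
  then show ?thesis
    by (simp add: power2_eq_iff_nonneg)
qed

lemma bounded_linear_scaleC: "bounded_linear (scaleC c :: 'h::complex_hilbert \<Rightarrow> 'h)"
proof (rule bounded_linear_intro[where K = "cmod c"])
  show "scaleC c (r *\<^sub>R x) = r *\<^sub>R scaleC c x" for r and x :: 'h
    by (simp add: scaleC_of_real[symmetric] scaleC_scaleC mult.commute)
qed (auto simp: scaleC_add_right norm_scaleC mult.commute)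

lemma scalar_op_apply [simp]: "blinfun_apply (scalar_op c) x = scaleC c x"
  by (simp add: scalar_op_def bounded_linear_Blinfun_apply bounded_linear_scaleC)

definition op_pow :: "('h::complex_hilbert) op \<Rightarrow> nat \<Rightarrow> 'h op" where
  "op_pow A n = ((\<lambda>B. A o\<^sub>L B) ^^ n) id_blinfun"

definition is_adjoint :: "('h::complex_hilbert) op \<Rightarrow> 'h op \<Rightarrow> bool" where
  "is_adjoint A B \<longleftrightarrow>
     (\<forall>x y. cinner (blinfun_apply A x) y = cinner x (blinfun_apply B y))"

definition adj :: "('h::complex_hilbert) op \<Rightarrow> 'h op" where
  "adj A = (THE B. is_adjoint A B)"

definition selfadjoint :: "('h::complex_hilbert) op \<Rightarrow> bool" where
  "selfadjoint A \<longleftrightarrow> is_adjoint A A"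

definition positive_op :: "('h::complex_hilbert) op \<Rightarrow> bool" where
  "positive_op A \<longleftrightarrow> (\<forall>x. cinner (blinfun_apply A x) x \<in> \<real>\<^sub>\<ge>\<^sub>0)"

definition op_le :: "('h::complex_hilbert) op \<Rightarrow> 'h op \<Rightarrow> bool" where
  "op_le A B \<longleftrightarrow> positive_op (B - A)"


section \<open>Von Neumann algebras, traces, conditional expectations\<close>

definition commutant :: "('h::complex_hilbert) op set \<Rightarrow> 'h op set" where
  "commutant S = {B \<in> clinear_ops. \<forall>A\<in>S. A o\<^sub>L B = B o\<^sub>L A}"

definition von_neumann_algebra :: "('h::complex_hilbert) op set \<Rightarrow> bool" where
  "von_neumann_algebra M \<longleftrightarrow>
     M \<subseteq> clinear_ops \<and>
     (\<forall>A\<in>M. \<exists>B\<in>M. is_adjoint A B) \<and>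
     commutant (commutant M) = M"

definition vN_generated :: "('h::complex_hilbert) op set \<Rightarrow> 'h op set" where
  "vN_generated S = \<Inter>{N. von_neumann_algebra N \<and> S \<subseteq> N}"

definition clinear_on :: "('h::complex_hilbert) op set \<Rightarrow> ('h op \<Rightarrow> complex) \<Rightarrow> bool" where
  "clinear_on M \<tau> \<longleftrightarrow>
     (\<forall>A\<in>M. \<forall>B\<in>M. \<tau> (A + B) = \<tau> A + \<tau> B) \<and>
     (\<forall>c. \<forall>A\<in>M. \<tau> (scalar_op c o\<^sub>L A) = c * \<tau> A)"

text \<open>Normality: \<open>\<tau>\<close> preserves least upper bounds of increasing nets of selfadjoint elements.
  A net is increasing iff it can be indexed by its upward directed range, hence the
  quantification over directed sets.\<close>
definition normal_on :: "('h::complex_hilbert) op set \<Rightarrow> ('h op \<Rightarrow> complex) \<Rightarrow> bool" where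
  "normal_on M \<tau> \<longleftrightarrow>
     (\<forall>S A. S \<subseteq> {B\<in>M. selfadjoint B} \<and> S \<noteq> {} \<and>
        (\<forall>B\<in>S. \<forall>C\<in>S. \<exists>D\<in>S. op_le B D \<and> op_le C D) \<and>
        A \<in> M \<and> selfadjoint A \<and>
        (\<forall>B\<in>S. op_le B A) \<and>
        (\<forall>C\<in>M. selfadjoint C \<and> (\<forall>B\<in>S. op_le B C) \<longrightarrow> op_le A C)
      \<longrightarrow> Re (\<tau> A) = (SUP B\<in>S. Re (\<tau> B)))"

definition faithful_normal_tracial_state ::
    "('h::complex_hilbert) op set \<Rightarrow> ('h op \<Rightarrow> complex) \<Rightarrow> bool" where
  "faithful_normal_tracial_state M \<tau> \<longleftrightarrow>
     clinear_on M \<tau> \<and>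
     \<tau> id_blinfun = 1 \<and>
     (\<forall>A\<in>M. \<tau> (adj A o\<^sub>L A) \<in> \<real>\<^sub>\<ge>\<^sub>0) \<and>
     (\<forall>A\<in>M. \<tau> (adj A o\<^sub>L A) = 0 \<longrightarrow> A = 0) \<and>
     (\<forall>A\<in>M. \<forall>B\<in>M. \<tau> (A o\<^sub>L B) = \<tau> (B o\<^sub>L A)) \<and>
     normal_on M \<tau>"

text \<open>\<open>E\<close> is a \<open>\<tau>\<close>-preserving conditional expectation of \<open>N\<close> onto \<open>D\<close>. For a faithful normal
  tracial state there is exactly one such map on \<open>N\<close>; its values outside \<open>N\<close> are irrelevant.\<close>
definition trace_preserving_cond_exp ::
    "(('h::complex_hilbert) op \<Rightarrow> complex) \<Rightarrow> 'h op set \<Rightarrow> 'h op set \<Rightarrow> ('h op \<Rightarrow> 'h op) \<Rightarrow> bool"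
  where
  "trace_preserving_cond_exp \<tau> N D E \<longleftrightarrow>
     (\<forall>A\<in>N. E A \<in> D) \<and>
     (\<forall>A\<in>N. \<forall>B\<in>N. E (A + B) = E A + E B) \<and>
     (\<forall>c. \<forall>A\<in>N. E (scalar_op c o\<^sub>L A) = scalar_op c o\<^sub>L E A) \<and>
     (\<forall>A\<in>N. positive_op A \<longrightarrow> positive_op (E A)) \<and>
     (\<forall>B\<in>D. E B = B) \<and>
     (\<forall>A\<in>N. \<forall>B\<in>D. \<forall>C\<in>D. E (B o\<^sub>L A o\<^sub>L C) = B o\<^sub>L E A o\<^sub>L C) \<and>
     (\<forall>A\<in>N. \<tau> (E A) = \<tau> A)"


section \<open>Functional calculus, distributions, freeness\<close>

text \<open>\<open>\<Phi> f\<close> is \<open>f(A)\<close> for a selfadjoint \<open>A\<close> and a Borel function \<open>f\<close> that is bounded on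
  \<open>[-\<parallel>A\<parallel>, \<parallel>A\<parallel>]\<close>. The listed properties determine \<open>\<Phi>\<close> uniquely on these functions, and the
  spectral theorem provides existence. The convergence clause, applied to constant
  sequences, shows that \<open>\<Phi> f\<close> depends only on the restriction of \<open>f\<close> to that interval.\<close>
definition borel_functional_calculus ::
    "('h::complex_hilbert) op \<Rightarrow> ((real \<Rightarrow> complex) \<Rightarrow> 'h op) \<Rightarrow> bool" where
  "borel_functional_calculus A \<Phi> \<longleftrightarrow>
     (let K = {- norm A..norm A};
          F = {f \<in> borel_measurable borel. bounded (f ` K)}
      in (\<forall>f\<in>F. \<Phi> f \<in> clinear_ops) \<and>
         \<Phi> (\<lambda>_. 1) = id_blinfun \<and>
         \<Phi> complex_of_real = A \<and>
         (\<forall>f\<in>F. \<forall>g\<in>F. \<Phi> (\<lambda>t. f t + g t) = \<Phi> f + \<Phi> g) \<and>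
         (\<forall>c. \<forall>f\<in>F. \<Phi> (\<lambda>t. c * f t) = scalar_op c o\<^sub>L \<Phi> f) \<and>
         (\<forall>f\<in>F. \<forall>g\<in>F. \<Phi> (\<lambda>t. f t * g t) = \<Phi> f o\<^sub>L \<Phi> g) \<and>
         (\<forall>f\<in>F. is_adjoint (\<Phi> f) (\<Phi> (\<lambda>t. cnj (f t)))) \<and>
         (\<forall>fs f C. (\<forall>n. fs n \<in> borel_measurable borel) \<and> f \<in> borel_measurable borel \<and>
            (\<forall>n. \<forall>t\<in>K. cmod (fs n t) \<le> C) \<and> (\<forall>t\<in>K. (\<lambda>n. fs n t) \<longlonglongrightarrow> f t)
          \<longrightarrow> (\<forall>x. (\<lambda>n. blinfun_apply (\<Phi> (fs n)) x) \<longlonglongrightarrow> blinfun_apply (\<Phi> f) x)))"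

text \<open>The distribution of a selfadjoint element: the compactly supported probability measure
  with the same moments.\<close>
definition has_distribution ::
    "(('h::complex_hilbert) op \<Rightarrow> complex) \<Rightarrow> 'h op \<Rightarrow> real measure \<Rightarrow> bool" where
  "has_distribution \<tau> A \<mu> \<longleftrightarrow>
     prob_space \<mu> \<and> sets \<mu> = sets borel \<and>
     (\<exists>R. AE t in \<mu>. \<bar>t\<bar> \<le> R) \<and>
     (\<forall>k. \<tau> (op_pow A k) = complex_of_real (\<integral>t. t ^ k \<partial>\<mu>))"

definition uniform_01 :: "real measure" where
  "uniform_01 = uniform_measure lborel {0..1}"

definition standard_semicircle :: "real measure" where
  "standard_semicircle =
     density lborel (\<lambda>t. ennreal (1 / (2 * pi) * sqrt (4 - t\<^sup>2) * indicator {-2..2} t))"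

inductive_set unital_algebra_gen :: "('h::complex_hilbert) op set \<Rightarrow> 'h op set"
  for S :: "('h::complex_hilbert) op set" where
  gen: "A \<in> S \<Longrightarrow> A \<in> unital_algebra_gen S"
| scalar: "scalar_op c \<in> unital_algebra_gen S"
| add: "A \<in> unital_algebra_gen S \<Longrightarrow> B \<in> unital_algebra_gen S \<Longrightarrow> A + B \<in> unital_algebra_gen S"
| mult: "A \<in> unital_algebra_gen S \<Longrightarrow> B \<in> unital_algebra_gen S \<Longrightarrow> A o\<^sub>L B \<in> unital_algebra_gen S"

text \<open>Words are lists of pairs of an index and an element of the algebra with that index.\<close>
definition free_algebras ::
    "(('h::complex_hilbert) op \<Rightarrow> complex) \<Rightarrow> ('i \<Rightarrow> 'h op set) \<Rightarrow> bool" where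
  "free_algebras \<tau> \<A> \<longleftrightarrow>
     (\<forall>w. w \<noteq> [] \<and> (\<forall>(i, A)\<in>set w. A \<in> \<A> i \<and> \<tau> A = 0) \<and>
          successively (\<lambda>u v. fst u \<noteq> fst v) w
        \<longrightarrow> \<tau> (foldr (o\<^sub>L) (map snd w) id_blinfun) = 0)"

text \<open>Freeness of selfadjoint elements; for these the unital algebra generated is closed under
  adjoints, so that this is the same as *-freeness.\<close>
definition free_pair ::
    "(('h::complex_hilbert) op \<Rightarrow> complex) \<Rightarrow> 'h op \<Rightarrow> 'h op \<Rightarrow> bool" where
  "free_pair \<tau> A B \<longleftrightarrow>
     free_algebras \<tau> (\<lambda>i::bool. unital_algebra_gen {if i then A else B})"


section \<open>The DT-operator and the polynomials\<close>

text \<open>\<open>\<Phi>\<close> is the functional calculus of the diagonal operator \<open>D\<^sub>0\<close>.\<close>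
definition DT_approx ::
    "((real \<Rightarrow> complex) \<Rightarrow> ('h::complex_hilbert) op) \<Rightarrow> 'h op \<Rightarrow> nat \<Rightarrow> 'h op" where
  "DT_approx \<Phi> X N =
     (\<Sum>j = 1..2 ^ N.
        \<Phi> (indicator {(real j - 1) / 2 ^ N .. real j / 2 ^ N})
        o\<^sub>L X
        o\<^sub>L \<Phi> (indicator {real j / 2 ^ N .. 1}))"

text \<open>The integral is oriented, i.e. it is minus the integral over \<open>[x,0]\<close> for \<open>x < 0\<close>.\<close>
definition moment_recursion :: "complex \<Rightarrow> (nat \<Rightarrow> real poly) \<Rightarrow> bool" where
  "moment_recursion l Q \<longleftrightarrow>
     Q 0 = 1 \<and>
     (\<forall>n x. poly (Q (Suc n)) x =
        (cmod l)\<^sup>2 * poly (Q n) (x + 1) + (LBINT y=0..x. poly (Q n) (y + 1)))"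

end

theory Submission
  imports Defs "HOL-Computational_Algebra.Formal_Power_Series"
begin

text \<open>
  Freeness makes all mixed moments of \<open>X\<close> and bounded Borel functions of \<open>D\<^sub>0\<close> obey the Schwinger-Dyson
  equation \<open>\<tau>(X A) = (\<tau> \<otimes> \<tau>)(\<partial>\<^sub>X A)\<close>: on reduced words in centred functions of \<open>D\<^sub>0\<close> and Chebyshev
  polynomials of \<open>X\<close> both sides vanish unless the word is \<open>X\<close>, and the general case reduces to these.
  Since \<open>T\<close> is the norm limit of \<open>\<Sum>\<^bsub>j<k\<^esub> p\<^sub>j X p\<^sub>k\<close>, the equation becomes a recursion for the densities
  \<open>E\<^sub>D(W)\<close> of alternating words \<open>W\<close> in \<open>T\<^sub>\<lambda>\<close> and \<open>T\<^sub>\<lambda>\<^sup>*\<close>, in which only pairs \<open>(T, T\<^sup>*)\<close> contribute, with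
  covariance \<open>f \<mapsto> \<integral>\<^sub>0\<^sup>x f\<close> or \<open>f \<mapsto> \<integral>\<^sub>x\<^sup>1 f\<close>. Its generating function solves a differential equation whose
  solution is \<open>\<Sum>\<^sub>n E\<^sub>D((T\<^sub>\<lambda>\<^sup>*T\<^sub>\<lambda>)\<^sup>n)(x) s\<^sup>n = (1 + \<bar>\<lambda>\<bar>\<^sup>2 \<kappa>) e\<^bsup>\<kappa> x\<^esup>\<close> with \<open>\<kappa> = s (1 + \<bar>\<lambda>\<bar>\<^sup>2 \<kappa>) e\<^sup>\<kappa>\<close>; the recursion for
  \<open>Q\<^sub>n\<close> is read off from it, and Lagrange inversion gives the trace.

  The trace only sees polynomials in \<open>D\<^sub>0\<close> so far, whereas \<open>E\<^sub>D\<close> takes values in the bicommutant of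
  \<open>D\<^sub>0\<close>. Normality of \<open>\<tau>\<close> closes the gap: every element of the bicommutant agrees with a bounded
  Borel function of \<open>D\<^sub>0\<close> on the closure of each \<open>{D\<^sub>0}' x\<close>, and the projections onto these subspaces
  form a directed family with supremum \<open>1\<close>.
\<close>

section \<open>Hilbert space geometry\<close>

text \<open>Freeness concerns polynomials in \<open>D0\<close> and \<open>X\<close>, but the
  approximants of \<open>T\<close> contain indicators of \<open>D0\<close>; so identities for
  polynomials in \<open>D0\<close> must be carried to Borel functions, in the 2-norm of \<tau>. The
  Hilbert space may be nonseparable, so one vector need not decide everything: Radon-Nikodym gives a
  density on one cyclic subspace at a time, and the density changes with the subspace. What survives
  is 2-norm approximation, and it suffices: the numbers \<tau>(C f(D0)) determine an element C of
  the bicommutant. The recursion closes because in an alternating word the opposite letters sit at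
  odd distance from the first: contracting such a pair leaves an enclosed word of even length and a
  remainder, both alternating. The reflection x \<mapsto> 1 - x exchanges \<open>T\<close> and its
  adjoint, and words of odd length have constant densities. The equation for \<kappa> comes from the
  recursion for Q: inserting A exp(\<kappa> x) as generating function, with c the squared modulus of
  \<lambda>, forces \<kappa> = s (1 + c \<kappa>) exp(\<kappa>) by differentiation in x, and then A
  = 1 + c \<kappa> at x = 0.\<close>

text \<open>\<open>o\<^sub>L\<close> binds weaker than \<open>+\<close>, hence a separate infix.\<close>
abbreviation op_mult :: "('h::complex_hilbert) op \<Rightarrow> 'h op \<Rightarrow> 'h op" (infixl "\<odot>" 70)
  where "A \<odot> B \<equiv> A o\<^sub>L B"

lemma scaleC_zero_left [simp]: "scaleC 0 (x::'h::complex_hilbert) = 0"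
  using scaleC_of_real[of 0 x] by simp

lemma scaleC_one [simp]: "scaleC 1 (x::'h::complex_hilbert) = x"
  using scaleC_of_real[of 1 x] by simp

lemma scaleC_minus_one: "scaleC (-1) (x::'h::complex_hilbert) = - x"
  using scaleC_of_real[of "-1" x] by simp

lemma scaleC_zero_right [simp]: "scaleC a (0::'h::complex_hilbert) = 0"
  using bounded_linear.linear[OF bounded_linear_scaleC] linear_0 by blast

lemma scaleC_diff_right: "scaleC a (x - y) = scaleC a x - scaleC a (y::'h::complex_hilbert)"
  using bounded_linear.linear[OF bounded_linear_scaleC] linear_diff by blast

lemma scaleC_minus_left: "scaleC (- a) y = - scaleC a (y::'h::complex_hilbert)"
  by (metis mult_minus1 scaleC_minus_one scaleC_scaleC)

lemma cinner_add_right: "cinner x (y + z) = cinner x y + cinner x (z::'h::complex_hilbert)"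
  by (metis cinner_add_left cinner_commute complex_cnj_add)

lemma cinner_scaleC_right: "cinner x (scaleC a y) = cnj a * cinner x (y::'h::complex_hilbert)"
  by (metis cinner_commute cinner_scaleC_left complex_cnj_mult)

lemma cinner_zero_left [simp]: "cinner 0 (y::'h::complex_hilbert) = 0"
  using cinner_scaleC_left[of 0 0 y] by simp

lemma cinner_zero_right [simp]: "cinner x (0::'h::complex_hilbert) = 0"
  using cinner_scaleC_right[of x 0 0] by simp

lemma cinner_minus_left: "cinner (- x) y = - cinner x (y::'h::complex_hilbert)"
  using cinner_scaleC_left[of "-1" x y] by (simp add: scaleC_minus_one)

lemma cinner_minus_right: "cinner x (- y) = - cinner x (y::'h::complex_hilbert)"
  using cinner_scaleC_right[of x "-1" y] by (simp add: scaleC_minus_one)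

lemma cinner_diff_left: "cinner (x - y) z = cinner x z - cinner y (z::'h::complex_hilbert)"
  using cinner_add_left[of x "- y" z] by (simp add: cinner_minus_left)

lemma cinner_diff_right: "cinner x (y - z) = cinner x y - cinner x (z::'h::complex_hilbert)"
  using cinner_add_right[of x y "- z"] by (simp add: cinner_minus_right)

lemmas cinner_simps = cinner_add_left cinner_add_right cinner_diff_left cinner_diff_right
  cinner_scaleC_left cinner_scaleC_right cinner_minus_left cinner_minus_right

lemma cinner_eq_0_iff [simp]: "cinner x x = 0 \<longleftrightarrow> x = (0::'h::complex_hilbert)"
  by (simp add: cinner_self)

lemma cinner_ext:
  fixes x y :: "'h::complex_hilbert"
  assumes "\<And>z. cinner x z = cinner y z"
  shows "x = y"
proof -
  have "cinner (x - y) (x - y) = 0"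
    using assms by (simp add: cinner_diff_left)
  then show ?thesis by simp
qed

lemma norm_add_sq:
  fixes x y :: "'h::complex_hilbert"
  shows "(norm (x + y))\<^sup>2 = (norm x)\<^sup>2 + 2 * Re (cinner x y) + (norm y)\<^sup>2"
proof -
  have "complex_of_real ((norm (x + y))\<^sup>2) = cinner (x + y) (x + y)"
    by (simp add: cinner_self)
  also have "\<dots> = cinner x x + (cinner x y + cnj (cinner x y)) + cinner y y"
    by (simp add: cinner_simps cinner_commute[of y x])
  also have "\<dots> = complex_of_real ((norm x)\<^sup>2 + 2 * Re (cinner x y) + (norm y)\<^sup>2)"
    by (simp add: cinner_self complex_add_cnj)
  finally show ?thesis by (simp only: of_real_eq_iff)
qed

lemma norm_diff_sq:
  fixes x y :: "'h::complex_hilbert"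
  shows "(norm (x - y))\<^sup>2 = (norm x)\<^sup>2 - 2 * Re (cinner x y) + (norm y)\<^sup>2"
  using norm_add_sq[of x "- y"] by (simp add: cinner_simps)

lemma parallelogram:
  fixes x y :: "'h::complex_hilbert"
  shows "(norm (x + y))\<^sup>2 + (norm (x - y))\<^sup>2 = 2 * (norm x)\<^sup>2 + 2 * (norm y)\<^sup>2"
  by (simp add: norm_add_sq norm_diff_sq)

lemma cinner_Cauchy_Schwarz:
  fixes x y :: "'h::complex_hilbert"
  shows "cmod (cinner x y) \<le> norm x * norm y"
proof (cases "y = 0")
  case False
  define c where "c = cinner x y / complex_of_real ((norm y)\<^sup>2)"
  have ny: "norm y > 0" using False by simp
  have "cinner x (scaleC c y) = complex_of_real ((cmod (cinner x y))\<^sup>2 / (norm y)\<^sup>2)"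
    by (simp add: cinner_simps c_def complex_norm_square[symmetric] mult.commute)
  then have 1: "Re (cinner x (scaleC c y)) = (cmod (cinner x y))\<^sup>2 / (norm y)\<^sup>2"
    by (simp only: Re_complex_of_real)
  have cc: "cmod c = cmod (cinner x y) / (norm y)\<^sup>2"
    by (simp add: c_def norm_divide del: of_real_power)
  have 2: "(norm (scaleC c y))\<^sup>2 = (cmod (cinner x y))\<^sup>2 / (norm y)\<^sup>2"
    using ny by (simp add: norm_scaleC cc power2_eq_square)
  have "0 \<le> (norm (x - scaleC c y))\<^sup>2" by simp
  also have "\<dots> = (norm x)\<^sup>2 - (cmod (cinner x y))\<^sup>2 / (norm y)\<^sup>2"
    unfolding norm_diff_sq 1 2 by simp
  finally have "(cmod (cinner x y))\<^sup>2 \<le> (norm x * norm y)\<^sup>2"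
    using ny by (simp add: field_simps power_mult_distrib)
  then show ?thesis by (rule power2_le_imp_le) simp
qed simp

lemma bounded_linear_cinner_left: "bounded_linear (\<lambda>x. cinner x (y::'h::complex_hilbert))"
proof (rule bounded_linear_intro[where K = "norm y"])
  show "cinner (r *\<^sub>R x) y = r *\<^sub>R cinner x y" for r x
    by (simp add: scaleC_of_real[symmetric] cinner_simps scaleR_conv_of_real)
qed (auto simp: cinner_simps cinner_Cauchy_Schwarz)

lemma bounded_linear_cinner_right: "bounded_linear (\<lambda>y. cinner (x::'h::complex_hilbert) y)"
proof (rule bounded_linear_intro[where K = "norm x"])
  show "cinner x (r *\<^sub>R y) = r *\<^sub>R cinner x y" for r y
    by (simp add: scaleC_of_real[symmetric] cinner_simps scaleR_conv_of_real)
  show "cmod (cinner x y) \<le> norm y * norm x" for y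
    using cinner_Cauchy_Schwarz[of x y] by (simp add: mult.commute)
qed (auto simp: cinner_simps)

lemmas tendsto_cinner_left = bounded_linear.tendsto[OF bounded_linear_cinner_left]
lemmas tendsto_cinner_right = bounded_linear.tendsto[OF bounded_linear_cinner_right]
lemmas tendsto_scaleC = bounded_linear.tendsto[OF bounded_linear_scaleC]

section \<open>Closed subspaces and orthogonal projections\<close>

definition closed_csubspace :: "('h::complex_hilbert) set \<Rightarrow> bool" where
  "closed_csubspace V \<longleftrightarrow> closed V \<and> 0 \<in> V \<and> (\<forall>x\<in>V. \<forall>y\<in>V. x + y \<in> V) \<and>
     (\<forall>c. \<forall>x\<in>V. scaleC c x \<in> V)"

lemma closed_csubspace_diff:
  assumes "closed_csubspace V" "x \<in> V" "y \<in> V" shows "x - y \<in> V"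
proof -
  have "x + scaleC (-1) y \<in> V" using assms unfolding closed_csubspace_def by blast
  then show ?thesis by (simp add: scaleC_minus_one)
qed

lemma closed_csubspace_closure:
  assumes "0 \<in> S" "\<And>x y. x \<in> S \<Longrightarrow> y \<in> S \<Longrightarrow> x + y \<in> S" "\<And>c x. x \<in> S \<Longrightarrow> scaleC c x \<in> S"
  shows "closed_csubspace (closure S)"
  unfolding closed_csubspace_def
proof (intro conjI ballI allI)
  show "0 \<in> closure S" using assms(1) closure_subset by blast
  show "x + y \<in> closure S" if xy: "x \<in> closure S" "y \<in> closure S" for x y
  proof -
    obtain u where "\<forall>n. u n \<in> S" "u \<longlonglongrightarrow> x"
      using xy(1) unfolding closure_sequential by blast
    moreover obtain v where "\<forall>n. v n \<in> S" "v \<longlonglongrightarrow> y"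
      using xy(2) unfolding closure_sequential by blast
    ultimately show ?thesis unfolding closure_sequential
      by (intro exI[of _ "\<lambda>n. u n + v n"]) (auto intro: assms tendsto_add)
  qed
  show "scaleC c x \<in> closure S" if x: "x \<in> closure S" for c x
  proof -
    obtain u where "\<forall>n. u n \<in> S" "u \<longlonglongrightarrow> x"
      using x unfolding closure_sequential by blast
    then show ?thesis unfolding closure_sequential
      by (intro exI[of _ "\<lambda>n. scaleC c (u n)"]) (auto intro: assms tendsto_scaleC)
  qed
qed simp

text \<open>Midpoints stay in \<open>V\<close>, so the parallelogram law makes a minimising sequence
  Cauchy; at the minimiser, a move along the optimal multiple of \<open>w\<close> would shorten the
  distance unless the inner product vanishes.\<close>

lemma orthogonal_projection_exists:
  fixes V :: "('h::complex_hilbert) set"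
  assumes V: "closed_csubspace V"
  shows "\<exists>v\<in>V. \<forall>w\<in>V. cinner (x - v) w = 0"
proof -
  have clV: "closed V" and V0: "0 \<in> V" and Vadd: "\<And>u v. u \<in> V \<Longrightarrow> v \<in> V \<Longrightarrow> u + v \<in> V"
    and Vsc: "\<And>c u. u \<in> V \<Longrightarrow> scaleC c u \<in> V"
    using V unfolding closed_csubspace_def by auto
  define d where "d = (INF v\<in>V. (norm (x - v))\<^sup>2)"
  have bdd: "bdd_below ((\<lambda>v. (norm (x - v))\<^sup>2) ` V)"
    by (rule bdd_belowI[of _ 0]) auto
  have dle: "d \<le> (norm (x - v))\<^sup>2" if "v \<in> V" for v
    unfolding d_def using bdd that by (rule cINF_lower)
  have "\<exists>v\<in>V. (norm (x - v))\<^sup>2 < d + 1 / real (Suc n)" for n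
  proof (rule ccontr)
    assume "\<not> ?thesis"
    then have "d + 1 / real (Suc n) \<le> d"
      unfolding d_def[symmetric] by (subst (2) d_def, intro cINF_greatest) (use V0 in \<open>auto simp: not_less\<close>)
    then show False by simp
  qed
  then obtain u where uV: "\<And>n. u n \<in> V" and u: "\<And>n. (norm (x - u n))\<^sup>2 < d + 1 / real (Suc n)"
    by metis
  have dist: "(norm (u m - u n))\<^sup>2 \<le> 2 / real (Suc m) + 2 / real (Suc n)" for m n
  proof -
    let ?h = "scaleC (1/2) (u m + u n)"
    have h: "?h \<in> V" using uV Vadd Vsc by blast
    have "(x - u m) + (x - u n) = scaleC 2 (x - ?h)"
    proof -
      have "scaleC 2 ?h = u m + u n" by (simp add: scaleC_scaleC)
      moreover have "scaleC 2 x = x + x"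
        using scaleC_add_left[of 1 1 x] by simp
      ultimately show ?thesis by (simp add: scaleC_diff_right algebra_simps)
    qed
    then have "(norm ((x - u m) + (x - u n)))\<^sup>2 = 4 * (norm (x - ?h))\<^sup>2"
      by (simp add: norm_scaleC power_mult_distrib)
    then have "4 * d \<le> (norm ((x - u m) + (x - u n)))\<^sup>2" using dle[OF h] by simp
    moreover have "norm ((x - u m) - (x - u n)) = norm (u m - u n)"
      by (simp add: norm_minus_commute)
    ultimately show ?thesis
      using parallelogram[of "x - u m" "x - u n"] u[of m] u[of n] by simp
  qed
  have "Cauchy u"
  proof (rule metric_CauchyI)
    fix e :: real assume "e > 0"
    then obtain N where N: "inverse (real (Suc N)) < e\<^sup>2 / 4"
      using reals_Archimedean[of "e\<^sup>2 / 4"] by auto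
    show "\<exists>N. \<forall>m\<ge>N. \<forall>n\<ge>N. dist (u m) (u n) < e"
    proof (intro exI allI impI)
      fix m n assume mn: "N \<le> m" "N \<le> n"
      have le: "1 / real (Suc k) \<le> inverse (real (Suc N))" if "N \<le> k" for k
        using that by (simp add: field_simps)
      have "(norm (u m - u n))\<^sup>2 < e\<^sup>2"
        using dist[of m n] le[OF mn(1)] le[OF mn(2)] N by linarith
      then show "dist (u m) (u n) < e"
        using \<open>e > 0\<close> by (simp add: dist_norm power_less_imp_less_base)
    qed
  qed
  then obtain v where v: "u \<longlonglongrightarrow> v" using Cauchy_convergent convergent_def by blast
  have vV: "v \<in> V" using closed_sequentially[OF clV] uV v by blast
  have "(\<lambda>n. (norm (x - u n))\<^sup>2) \<longlonglongrightarrow> (norm (x - v))\<^sup>2" by (intro tendsto_intros v)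
  moreover have "(\<lambda>n. d + 1 / real (Suc n)) \<longlonglongrightarrow> d + 0"
    by (intro tendsto_intros LIMSEQ_Suc[OF lim_1_over_n])
  ultimately have vd: "(norm (x - v))\<^sup>2 \<le> d"
    using u by (intro LIMSEQ_le[where Y = "\<lambda>n. d + 1 / real (Suc n)"]) (auto intro: less_imp_le)
  show ?thesis
  proof (intro bexI[of _ v] ballI vV)
    fix w assume w: "w \<in> V"
    show "cinner (x - v) w = 0"
    proof (cases "w = 0")
      case False
      define c where "c = cinner (x - v) w / complex_of_real ((norm w)\<^sup>2)"
      have nw: "norm w > 0" using False by simp
      have "cinner (x - v) (scaleC c w) = complex_of_real ((cmod (cinner (x - v) w))\<^sup>2 / (norm w)\<^sup>2)"
        by (simp add: cinner_scaleC_right c_def complex_norm_square[symmetric] mult.commute)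
      then have 1: "Re (cinner (x - v) (scaleC c w)) = (cmod (cinner (x - v) w))\<^sup>2 / (norm w)\<^sup>2"
        by (simp only: Re_complex_of_real)
      have cc: "cmod c = cmod (cinner (x - v) w) / (norm w)\<^sup>2"
        by (simp add: c_def norm_divide del: of_real_power)
      have 2: "(norm (scaleC c w))\<^sup>2 = (cmod (cinner (x - v) w))\<^sup>2 / (norm w)\<^sup>2"
        using nw by (simp add: norm_scaleC cc power2_eq_square)
      have "v + scaleC c w \<in> V" using vV w Vadd Vsc by blast
      then have "d \<le> (norm (x - (v + scaleC c w)))\<^sup>2" by (rule dle)
      then have "(norm (x - v))\<^sup>2 \<le> (norm ((x - v) - scaleC c w))\<^sup>2"
        using vd by (simp only: diff_diff_eq)
      also have "\<dots> = (norm (x - v))\<^sup>2 - (cmod (cinner (x - v) w))\<^sup>2 / (norm w)\<^sup>2"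
        unfolding norm_diff_sq 1 2 by simp
      finally show ?thesis using nw by (simp add: field_simps)
    qed simp
  qed
qed

section \<open>Operators and adjoints\<close>

lemma clinearD: "A \<in> clinear_ops \<Longrightarrow> blinfun_apply A (scaleC c x) = scaleC c (blinfun_apply A x)"
  by (simp add: clinear_ops_def)

lemma Blinfun_clinear:
  fixes f :: "'h::complex_hilbert \<Rightarrow> 'h"
  assumes "\<And>x y. f (x + y) = f x + f y" "\<And>c x. f (scaleC c x) = scaleC c (f x)"
    "\<And>x. norm (f x) \<le> K * norm x"
  obtains A where "A \<in> clinear_ops" "\<And>x. blinfun_apply A x = f x"
proof -
  have "bounded_linear f"
  proof (rule bounded_linear_intro[where K = K])
    show "f (r *\<^sub>R x) = r *\<^sub>R f x" for r x
      by (simp add: scaleC_of_real[symmetric] assms)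
  qed (use assms in \<open>auto simp: mult.commute\<close>)
  then have "\<And>x. blinfun_apply (Blinfun f) x = f x"
    by (simp add: bounded_linear_Blinfun_apply)
  then show ?thesis using that[of "Blinfun f"] assms by (auto simp: clinear_ops_def)
qed

lemma ex_projection:
  fixes V :: "('h::complex_hilbert) set"
  assumes V: "closed_csubspace V"
  obtains P where "P \<in> clinear_ops" "\<And>x. blinfun_apply P x \<in> V"
    "\<And>x. x \<in> V \<Longrightarrow> blinfun_apply P x = x"
    "\<And>x w. w \<in> V \<Longrightarrow> cinner (x - blinfun_apply P x) w = 0" "is_adjoint P P"
proof -
  have Vadd: "\<And>u v. u \<in> V \<Longrightarrow> v \<in> V \<Longrightarrow> u + v \<in> V"
    and Vsc: "\<And>c u. u \<in> V \<Longrightarrow> scaleC c u \<in> V"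
    using V unfolding closed_csubspace_def by auto
  obtain p where pV: "\<And>x. p x \<in> V" and p: "\<And>x w. w \<in> V \<Longrightarrow> cinner (x - p x) w = 0"
    using orthogonal_projection_exists[OF V] by metis
  have uniq: "p x = v" if v: "v \<in> V" "\<And>w. w \<in> V \<Longrightarrow> cinner (x - v) w = 0" for x v
  proof -
    have d: "p x - v \<in> V" using closed_csubspace_diff[OF V pV v(1)] .
    have "cinner (p x - v) (p x - v) = cinner (x - v) (p x - v) - cinner (x - p x) (p x - v)"
      by (simp add: cinner_diff_left)
    then have "cinner (p x - v) (p x - v) = 0" using v(2)[OF d] p[OF d] by simp
    then show ?thesis by simp
  qed
  have add: "p (x + y) = p x + p y" for x y
  proof (rule uniq)
    fix w assume "w \<in> V"
    then show "cinner (x + y - (p x + p y)) w = 0"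
      using p[of w x] p[of w y] by (simp add: cinner_simps)
  qed (intro Vadd pV)
  have sc: "p (scaleC c x) = scaleC c (p x)" for c x
  proof (rule uniq)
    fix w assume "w \<in> V"
    then show "cinner (scaleC c x - scaleC c (p x)) w = 0"
      using p[of w x] by (simp add: cinner_simps)
  qed (intro Vsc pV)
  have bd: "norm (p x) \<le> 1 * norm x" for x
  proof -
    have "cinner x (p x) = cinner (p x) (p x)"
      using p[OF pV, of x x] by (simp add: cinner_simps)
    then have "(norm (p x))\<^sup>2 = cmod (cinner x (p x))"
      by (simp add: cinner_self norm_power)
    also have "\<dots> \<le> norm x * norm (p x)" by (rule cinner_Cauchy_Schwarz)
    finally show ?thesis by (cases "p x = 0") (auto simp: power2_eq_square)
  qed
  obtain P where P: "P \<in> clinear_ops" "\<And>x. blinfun_apply P x = p x"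
    using Blinfun_clinear[of p 1, OF add sc bd] by blast
  have sa: "is_adjoint P P" unfolding is_adjoint_def P(2)
  proof (intro allI)
    fix x y
    have "cinner (p x) y = cinner (p x) (p y)"
      using p[OF pV, of y x] cinner_commute[of "p x" "y - p y"] by (simp add: cinner_simps)
    also have "\<dots> = cinner x (p y)"
      using p[OF pV, of x y] by (simp add: cinner_simps)
    finally show "cinner (p x) y = cinner x (p y)" .
  qed
  show ?thesis
  proof (rule that[of P])
    show "blinfun_apply P x = x" if "x \<in> V" for x
      unfolding P(2) using uniq[OF that] by simp
  qed (use P pV p sa in auto)
qed

text \<open>A vector \<open>u\<close> orthogonal to the kernel spans its complement, since
  \<open>f u * x - f x * u\<close> always lies in the kernel.\<close>

lemma Riesz_representation:
  fixes f :: "'h::complex_hilbert \<Rightarrow> complex"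
  assumes "bounded_linear f" and fC: "\<And>c x. f (scaleC c x) = c * f x"
  shows "\<exists>z. \<forall>x. f x = cinner x z"
proof (cases "\<forall>x. f x = 0")
  case True
  then show ?thesis by (intro exI[of _ 0]) simp
next
  case False
  then obtain x0 where x0: "f x0 \<noteq> 0" by blast
  interpret bounded_linear f by fact
  let ?V = "{x. f x = 0}"
  have V: "closed_csubspace ?V"
    unfolding closed_csubspace_def
    by (auto simp: zero add fC intro!: closed_Collect_eq continuous_intros continuous_on)
  obtain v where v: "f v = 0" "\<And>w. f w = 0 \<Longrightarrow> cinner (x0 - v) w = 0"
    using orthogonal_projection_exists[OF V, of x0] by auto
  define u where "u = x0 - v"
  have fu: "f u \<noteq> 0" unfolding u_def using x0 v by (simp add: diff)
  have uw: "cinner u w = 0" if "f w = 0" for w using v that unfolding u_def by blast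
  have u0: "u \<noteq> 0" using fu zero by auto
  show ?thesis
  proof (intro exI allI)
    fix x
    have "f (scaleC (f u) x - scaleC (f x) u) = 0" by (simp add: diff fC)
    from uw[OF this] have "cnj (f u) * cinner u x = cnj (f x) * cinner u u"
      by (simp add: cinner_simps)
    then have "cnj (cnj (f u) * cinner u x) = cnj (cnj (f x) * cinner u u)" by simp
    then have "f u * cinner x u = f x * cinner u u"
      by (simp add: cinner_commute[of u x] cinner_self)
    then show "f x = cinner x (scaleC (cnj (f u / cinner u u)) u)"
      using u0 by (simp add: cinner_simps field_simps)
  qed
qed

lemma is_adjoint_unique: "is_adjoint A B \<Longrightarrow> is_adjoint A C \<Longrightarrow> B = C"
proof (rule blinfun_eqI)
  fix x assume *: "is_adjoint A B" "is_adjoint A C"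
  have "cinner (blinfun_apply B x) z = cinner (blinfun_apply C x) z" for z
    using * unfolding is_adjoint_def by (metis cinner_commute)
  then show "blinfun_apply B x = blinfun_apply C x" by (rule cinner_ext)
qed

lemma adj_eqI: "is_adjoint A B \<Longrightarrow> adj A = B"
  unfolding adj_def using is_adjoint_unique by blast

lemma is_adjoint_sym: "is_adjoint A B \<Longrightarrow> is_adjoint B A"
  unfolding is_adjoint_def by (metis cinner_commute)

lemma is_adjoint_clinear:
  assumes "is_adjoint A B" shows "B \<in> clinear_ops"
  unfolding clinear_ops_def
proof (clarify, rule cinner_ext)
  fix c x z
  show "cinner (blinfun_apply B (scaleC c x)) z = cinner (scaleC c (blinfun_apply B x)) z"
    using is_adjoint_sym[OF assms] unfolding is_adjoint_def by (simp add: cinner_simps)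
qed

lemma ex_adjoint:
  fixes A :: "('h::complex_hilbert) op"
  assumes A: "A \<in> clinear_ops"
  shows "\<exists>B. is_adjoint A B"
proof -
  have "\<exists>z. \<forall>x. cinner (blinfun_apply A x) y = cinner x z" for y
    by (rule Riesz_representation)
      (auto simp: clinearD[OF A] cinner_simps
        intro: bounded_linear_compose[OF bounded_linear_cinner_left] blinfun.bounded_linear_right)
  then obtain b where b: "\<And>x y. cinner (blinfun_apply A x) y = cinner x (b y)" by metis
  have b': "cinner (b y) x = cinner y (blinfun_apply A x)" for x y
    using b by (metis cinner_commute)
  have nb: "norm (b x) \<le> norm A * norm x" for x
  proof -
    have "(norm (b x))\<^sup>2 = cmod (cinner (b x) (b x))" by (simp add: cinner_self norm_power)
    also have "\<dots> = cmod (cinner x (blinfun_apply A (b x)))" by (simp add: b')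
    also have "\<dots> \<le> norm x * norm (blinfun_apply A (b x))" by (rule cinner_Cauchy_Schwarz)
    also have "\<dots> \<le> norm x * (norm A * norm (b x))"
      by (intro mult_left_mono norm_blinfun) simp
    finally show ?thesis by (cases "b x = 0") (auto simp: power2_eq_square field_simps)
  qed
  obtain B where "B \<in> clinear_ops" "\<And>x. blinfun_apply B x = b x"
  proof (rule Blinfun_clinear[of b "norm A"])
    show "b (x + y) = b x + b y" for x y
      by (rule cinner_ext) (simp add: b' cinner_simps)
    show "b (scaleC c x) = scaleC c (b x)" for c x
      by (rule cinner_ext) (simp add: b' cinner_simps)
  qed (use nb in auto)
  then show ?thesis using b unfolding is_adjoint_def by metis
qed

lemma is_adjoint_adj: "A \<in> clinear_ops \<Longrightarrow> is_adjoint A (adj A)"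
  using ex_adjoint adj_eqI by metis

lemma adj_clinear: "A \<in> clinear_ops \<Longrightarrow> adj A \<in> clinear_ops"
  using is_adjoint_adj is_adjoint_clinear by blast

lemma cinner_adj_right: "A \<in> clinear_ops \<Longrightarrow> cinner x (blinfun_apply (adj A) y) = cinner (blinfun_apply A x) y"
  using is_adjoint_adj unfolding is_adjoint_def by metis

lemma cinner_adj_left: "A \<in> clinear_ops \<Longrightarrow> cinner (blinfun_apply (adj A) x) y = cinner x (blinfun_apply A y)"
  using is_adjoint_sym[OF is_adjoint_adj] unfolding is_adjoint_def by metis

lemma adj_adj: "A \<in> clinear_ops \<Longrightarrow> adj (adj A) = A"
  using is_adjoint_sym[OF is_adjoint_adj] adj_eqI by blast

lemma clinear_add: "A \<in> clinear_ops \<Longrightarrow> B \<in> clinear_ops \<Longrightarrow> A + B \<in> clinear_ops"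
  by (simp add: clinear_ops_def blinfun.add_left scaleC_add_right)

lemma clinear_diff: "A \<in> clinear_ops \<Longrightarrow> B \<in> clinear_ops \<Longrightarrow> A - B \<in> clinear_ops"
  by (simp add: clinear_ops_def blinfun.diff_left scaleC_diff_right)

lemma clinear_mult: "A \<in> clinear_ops \<Longrightarrow> B \<in> clinear_ops \<Longrightarrow> A \<odot> B \<in> clinear_ops"
  by (simp add: clinear_ops_def)

lemma clinear_scalar: "scalar_op c \<in> clinear_ops"
  by (simp add: clinear_ops_def scaleC_scaleC mult.commute)

lemma clinear_id: "id_blinfun \<in> clinear_ops"
  by (simp add: clinear_ops_def)

lemma clinear_zero: "0 \<in> clinear_ops"
  by (simp add: clinear_ops_def)

lemmas clinear_intros = clinear_add clinear_diff clinear_mult clinear_scalar clinear_id clinear_zero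
  adj_clinear

lemma adj_mult: "A \<in> clinear_ops \<Longrightarrow> B \<in> clinear_ops \<Longrightarrow> adj (A \<odot> B) = adj B \<odot> adj A"
  by (rule adj_eqI) (simp add: is_adjoint_def cinner_adj_right)

lemma adj_add: "A \<in> clinear_ops \<Longrightarrow> B \<in> clinear_ops \<Longrightarrow> adj (A + B) = adj A + adj B"
  by (rule adj_eqI) (simp add: is_adjoint_def cinner_adj_right blinfun.add_left cinner_simps)

lemma adj_diff: "A \<in> clinear_ops \<Longrightarrow> B \<in> clinear_ops \<Longrightarrow> adj (A - B) = adj A - adj B"
  by (rule adj_eqI) (simp add: is_adjoint_def cinner_adj_right blinfun.diff_left cinner_simps)

lemma adj_scalar: "adj (scalar_op c) = scalar_op (cnj c)"
  by (rule adj_eqI) (simp add: is_adjoint_def cinner_simps)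

lemma adj_id: "adj id_blinfun = id_blinfun"
  by (rule adj_eqI) (simp add: is_adjoint_def)

lemma adj_zero: "adj 0 = 0"
  by (rule adj_eqI) (simp add: is_adjoint_def)

lemma adj_selfadjoint: "selfadjoint A \<Longrightarrow> adj A = A"
  by (simp add: selfadjoint_def adj_eqI)

lemma selfadjointI: "A \<in> clinear_ops \<Longrightarrow> adj A = A \<Longrightarrow> selfadjoint A"
  unfolding selfadjoint_def using is_adjoint_adj by metis

lemma norm_adj_le:
  assumes A: "A \<in> clinear_ops" shows "norm (adj A) \<le> norm A"
proof (rule norm_blinfun_bound)
  fix x
  let ?y = "blinfun_apply (adj A) x"
  have "(norm ?y)\<^sup>2 = cmod (cinner ?y ?y)" by (simp add: cinner_self norm_power)
  also have "\<dots> = cmod (cinner x (blinfun_apply A ?y))" by (simp add: cinner_adj_left A)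
  also have "\<dots> \<le> norm x * norm (blinfun_apply A ?y)" by (rule cinner_Cauchy_Schwarz)
  also have "\<dots> \<le> norm x * (norm A * norm ?y)"
    by (intro mult_left_mono norm_blinfun) simp
  finally show "norm ?y \<le> norm A * norm x"
    by (cases "?y = 0") (auto simp: power2_eq_square field_simps)
qed simp

lemma op_assoc: "(A \<odot> B) \<odot> C = A \<odot> (B \<odot> C)"
  by (rule blinfun_eqI) simp

lemma op_add_left: "(A + B) \<odot> C = A \<odot> C + B \<odot> C"
  by (rule blinfun_eqI) (simp add: blinfun.add_left)

lemma op_add_right: "A \<odot> (B + C) = A \<odot> B + A \<odot> C"
  by (rule blinfun_eqI) (simp add: blinfun.add_left blinfun.add_right)

lemma op_diff_left: "(A - B) \<odot> C = A \<odot> C - B \<odot> C"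
  by (rule blinfun_eqI) (simp add: blinfun.diff_left)

lemma op_diff_right: "A \<odot> (B - C) = A \<odot> B - A \<odot> C"
  by (rule blinfun_eqI) (simp add: blinfun.diff_left blinfun.diff_right)

lemma op_id_left [simp]: "id_blinfun \<odot> A = A"
  by (rule blinfun_eqI) simp

lemma op_id_right [simp]: "A \<odot> id_blinfun = A"
  by (rule blinfun_eqI) simp

lemma op_zero_left [simp]: "0 \<odot> A = 0"
  by (rule blinfun_eqI) simp

lemma op_zero_right [simp]: "A \<odot> 0 = 0"
  by (rule blinfun_eqI) simp

lemma op_sum_left: "(\<Sum>i\<in>I. f i) \<odot> A = (\<Sum>i\<in>I. f i \<odot> A)"
  by (induction I rule: infinite_finite_induct) (simp_all add: op_add_left)

lemma op_sum_right: "A \<odot> (\<Sum>i\<in>I. f i) = (\<Sum>i\<in>I. A \<odot> f i)"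
  by (induction I rule: infinite_finite_induct) (simp_all add: op_add_right)

lemma scalar_commute: "A \<in> clinear_ops \<Longrightarrow> A \<odot> scalar_op c = scalar_op c \<odot> A"
  by (rule blinfun_eqI) (simp add: clinearD)

lemma scalar_one: "scalar_op 1 = id_blinfun"
  by (rule blinfun_eqI) simp

lemma scalar_zero: "scalar_op 0 = 0"
  by (rule blinfun_eqI) simp

lemma scalar_mult: "scalar_op a \<odot> scalar_op b = scalar_op (a * b)"
  by (rule blinfun_eqI) (simp add: scaleC_scaleC)

lemma scalar_add: "scalar_op a + scalar_op b = scalar_op (a + b)"
  by (rule blinfun_eqI) (simp add: scaleC_add_left blinfun.add_left)

lemma scalar_uminus_one: "scalar_op (-1) \<odot> A = - A"
  by (rule blinfun_eqI) (simp add: scaleC_minus_one blinfun.minus_left)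

lemma norm_op_mult: "norm (A \<odot> B) \<le> norm A * norm B"
  by (rule norm_blinfun_compose)

lemma tendsto_op_mult: "f \<longlonglongrightarrow> A \<Longrightarrow> g \<longlonglongrightarrow> B \<Longrightarrow> (\<lambda>n. f n \<odot> g n) \<longlonglongrightarrow> A \<odot> B"
  by (rule bounded_bilinear.tendsto[OF bounded_bilinear_blinfun_compose])

lemma tendsto_blinfun_apply: "f \<longlonglongrightarrow> A \<Longrightarrow> (\<lambda>n. blinfun_apply (f n) x) \<longlonglongrightarrow> blinfun_apply A x"
  by (intro tendsto_intros)

lemma clinear_limit:
  assumes "\<And>n. A n \<in> clinear_ops" "\<And>x. (\<lambda>n. blinfun_apply (A n) x) \<longlonglongrightarrow> blinfun_apply B x"
  shows "B \<in> clinear_ops"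
  unfolding clinear_ops_def
proof (clarify)
  fix c x
  have "(\<lambda>n. blinfun_apply (A n) (scaleC c x)) \<longlonglongrightarrow> scaleC c (blinfun_apply B x)"
    using assms(1) by (simp add: clinearD tendsto_scaleC assms(2))
  then show "blinfun_apply B (scaleC c x) = scaleC c (blinfun_apply B x)"
    using assms(2) LIMSEQ_unique by blast
qed

section \<open>Commutants\<close>

lemma commutantD: "B \<in> commutant S \<Longrightarrow> A \<in> S \<Longrightarrow> A \<odot> B = B \<odot> A"
  by (simp add: commutant_def)

lemma commutant_clinear: "commutant S \<subseteq> clinear_ops"
  by (auto simp: commutant_def)

lemma commutant_add: "A \<in> commutant S \<Longrightarrow> B \<in> commutant S \<Longrightarrow> A + B \<in> commutant S"
  by (auto simp: commutant_def op_add_left op_add_right clinear_add)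

lemma commutant_diff: "A \<in> commutant S \<Longrightarrow> B \<in> commutant S \<Longrightarrow> A - B \<in> commutant S"
  by (auto simp: commutant_def op_diff_left op_diff_right clinear_diff)

lemma commutant_mult: "A \<in> commutant S \<Longrightarrow> B \<in> commutant S \<Longrightarrow> A \<odot> B \<in> commutant S"
  by (auto simp: commutant_def clinear_mult) (metis op_assoc)

lemma commutant_scalar: "S \<subseteq> clinear_ops \<Longrightarrow> scalar_op c \<in> commutant S"
  by (auto simp: commutant_def clinear_scalar scalar_commute)

lemma commutant_limit:
  assumes A: "\<And>n. A n \<in> commutant S"
    and lim: "\<And>x. (\<lambda>n. blinfun_apply (A n) x) \<longlonglongrightarrow> blinfun_apply B x"
  shows "B \<in> commutant S"
  unfolding commutant_def
proof (clarify, intro conjI ballI)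
  show "B \<in> clinear_ops" using clinear_limit[of A, OF _ lim] A commutant_clinear by blast
  fix C assume C: "C \<in> S"
  show "C \<odot> B = B \<odot> C"
  proof (rule blinfun_eqI)
    fix x
    have "blinfun_apply C (blinfun_apply (A n) x) = blinfun_apply (A n) (blinfun_apply C x)" for n
      using commutantD[OF A C] by (metis blinfun_apply_blinfun_compose)
    moreover have "(\<lambda>n. blinfun_apply C (blinfun_apply (A n) x)) \<longlonglongrightarrow> blinfun_apply C (blinfun_apply B x)"
      by (intro tendsto_intros lim)
    ultimately have "(\<lambda>n. blinfun_apply (A n) (blinfun_apply C x)) \<longlonglongrightarrow> blinfun_apply C (blinfun_apply B x)"
      by simp
    then show "blinfun_apply (C \<odot> B) x = blinfun_apply (B \<odot> C) x"
      using LIMSEQ_unique[OF _ lim[of "blinfun_apply C x"]] by simp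
  qed
qed

lemma commutant_antimono: "S \<subseteq> T \<Longrightarrow> commutant T \<subseteq> commutant S"
  by (auto simp: commutant_def)

lemma subset_bicommutant: "S \<subseteq> clinear_ops \<Longrightarrow> S \<subseteq> commutant (commutant S)"
  by (auto simp: commutant_def)

lemma commutant_bicommutant:
  "S \<subseteq> clinear_ops \<Longrightarrow> commutant (commutant (commutant S)) = commutant S"
  by (intro equalityI commutant_antimono subset_bicommutant commutant_clinear)

lemma commutant_adj:
  assumes S: "S \<subseteq> clinear_ops" "\<And>A. A \<in> S \<Longrightarrow> adj A \<in> S" and B: "B \<in> commutant S"
  shows "adj B \<in> commutant S"
  unfolding commutant_def
proof (clarify, intro conjI ballI)
  have Bc: "B \<in> clinear_ops" using B commutant_clinear by blast
  then show "adj B \<in> clinear_ops" by (rule adj_clinear)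
  fix A assume A: "A \<in> S"
  have Ac: "A \<in> clinear_ops" "adj A \<in> clinear_ops" using A S by auto
  have "adj A \<odot> B = B \<odot> adj A" using commutantD[OF B] S A by blast
  then have "adj (adj A \<odot> B) = adj (B \<odot> adj A)" by simp
  then show "A \<odot> adj B = adj B \<odot> A" by (simp add: adj_mult Ac Bc adj_adj)
qed

lemma bicommutant_von_neumann:
  assumes S: "S \<subseteq> clinear_ops" "\<And>A. A \<in> S \<Longrightarrow> adj A \<in> S"
  shows "von_neumann_algebra (commutant (commutant S))"
  unfolding von_neumann_algebra_def
proof (intro conjI ballI)
  show "\<exists>B\<in>commutant (commutant S). is_adjoint A B" if "A \<in> commutant (commutant S)" for A
    using commutant_adj[OF commutant_clinear _ that] commutant_adj[OF S] that
      commutant_clinear is_adjoint_adj by blast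
qed (use commutant_clinear commutant_bicommutant[OF commutant_clinear] in blast)+

lemma vN_generated_subset_bicommutant:
  assumes "S \<subseteq> clinear_ops" "\<And>A. A \<in> S \<Longrightarrow> adj A \<in> S"
  shows "vN_generated S \<subseteq> commutant (commutant S)"
  unfolding vN_generated_def
  using bicommutant_von_neumann[OF assms] subset_bicommutant[OF assms(1)] by blast

section \<open>Bounded Borel functions on an interval\<close>

text \<open>With \<open>r = norm D0\<close> this is the domain of the functional calculus. Nothing
  bounds the values outside the interval, so the induction rules below need a way to change a
  function there.\<close>

definition bdd_borel :: "real \<Rightarrow> (real \<Rightarrow> complex) set" where
  "bdd_borel r = {f \<in> borel_measurable borel. bounded (f ` {-r..r})}"

lemma bdd_borelI:
  "f \<in> borel_measurable borel \<Longrightarrow> (\<And>t. t \<in> {-r..r} \<Longrightarrow> cmod (f t) \<le> C) \<Longrightarrow> f \<in> bdd_borel r"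
  by (auto simp: bdd_borel_def bounded_iff intro!: exI[of _ C])

lemma bdd_borelE:
  assumes "f \<in> bdd_borel r"
  obtains C where "C \<ge> 0" "\<And>t. t \<in> {-r..r} \<Longrightarrow> cmod (f t) \<le> C"
proof -
  obtain C where "\<forall>x\<in>f ` {-r..r}. norm x \<le> C" using assms by (auto simp: bdd_borel_def bounded_iff)
  then show ?thesis by (intro that[of "max C 0"]) (auto simp: max.coboundedI1)
qed

lemma bdd_borel_measurable: "f \<in> bdd_borel r \<Longrightarrow> f \<in> borel_measurable borel"
  by (simp add: bdd_borel_def)

lemma bdd_borel_const: "(\<lambda>_. c) \<in> bdd_borel r"
  by (rule bdd_borelI) auto

lemma bdd_borel_of_real:
  assumes "f \<in> borel_measurable borel" "\<And>t. t \<in> {-r..r} \<Longrightarrow> \<bar>f t\<bar> \<le> C"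
  shows "(\<lambda>t. complex_of_real (f t)) \<in> bdd_borel r"
  by (rule bdd_borelI[of _ _ C]) (use assms in auto)

lemma bdd_borel_indicator: "A \<in> sets borel \<Longrightarrow> indicator A \<in> bdd_borel r"
  by (rule bdd_borelI[of _ _ 1]) (auto simp: indicator_def)

lemma bdd_borel_power: "(\<lambda>t. complex_of_real t ^ k) \<in> bdd_borel r"
proof (rule bdd_borelI[of _ _ "\<bar>r\<bar> ^ k"])
  show "cmod (complex_of_real t ^ k) \<le> \<bar>r\<bar> ^ k" if "t \<in> {- r..r}" for t
    using that by (auto simp: norm_power intro!: power_mono)
qed simp

lemma bdd_borel_add:
  assumes "f \<in> bdd_borel r" "g \<in> bdd_borel r" shows "(\<lambda>t. f t + g t) \<in> bdd_borel r"
proof -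
  obtain C D where "\<And>t. t \<in> {-r..r} \<Longrightarrow> cmod (f t) \<le> C" "\<And>t. t \<in> {-r..r} \<Longrightarrow> cmod (g t) \<le> D"
    using assms bdd_borelE by meson
  then show ?thesis using assms
    by (intro bdd_borelI[of _ _ "C + D"])
      (auto simp: bdd_borel_def intro!: order_trans[OF norm_triangle_ineq] add_mono)
qed

lemma bdd_borel_mult:
  assumes "f \<in> bdd_borel r" "g \<in> bdd_borel r" shows "(\<lambda>t. f t * g t) \<in> bdd_borel r"
proof -
  obtain C where "C \<ge> 0" "\<And>t. t \<in> {-r..r} \<Longrightarrow> cmod (f t) \<le> C"
    using assms(1) bdd_borelE by blast
  moreover obtain D where "\<And>t. t \<in> {-r..r} \<Longrightarrow> cmod (g t) \<le> D"
    using assms(2) bdd_borelE by blast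
  ultimately show ?thesis using assms
    by (intro bdd_borelI[of _ _ "C * D"])
      (auto simp: bdd_borel_def norm_mult intro!: mult_mono)
qed

lemma bdd_borel_cmult: "f \<in> bdd_borel r \<Longrightarrow> (\<lambda>t. c * f t) \<in> bdd_borel r"
  by (rule bdd_borel_mult[OF bdd_borel_const])

lemma bdd_borel_uminus: "f \<in> bdd_borel r \<Longrightarrow> (\<lambda>t. - f t) \<in> bdd_borel r"
  using bdd_borel_cmult[of f r "-1"] by simp

lemma bdd_borel_diff: "f \<in> bdd_borel r \<Longrightarrow> g \<in> bdd_borel r \<Longrightarrow> (\<lambda>t. f t - g t) \<in> bdd_borel r"
  using bdd_borel_add[OF _ bdd_borel_uminus] by simp

lemma bdd_borel_cnj:
  assumes "f \<in> bdd_borel r" shows "(\<lambda>t. cnj (f t)) \<in> bdd_borel r"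
proof -
  obtain C where "\<And>t. t \<in> {-r..r} \<Longrightarrow> cmod (f t) \<le> C" using bdd_borelE[OF assms] by blast
  moreover have "(\<lambda>t. cnj (f t)) \<in> borel_measurable borel"
    by (rule measurable_compose[OF bdd_borel_measurable[OF assms]])
      (intro borel_measurable_continuous_onI continuous_intros)
  ultimately show ?thesis by (intro bdd_borelI[of _ _ C]) auto
qed

lemma bdd_borel_sum:
  "(\<And>i. i \<in> I \<Longrightarrow> f i \<in> bdd_borel r) \<Longrightarrow> (\<lambda>t. \<Sum>i\<in>I. f i t) \<in> bdd_borel r"
  by (induction I rule: infinite_finite_induct) (auto intro: bdd_borel_const bdd_borel_add)

lemma bdd_borel_Re:
  assumes "f \<in> bdd_borel r" shows "(\<lambda>t. complex_of_real (Re (f t))) \<in> bdd_borel r"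
proof -
  obtain C where C: "\<And>t. t \<in> {-r..r} \<Longrightarrow> cmod (f t) \<le> C" using bdd_borelE[OF assms] by blast
  show ?thesis using bdd_borel_measurable[OF assms]
    by (intro bdd_borel_of_real[of _ _ C] order_trans[OF abs_Re_le_cmod C]) auto
qed

lemma bdd_borel_Im:
  assumes "f \<in> bdd_borel r" shows "(\<lambda>t. complex_of_real (Im (f t))) \<in> bdd_borel r"
proof -
  obtain C where C: "\<And>t. t \<in> {-r..r} \<Longrightarrow> cmod (f t) \<le> C" using bdd_borelE[OF assms] by blast
  show ?thesis using bdd_borel_measurable[OF assms]
    by (intro bdd_borel_of_real[of _ _ C] order_trans[OF abs_Im_le_cmod C]) auto
qed

lemmas bdd_borel_intros = bdd_borel_const bdd_borel_indicator bdd_borel_power bdd_borel_add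
  bdd_borel_mult bdd_borel_uminus bdd_borel_diff bdd_borel_cnj bdd_borel_sum

text \<open>A monotone class argument on positive and negative parts of real and imaginary part. The
  increasing case offers limits bounded on the whole line, which a function in
  \<open>bdd_borel r\<close> need not be; \<open>cong\<close> bridges the gap.\<close>

lemma bdd_borel_induct_indicator [consumes 1, case_names indicator add cmult cong increasing]:
  fixes P :: "(real \<Rightarrow> complex) \<Rightarrow> bool"
  assumes f: "f \<in> bdd_borel r"
    and ind: "\<And>A. A \<in> sets borel \<Longrightarrow> P (indicator A)"
    and add: "\<And>f g. f \<in> bdd_borel r \<Longrightarrow> g \<in> bdd_borel r \<Longrightarrow> P f \<Longrightarrow> P g \<Longrightarrow> P (\<lambda>t. f t + g t)"
    and cmult: "\<And>c f. f \<in> bdd_borel r \<Longrightarrow> P f \<Longrightarrow> P (\<lambda>t. c * f t)"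
    and cong: "\<And>f g. P g \<Longrightarrow> f \<in> bdd_borel r \<Longrightarrow> g \<in> bdd_borel r \<Longrightarrow>
        (\<And>t. t \<in> {-r..r} \<Longrightarrow> f t = g t) \<Longrightarrow> P f"
    and incr: "\<And>u f C. (\<And>n::nat. u n \<in> borel_measurable borel) \<Longrightarrow> f \<in> borel_measurable borel \<Longrightarrow>
        (\<And>n t. 0 \<le> u n t) \<Longrightarrow> (\<And>n t. u n t \<le> u (Suc n) t) \<Longrightarrow> (\<And>n t. u n t \<le> f t) \<Longrightarrow>
        (\<And>t. f t \<le> C) \<Longrightarrow> (\<And>t. (\<lambda>n. u n t) \<longlonglongrightarrow> f t) \<Longrightarrow>
        (\<And>n. P (\<lambda>t. complex_of_real (u n t))) \<Longrightarrow> P (\<lambda>t. complex_of_real (f t))"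
  shows "P f"
proof -
  have P0: "P (\<lambda>_. 0)" using cmult[OF bdd_borel_indicator ind, of "{}" 0] by simp
  have nonneg: "(\<exists>C. \<forall>t. g t \<le> C) \<Longrightarrow> P (\<lambda>t. complex_of_real (g t))"
    if um: "g \<in> borel_measurable borel" and "\<And>t. 0 \<le> g t" for g :: "real \<Rightarrow> real"
    using that
  proof (induction rule: borel_measurable_induct_real)
    case (set A)
    have "indicator A = (\<lambda>t. complex_of_real (indicator A t))"
      by (auto simp: indicator_def fun_eq_iff)
    then show ?case using ind[of A] set by simp
  next
    case (mult u c)
    show ?case
    proof (cases "c = 0")
      case True then show ?thesis using P0 by simp
    next
      case False
      then have c: "c > 0" using mult by simp
      obtain C where C: "\<And>t. c * u t \<le> C" using mult.prems by blast
      have uC: "u t \<le> C / c" for t using C[of t] c by (simp add: field_simps)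
      have "P (\<lambda>t. complex_of_real c * complex_of_real (u t))"
        using mult uC by (intro cmult bdd_borel_of_real[of _ _ "C / c"]) auto
      then show ?thesis by simp
    qed
  next
    case (add u v)
    then obtain C where C: "\<And>t. v t + u t \<le> C" by blast
    have nn: "0 \<le> u t" "0 \<le> v t" for t using add.hyps by auto
    have b: "v t \<le> C" "u t \<le> C" for t using C[of t] nn[of t] by linarith+
    have "P (\<lambda>t. complex_of_real (v t) + complex_of_real (u t))"
      using add b nn by (intro assms(3) bdd_borel_of_real[of _ _ C]) auto
    then show ?case by simp
  next
    case (seq U)
    then obtain C where C: "\<And>t. g t \<le> C" by blast
    have Uinc: "U i t \<le> U j t" if "i \<le> j" for i j t
      using \<open>incseq U\<close> that by (auto simp: incseq_def le_fun_def)
    have Ulim: "(\<lambda>i. U i t) \<longlonglongrightarrow> g t" for t using seq.hyps by simp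
    have Ug: "U i t \<le> g t" for i t
      by (rule incseq_le[OF _ Ulim]) (simp add: incseq_def Uinc)
    have PU: "P (\<lambda>t. complex_of_real (U n t))" for n
      using seq.IH[of n] Ug C order_trans by meson
    show ?case
      by (rule incr[of U _ C]) (use seq.hyps seq.prems Ug C Ulim Uinc PU um in auto)
  qed
  have real: "P (\<lambda>t. complex_of_real (g t))"
    if g: "g \<in> borel_measurable borel" and b: "\<And>t. t \<in> {-r..r} \<Longrightarrow> \<bar>g t\<bar> \<le> C" for g :: "real \<Rightarrow> real" and C
  proof -
    \<comment> \<open>Cutting off outside the interval makes both parts bounded everywhere, as the
      increasing case requires.\<close>
    define p where "p t = indicator {-r..r} t * max 0 (g t)" for t
    define q where "q t = indicator {-r..r} t * max 0 (- g t)" for t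
    have m: "p \<in> borel_measurable borel" "q \<in> borel_measurable borel"
      using g unfolding p_def q_def by measurable
    have pq0: "0 \<le> p t" "0 \<le> q t" for t by (auto simp: p_def q_def)
    have pqC: "p t \<le> max C 0" "q t \<le> max C 0" for t
      using b[of t] by (auto simp: p_def q_def indicator_def)
    have bb: "(\<lambda>t. complex_of_real (p t)) \<in> bdd_borel r" "(\<lambda>t. complex_of_real (q t)) \<in> bdd_borel r"
      using m pq0 pqC by (auto intro!: bdd_borel_of_real[of _ _ "max C 0"])
    have "P (\<lambda>t. complex_of_real (p t) + (-1) * complex_of_real (q t))"
      using pqC by (intro add cmult bdd_borel_cmult bb nonneg m pq0) blast+
    then show ?thesis
    proof (rule cong)
      show "(\<lambda>t. complex_of_real (g t)) \<in> bdd_borel r" using g b by (rule bdd_borel_of_real)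
      show "(\<lambda>t. complex_of_real (p t) + - 1 * complex_of_real (q t)) \<in> bdd_borel r"
        by (intro bdd_borel_add bdd_borel_cmult bb)
      show "complex_of_real (g t) = complex_of_real (p t) + - 1 * complex_of_real (q t)"
        if "t \<in> {-r..r}" for t
        using that by (cases "g t \<ge> 0") (simp_all add: p_def q_def)
    qed
  qed
  obtain C where C: "\<And>t. t \<in> {-r..r} \<Longrightarrow> cmod (f t) \<le> C" using bdd_borelE[OF f] by blast
  have fm: "f \<in> borel_measurable borel" using f by (rule bdd_borel_measurable)
  have "P (\<lambda>t. complex_of_real (Re (f t)) + \<i> * complex_of_real (Im (f t)))"
    using C fm order_trans[OF abs_Re_le_cmod] order_trans[OF abs_Im_le_cmod]
    by (intro add cmult bdd_borel_cmult bdd_borel_Re bdd_borel_Im f real[of _ C]) auto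
  then show ?thesis by (simp add: complex_eq[symmetric])
qed

text \<open>Weierstrass approximation reaches the continuous functions, increasing limits the
  indicators of half-lines, and Dynkin's lemma all Borel sets.\<close>
lemma bdd_borel_induct [consumes 1, case_names power add cmult uniform increasing]:
  fixes P :: "(real \<Rightarrow> complex) \<Rightarrow> bool"
  assumes f: "f \<in> bdd_borel r"
    and power: "\<And>k. P (\<lambda>t. complex_of_real t ^ k)"
    and add: "\<And>f g. f \<in> bdd_borel r \<Longrightarrow> g \<in> bdd_borel r \<Longrightarrow> P f \<Longrightarrow> P g \<Longrightarrow> P (\<lambda>t. f t + g t)"
    and cmult: "\<And>c f. f \<in> bdd_borel r \<Longrightarrow> P f \<Longrightarrow> P (\<lambda>t. c * f t)"
    and unif: "\<And>u f. (\<And>n. u n \<in> bdd_borel r) \<Longrightarrow> f \<in> bdd_borel r \<Longrightarrow> (\<And>n. P (u n)) \<Longrightarrow>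
        (\<And>n t. t \<in> {-r..r} \<Longrightarrow> cmod (f t - u n t) \<le> 1 / real (Suc n)) \<Longrightarrow> P f"
    and incr: "\<And>u f C. (\<And>n::nat. u n \<in> borel_measurable borel) \<Longrightarrow> f \<in> borel_measurable borel \<Longrightarrow>
        (\<And>n t. 0 \<le> u n t) \<Longrightarrow> (\<And>n t. u n t \<le> u (Suc n) t) \<Longrightarrow> (\<And>n t. u n t \<le> f t) \<Longrightarrow>
        (\<And>t. f t \<le> C) \<Longrightarrow> (\<And>t. (\<lambda>n. u n t) \<longlonglongrightarrow> f t) \<Longrightarrow>
        (\<And>n. P (\<lambda>t. complex_of_real (u n t))) \<Longrightarrow> P (\<lambda>t. complex_of_real (f t))"
  shows "P f"
proof -
  \<comment> \<open>A constant sequence turns the uniform case into a congruence on the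
    interval.\<close>
  have cong: "P f" if "P g" "f \<in> bdd_borel r" "g \<in> bdd_borel r" "\<And>t. t \<in> {-r..r} \<Longrightarrow> f t = g t" for f g
    using that by (intro unif[of "\<lambda>_. g" f]) auto
  have P0: "P (\<lambda>_. 0)" using cmult[OF bdd_borel_power power, of 0] by simp
  have P1: "P (\<lambda>_. 1)" using power[of 0] by simp
  have sum: "P (\<lambda>t. \<Sum>i\<in>I. f i t)" if "\<And>i. i \<in> I \<Longrightarrow> f i \<in> bdd_borel r \<and> P (f i)"
    for I :: "nat set" and f
    using that
    by (induction I rule: infinite_finite_induct) (auto intro!: P0 add bdd_borel_sum)
  have cont: "P (\<lambda>t. complex_of_real (g t))" if g: "continuous_on UNIV g" for g :: "real \<Rightarrow> real"
  proof -
    have gc: "continuous_on {-r..r} g" by (rule continuous_on_subset[OF g]) simp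
    have "\<exists>p. real_polynomial_function p \<and> (\<forall>t\<in>{-r..r}. \<bar>g t - p t\<bar> < 1 / real (Suc n))" for n
    proof -
      have "0 < 1 / real (Suc n)" by simp
      from Stone_Weierstrass_real_polynomial_function[OF compact_Icc gc this]
      obtain p where "real_polynomial_function p" "\<And>t. t \<in> {-r..r} \<Longrightarrow> \<bar>g t - p t\<bar> < 1 / real (Suc n)" by blast
      then show ?thesis by (intro exI[of _ p]) simp
    qed
    then obtain p where p: "\<And>n. real_polynomial_function (p n)"
      "\<And>n t. t \<in> {-r..r} \<Longrightarrow> \<bar>g t - p n t\<bar> < 1 / real (Suc n)" by metis
    have pP: "P (\<lambda>t. complex_of_real (p n t)) \<and> (\<lambda>t. complex_of_real (p n t)) \<in> bdd_borel r" for n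
    proof -
      obtain a N where pn: "p n = (\<lambda>x. \<Sum>i\<le>N. a i * x ^ i)"
        using p(1)[of n] unfolding real_polynomial_function_iff_sum by blast
      have eq: "(\<lambda>t. complex_of_real (p n t)) = (\<lambda>t. \<Sum>i\<le>N. complex_of_real (a i) * complex_of_real t ^ i)"
        by (simp add: pn)
      show ?thesis unfolding eq
        by (auto intro!: sum cmult power bdd_borel_intros bdd_borel_cmult)
    qed
    obtain B where "\<forall>x\<in>g ` {-r..r}. norm x \<le> B"
      using compact_imp_bounded[OF compact_continuous_image[OF gc compact_Icc]]
      unfolding bounded_iff by blast
    then have B: "\<And>t. t \<in> {-r..r} \<Longrightarrow> \<bar>g t\<bar> \<le> B" by simp
    show ?thesis
    proof (rule unif[of "\<lambda>n t. complex_of_real (p n t)"])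
      show "(\<lambda>t. complex_of_real (g t)) \<in> bdd_borel r"
        by (rule bdd_borel_of_real[OF borel_measurable_continuous_onI[OF g] B])
      show "cmod (complex_of_real (g t) - complex_of_real (p n t)) \<le> 1 / real (Suc n)"
        if "t \<in> {-r..r}" for n t
        using p(2)[OF that, of n] by (simp only: of_real_diff[symmetric] norm_of_real less_imp_le)
    qed (use pP in auto)
  qed
  have ind: "P (indicator A)" if "A \<in> sets borel" for A :: "real set"
  proof -
    have "A \<in> sigma_sets UNIV (range lessThan)"
      using that by (subst (asm) borel_Iio) simp
    then have "P (\<lambda>t. complex_of_real (indicator A t))"
    proof (induction rule: sigma_sets_induct_disjoint[rotated 2, consumes 1, case_names basic empty compl union])
      show "Int_stable (range (lessThan :: real \<Rightarrow> real set))"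
      proof (rule Int_stableI)
        fix a b assume "a \<in> range (lessThan :: real \<Rightarrow> real set)" "b \<in> range (lessThan :: real \<Rightarrow> real set)"
        then obtain s t where "a = {..<s}" "b = {..<t}" by auto
        then have "a \<inter> b = {..<min s t}" by auto
        then show "a \<inter> b \<in> range lessThan" by blast
      qed
    next
      case (basic A)
      then obtain c where A: "A = {..<c}" by auto
      \<comment> \<open>Continuous ramps of slope \<open>n\<close> increase to the indicator. They
        vanish at \<open>t = c\<close>, which is why open half-lines are taken as
        generators.\<close>
      show ?case unfolding A
      proof (rule incr[where C = 1 and u = "\<lambda>n t. min 1 (real n * max 0 (c - t))"])
        show "P (\<lambda>t. complex_of_real (min 1 (real n * max 0 (c - t))))" for n
          by (rule cont) (intro continuous_intros)
        show "min 1 (real n * max 0 (c - t)) \<le> min 1 (real (Suc n) * max 0 (c - t))" for n t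
          by (intro min.mono mult_right_mono) auto
        show "min 1 (real n * max 0 (c - t)) \<le> indicator {..<c} t" for n t
          by (auto simp: indicator_def)
        show "(\<lambda>n. min 1 (real n * max 0 (c - t))) \<longlonglongrightarrow> indicator {..<c} t" for t
        proof (cases "t < c")
          case True
          obtain N where N: "1 / (c - t) < real N" using reals_Archimedean2 by blast
          have "min 1 (real n * max 0 (c - t)) = 1" if "n \<ge> N" for n
          proof -
            have "1 / (c - t) \<le> real n" using N that by linarith
            then have "1 \<le> real n * (c - t)" using True by (simp add: field_simps)
            then show ?thesis using True by simp
          qed
          then show ?thesis using True
            by (intro tendsto_eventually eventually_sequentiallyI[of N]) auto
        qed auto
      qed auto
    next
      case (compl A)
      then have "A \<in> sets borel" by (subst borel_Iio) simp
      then have m: "(\<lambda>t. complex_of_real (indicator A t)) \<in> bdd_borel r"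
        by (intro bdd_borel_of_real[of _ _ 1]) (auto simp: indicator_def)
      have "P (\<lambda>t. 1 + (-1) * complex_of_real (indicator A t))"
        by (intro add cmult compl P1 bdd_borel_const bdd_borel_cmult m)
      also have "(\<lambda>t. 1 + (-1) * complex_of_real (indicator A t)) = (\<lambda>t. complex_of_real (indicator (UNIV - A) t))"
        by (auto simp: indicator_def)
      finally show ?case .
    next
      case (union A)
      have Ab: "A i \<in> sets borel" for i using union by (subst borel_Iio) auto
      show ?case
      proof (rule incr[where C = 1 and u = "\<lambda>n t. \<Sum>i<n. indicator (A i) t"])
        show "P (\<lambda>t. complex_of_real (\<Sum>i<n. indicator (A i) t))" for n
          unfolding of_real_sum using union.IH
          by (intro sum conjI bdd_borel_of_real[of _ _ 1] borel_measurable_indicator Ab) auto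
        have eq: "(\<Sum>i<n. indicator (A i) t) = (indicator (\<Union>i<n. A i) t :: real)" for n t
          by (rule indicator_UN_disjoint[symmetric])
            (use union.hyps in \<open>auto intro: disjoint_family_on_mono\<close>)
        show "(\<Sum>i<n. indicator (A i) t) \<le> (indicator (\<Union>i. A i) t :: real)" for n t
          unfolding eq by (auto simp: indicator_def)
        show "(\<lambda>n. \<Sum>i<n. indicator (A i) t :: real) \<longlonglongrightarrow> indicator (\<Union>i. A i) t" for t
          unfolding eq by (rule LIMSEQ_indicator_UN)
        show "(\<lambda>t. \<Sum>i<n. indicator (A i) t :: real) \<in> borel_measurable borel" for n
          by (intro borel_measurable_sum borel_measurable_indicator Ab)
        show "(\<lambda>t. indicator (\<Union>i. A i) t :: real) \<in> borel_measurable borel"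
          by (intro borel_measurable_indicator sets.countable_UN) (use Ab in auto)
      qed (simp_all add: sum_nonneg indicator_le_1)
    qed (use P0 in auto)
    moreover have "indicator A = (\<lambda>t. complex_of_real (indicator A t))"
      by (auto simp: indicator_def fun_eq_iff)
    ultimately show ?thesis by simp
  qed
  show ?thesis
  proof (rule bdd_borel_induct_indicator[where P = P, OF f])
    show "P (\<lambda>t. complex_of_real (f t))"
      if "\<And>n::nat. u n \<in> borel_measurable borel" "f \<in> borel_measurable borel"
        "\<And>n t. 0 \<le> u n t" "\<And>n t. u n t \<le> u (Suc n) t" "\<And>n t. u n t \<le> f t"
        "\<And>t. f t \<le> C" "\<And>t. (\<lambda>n. u n t) \<longlonglongrightarrow> f t"
        "\<And>n. P (\<lambda>t. complex_of_real (u n t))" for u f C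
      using that by (rule incr)
    show "P f" if "P g" "f \<in> bdd_borel r" "g \<in> bdd_borel r" "\<And>t. t \<in> {-r..r} \<Longrightarrow> f t = g t" for f g
      using that by (rule cong)
  qed (fact ind add cmult)+
qed

section \<open>Von Neumann algebras and the trace\<close>

lemma vN_clinear: "von_neumann_algebra M \<Longrightarrow> A \<in> M \<Longrightarrow> A \<in> clinear_ops"
  by (auto simp: von_neumann_algebra_def)

lemma vN_bicommutant: "von_neumann_algebra M \<Longrightarrow> commutant (commutant M) = M"
  by (simp add: von_neumann_algebra_def)

lemma vN_add: "von_neumann_algebra M \<Longrightarrow> A \<in> M \<Longrightarrow> B \<in> M \<Longrightarrow> A + B \<in> M"
  using commutant_add vN_bicommutant by metis

lemma vN_diff: "von_neumann_algebra M \<Longrightarrow> A \<in> M \<Longrightarrow> B \<in> M \<Longrightarrow> A - B \<in> M"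
  using commutant_diff vN_bicommutant by metis

lemma vN_mult: "von_neumann_algebra M \<Longrightarrow> A \<in> M \<Longrightarrow> B \<in> M \<Longrightarrow> A \<odot> B \<in> M"
  using commutant_mult vN_bicommutant by metis

lemma vN_scalar: "von_neumann_algebra M \<Longrightarrow> scalar_op c \<in> M"
  using commutant_scalar[OF commutant_clinear] vN_bicommutant by metis

lemma vN_id: "von_neumann_algebra M \<Longrightarrow> id_blinfun \<in> M"
  using vN_scalar scalar_one by metis

lemma vN_zero: "von_neumann_algebra M \<Longrightarrow> 0 \<in> M"
  using vN_scalar scalar_zero by metis

lemma vN_adj: "von_neumann_algebra M \<Longrightarrow> A \<in> M \<Longrightarrow> adj A \<in> M"
  using adj_eqI unfolding von_neumann_algebra_def by metis

lemma vN_sum: "von_neumann_algebra M \<Longrightarrow> (\<And>i. i \<in> I \<Longrightarrow> f i \<in> M) \<Longrightarrow> (\<Sum>i\<in>I. f i) \<in> M"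
  by (induction I rule: infinite_finite_induct) (auto intro: vN_zero vN_add)

lemma vN_limit:
  assumes "von_neumann_algebra M" "\<And>n. A n \<in> M" "A \<longlonglongrightarrow> B"
  shows "B \<in> M"
  using commutant_limit[of A "commutant M" B] assms tendsto_blinfun_apply[OF assms(3)]
  by (simp add: vN_bicommutant)

lemma vN_op_pow: "von_neumann_algebra M \<Longrightarrow> A \<in> M \<Longrightarrow> op_pow A n \<in> M"
  by (induction n) (auto simp: op_pow_def intro: vN_id vN_mult)

lemma op_pow_0 [simp]: "op_pow A 0 = id_blinfun"
  by (simp add: op_pow_def)

lemma op_pow_Suc: "op_pow A (Suc n) = A \<odot> op_pow A n"
  by (simp add: op_pow_def)

locale tracial_vN =
  fixes M :: "('h::complex_hilbert) op set" and \<tau> :: "'h op \<Rightarrow> complex"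
  assumes vN: "von_neumann_algebra M" and tr: "faithful_normal_tracial_state M \<tau>"
begin

lemmas M_clinear = vN_clinear[OF vN] and M_add = vN_add[OF vN] and M_diff = vN_diff[OF vN]
  and M_mult = vN_mult[OF vN] and M_scalar = vN_scalar[OF vN] and M_id = vN_id[OF vN]
  and M_zero = vN_zero[OF vN] and M_adj = vN_adj[OF vN] and M_sum = vN_sum[OF vN]
  and M_limit = vN_limit[OF vN] and M_op_pow = vN_op_pow[OF vN]

lemmas M_intros = M_add M_diff M_mult M_scalar M_id M_zero M_adj M_op_pow

lemma tau_add: "A \<in> M \<Longrightarrow> B \<in> M \<Longrightarrow> \<tau> (A + B) = \<tau> A + \<tau> B"
  using tr by (simp add: faithful_normal_tracial_state_def clinear_on_def)

lemma tau_scalar_mult: "A \<in> M \<Longrightarrow> \<tau> (scalar_op c \<odot> A) = c * \<tau> A"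
  using tr by (simp add: faithful_normal_tracial_state_def clinear_on_def)

lemma tau_id: "\<tau> id_blinfun = 1"
  using tr by (simp add: faithful_normal_tracial_state_def)

lemma tau_commute: "A \<in> M \<Longrightarrow> B \<in> M \<Longrightarrow> \<tau> (A \<odot> B) = \<tau> (B \<odot> A)"
  using tr by (simp add: faithful_normal_tracial_state_def)

lemma tau_pos: "A \<in> M \<Longrightarrow> \<tau> (adj A \<odot> A) \<in> \<real>\<^sub>\<ge>\<^sub>0"
  using tr by (simp add: faithful_normal_tracial_state_def)

lemma tau_faithful: "A \<in> M \<Longrightarrow> \<tau> (adj A \<odot> A) = 0 \<Longrightarrow> A = 0"
  using tr by (simp add: faithful_normal_tracial_state_def)

lemma tau_zero: "\<tau> 0 = 0"
  using tau_scalar_mult[OF M_zero, of 0] by simp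

lemma tau_uminus: "A \<in> M \<Longrightarrow> \<tau> (- A) = - \<tau> A"
  using tau_scalar_mult[of A "-1"] by (simp add: scalar_uminus_one)

lemma M_uminus: "A \<in> M \<Longrightarrow> - A \<in> M"
  using M_diff[OF M_zero] by force

lemma tau_diff: "A \<in> M \<Longrightarrow> B \<in> M \<Longrightarrow> \<tau> (A - B) = \<tau> A - \<tau> B"
  using tau_add[of A "- B"] by (simp add: tau_uminus M_uminus)

lemma tau_sum: "(\<And>i. i \<in> I \<Longrightarrow> f i \<in> M) \<Longrightarrow> \<tau> (\<Sum>i\<in>I. f i) = (\<Sum>i\<in>I. \<tau> (f i))"
proof (induction I rule: infinite_finite_induct)
  case (insert x F)
  then show ?case by (simp add: tau_add M_sum)
qed (simp_all add: tau_zero)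

lemma tau_scalar: "\<tau> (scalar_op c) = c"
  using tau_scalar_mult[OF M_id] by (simp add: tau_id)

text \<open>Polarisation: positivity at \<open>B\<close> and at \<open>B + id_blinfun\<close> shows
  that \<open>\<tau> (adj B) + \<tau> B\<close> is real; this is applied to \<open>A\<close> and to
  \<open>A\<close> multiplied by \<i>.\<close>

lemma tau_adj:
  assumes A: "A \<in> M" shows "\<tau> (adj A) = cnj (\<tau> A)"
proof -
  have *: "Im (\<tau> (adj (B + id_blinfun) \<odot> (B + id_blinfun))) = 0" "Im (\<tau> (adj B \<odot> B)) = 0" if "B \<in> M" for B
    using tau_pos[of "B + id_blinfun"] tau_pos[of B] that
    by (auto simp: complex_nonneg_Reals_iff M_intros)
  have **: "Im (\<tau> (adj B) + \<tau> B) = 0" if B: "B \<in> M" for B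
  proof -
    have "adj (B + id_blinfun) \<odot> (B + id_blinfun) = adj B \<odot> B + (adj B + B + id_blinfun)"
      using M_clinear[OF B] by (simp add: adj_add adj_id clinear_id op_add_left op_add_right)
    then have "\<tau> (adj (B + id_blinfun) \<odot> (B + id_blinfun)) = \<tau> (adj B \<odot> B) + (\<tau> (adj B) + \<tau> B + 1)"
      using B by (simp add: tau_add M_intros tau_id)
    then show ?thesis using *[OF B] by simp
  qed
  have "adj (scalar_op \<i> \<odot> A) = scalar_op (-\<i>) \<odot> adj A"
    using M_clinear[OF A] by (simp add: adj_mult clinear_scalar adj_scalar scalar_commute adj_clinear)
  then have "\<tau> (adj (scalar_op \<i> \<odot> A)) = - \<i> * \<tau> (adj A)"
    using A by (simp add: tau_scalar_mult M_intros)
  moreover have "\<tau> (scalar_op \<i> \<odot> A) = \<i> * \<tau> A" using A by (simp add: tau_scalar_mult)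
  ultimately have "Re (\<tau> A) = Re (\<tau> (adj A))"
    using **[of "scalar_op \<i> \<odot> A"] A by (simp add: M_intros)
  then show ?thesis using **[OF A] by (simp add: complex_eq_iff)
qed

text \<open>Normality for the two-element directed set \<open>{A, B}\<close> is monotonicity.\<close>
lemma tau_mono:
  assumes "A \<in> M" "B \<in> M" "selfadjoint A" "selfadjoint B" "op_le A B"
  shows "Re (\<tau> A) \<le> Re (\<tau> B)"
proof -
  have refl: "op_le C C" for C by (simp add: op_le_def positive_op_def)
  have "normal_on M \<tau>" using tr by (simp add: faithful_normal_tracial_state_def)
  then have "Re (\<tau> B) = (SUP C\<in>{A,B}. Re (\<tau> C))"
    unfolding normal_on_def
    by (rule allE[of _ "{A,B}"], elim allE[of _ B] mp) (use assms refl in auto)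
  also have "\<dots> = max (Re (\<tau> A)) (Re (\<tau> B))"
    by (simp add: cSup_insert sup_max)
  finally show ?thesis by simp
qed

lemma tau_SUP:
  assumes "S \<subseteq> M" "\<And>B. B \<in> S \<Longrightarrow> selfadjoint B" "S \<noteq> {}"
    "\<And>B C. B \<in> S \<Longrightarrow> C \<in> S \<Longrightarrow> \<exists>D\<in>S. op_le B D \<and> op_le C D"
    "A \<in> M" "selfadjoint A" "\<And>B. B \<in> S \<Longrightarrow> op_le B A"
    "\<And>C. C \<in> M \<Longrightarrow> selfadjoint C \<Longrightarrow> (\<And>B. B \<in> S \<Longrightarrow> op_le B C) \<Longrightarrow> op_le A C"
  shows "Re (\<tau> A) = (SUP B\<in>S. Re (\<tau> B))"
proof -
  have "normal_on M \<tau>" using tr by (simp add: faithful_normal_tracial_state_def)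
  then show ?thesis
    unfolding normal_on_def
    by (rule allE[of _ S], elim allE[of _ A] mp) (use assms in auto)
qed

lemma op_le_iff:
  "op_le A B \<longleftrightarrow> (\<forall>x. cinner (blinfun_apply B x) x - cinner (blinfun_apply A x) x \<in> \<real>\<^sub>\<ge>\<^sub>0)"
  by (simp add: op_le_def positive_op_def blinfun.diff_left cinner_simps)

lemma selfadjoint_cinner_real:
  "selfadjoint A \<Longrightarrow> cinner (blinfun_apply A x) x = complex_of_real (Re (cinner (blinfun_apply A x) x))"
  unfolding selfadjoint_def is_adjoint_def
  by (metis cinner_commute complex_In_mult_cnj_zero complex_eq_iff Im_complex_of_real Re_complex_of_real
      complex_cnj equal_neg_zero cnj.simps(2))

lemma op_le_selfadjoint_iff:
  assumes "selfadjoint A" "selfadjoint B"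
  shows "op_le A B \<longleftrightarrow> (\<forall>x. Re (cinner (blinfun_apply A x) x) \<le> Re (cinner (blinfun_apply B x) x))"
  unfolding op_le_iff
  by (subst selfadjoint_cinner_real[OF assms(1)], subst selfadjoint_cinner_real[OF assms(2)])
    (simp add: of_real_diff[symmetric] complex_nonneg_Reals_iff del: of_real_diff)

text \<open>Quadratic forms show that the strong limit of an increasing sequence is its least upper
  bound, so the order-theoretic definition of normality yields convergence of the traces.\<close>

lemma tau_incseq:
  assumes A: "\<And>n. A n \<in> M" "\<And>n. selfadjoint (A n)" "\<And>n. op_le (A n) (A (Suc n))"
    and B: "B \<in> M" "selfadjoint B" and lim: "\<And>x. (\<lambda>n. blinfun_apply (A n) x) \<longlonglongrightarrow> blinfun_apply B x"
  shows "(\<lambda>n. Re (\<tau> (A n))) \<longlonglongrightarrow> Re (\<tau> B)"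
proof -
  let ?q = "\<lambda>C x. Re (cinner (blinfun_apply C x) x)"
  have inc: "incseq (\<lambda>n. ?q (A n) x)" for x
    using op_le_selfadjoint_iff[OF A(2) A(2)] A(3) by (intro incseq_SucI) blast
  have qlim: "(\<lambda>n. ?q (A n) x) \<longlonglongrightarrow> ?q B x" for x
    by (intro tendsto_Re tendsto_cinner_left lim)
  have le: "op_le (A m) (A n)" if "m \<le> n" for m n
    using inc that by (auto simp: op_le_selfadjoint_iff A incseq_def)
  have leB: "op_le (A n) B" for n
    using inc qlim by (auto simp: op_le_selfadjoint_iff A B intro: incseq_le)
  have "Re (\<tau> B) = (SUP C\<in>range A. Re (\<tau> C))"
  proof (rule tau_SUP)
    show "\<exists>D\<in>range A. op_le C D \<and> op_le C' D" if CC: "C \<in> range A" "C' \<in> range A" for C C'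
    proof -
      obtain m n where "C = A m" "C' = A n" using CC by blast
      then show ?thesis using le[of m "max m n"] le[of n "max m n"] by auto
    qed
    show "op_le B C" if "C \<in> M" "selfadjoint C" "\<And>D. D \<in> range A \<Longrightarrow> op_le D C" for C
    proof (subst op_le_selfadjoint_iff[OF B(2) that(2)], rule allI)
      fix x
      have "?q (A n) x \<le> ?q C x" for n
        using that(3)[of "A n"] by (auto simp: op_le_selfadjoint_iff A that(2))
      then show "?q B x \<le> ?q C x" by (intro LIMSEQ_le_const2[OF qlim]) auto
    qed
  qed (use A B leB in auto)
  then have "Re (\<tau> B) = (SUP n. Re (\<tau> (A n)))" by (simp add: image_image)
  moreover have "(\<lambda>n. Re (\<tau> (A n))) \<longlonglongrightarrow> (SUP n. Re (\<tau> (A n)))"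
  proof (rule LIMSEQ_incseq_SUP)
    show "bdd_above (range (\<lambda>n. Re (\<tau> (A n))))"
      using tau_mono[OF A(1) B(1) A(2) B(2) leB] by (intro bdd_aboveI[of _ "Re (\<tau> B)"]) auto
    show "incseq (\<lambda>n. Re (\<tau> (A n)))"
      by (intro incseq_SucI tau_mono A)
  qed
  ultimately show ?thesis by simp
qed

section \<open>The 2-norm of the trace\<close>

definition tnorm :: "'h op \<Rightarrow> real" where
  "tnorm A = sqrt (Re (\<tau> (adj A \<odot> A)))"

lemma tau_adj_mult_self: "A \<in> M \<Longrightarrow> \<tau> (adj A \<odot> A) = complex_of_real ((tnorm A)\<^sup>2)"
  using tau_pos[of A] unfolding tnorm_def
  by (auto simp: complex_nonneg_Reals_iff complex_eq_iff simp del: of_real_power)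

lemma tnorm_nonneg: "A \<in> M \<Longrightarrow> 0 \<le> tnorm A"
  using tau_pos[of A] by (auto simp: tnorm_def complex_nonneg_Reals_iff)

lemma tnorm_eq_0: "A \<in> M \<Longrightarrow> tnorm A = 0 \<Longrightarrow> A = 0"
  using tau_adj_mult_self tau_faithful by force

lemma tau_Cauchy_Schwarz:
  assumes A: "A \<in> M" and B: "B \<in> M"
  shows "cmod (\<tau> (adj B \<odot> A)) \<le> tnorm A * tnorm B"
proof (cases "tnorm B = 0")
  case True
  then show ?thesis using tnorm_eq_0[OF B] by (simp add: adj_zero tau_zero)
next
  case False
  then have b: "tnorm B > 0" using tnorm_nonneg[OF B] by simp
  define t where "t = \<tau> (adj B \<odot> A)"
  define c where "c = t / complex_of_real ((tnorm B)\<^sup>2)"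
  note cl = M_clinear[OF A] M_clinear[OF B]
  have AB: "\<tau> (adj A \<odot> B) = cnj t"
    unfolding t_def using A B tau_adj[of "adj B \<odot> A"] by (simp add: M_intros adj_mult adj_adj cl adj_clinear)
  let ?C = "A - scalar_op c \<odot> B"
  have "adj ?C \<odot> ?C = adj A \<odot> A - scalar_op c \<odot> (adj A \<odot> B) - scalar_op (cnj c) \<odot> (adj B \<odot> A)
      + scalar_op (c * cnj c) \<odot> (adj B \<odot> B)"
  proof -
    have "adj ?C = adj A - scalar_op (cnj c) \<odot> adj B"
      using cl by (simp add: adj_diff adj_mult adj_scalar clinear_intros scalar_commute)
    moreover have "adj A \<odot> (scalar_op c \<odot> B) = scalar_op c \<odot> (adj A \<odot> B)"
      using cl by (metis op_assoc scalar_commute adj_clinear)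
    moreover have "(scalar_op (cnj c) \<odot> adj B) \<odot> (scalar_op c \<odot> B) = scalar_op (c * cnj c) \<odot> (adj B \<odot> B)"
      using cl by (metis op_assoc scalar_commute adj_clinear scalar_mult mult.commute)
    ultimately show ?thesis by (simp add: op_diff_left op_diff_right op_assoc)
  qed
  then have "\<tau> (adj ?C \<odot> ?C) = complex_of_real ((tnorm A)\<^sup>2) - c * cnj t - cnj c * t
      + c * cnj c * complex_of_real ((tnorm B)\<^sup>2)"
    using A B by (simp add: tau_add tau_diff tau_scalar_mult M_intros tau_adj_mult_self AB t_def
        del: of_real_power)
  also have "\<dots> = complex_of_real ((tnorm A)\<^sup>2) - t * cnj t / complex_of_real ((tnorm B)\<^sup>2)"
    using b by (simp add: c_def field_simps)
  also have "\<dots> = complex_of_real ((tnorm A)\<^sup>2 - (cmod t)\<^sup>2 / (tnorm B)\<^sup>2)"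
    by (simp add: complex_norm_square[symmetric])
  finally have "complex_of_real ((tnorm A)\<^sup>2 - (cmod t)\<^sup>2 / (tnorm B)\<^sup>2) \<in> \<real>\<^sub>\<ge>\<^sub>0"
    using tau_pos[of ?C] A B by (simp add: M_intros del: of_real_diff)
  then have "0 \<le> (tnorm A)\<^sup>2 - (cmod t)\<^sup>2 / (tnorm B)\<^sup>2"
    by (simp only: nonneg_Reals_of_real_iff)
  then have "(cmod t)\<^sup>2 \<le> (tnorm A * tnorm B)\<^sup>2"
    using b by (simp add: field_simps power_mult_distrib)
  then show ?thesis unfolding t_def
    by (rule power2_le_imp_le) (simp add: tnorm_nonneg A B)
qed

lemma tnorm_adj: "A \<in> M \<Longrightarrow> tnorm (adj A) = tnorm A"
  by (simp add: tnorm_def adj_adj M_clinear tau_commute M_adj)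

text \<open>Monotonicity of the trace, applied to the operator inequality between
  \<open>adj A \<odot> adj B \<odot> B \<odot> A\<close> and \<open>(norm B)\<^sup>2\<close> times
  \<open>adj A \<odot> A\<close>.\<close>

lemma tnorm_mult_left:
  assumes A: "A \<in> M" and B: "B \<in> M"
  shows "tnorm (B \<odot> A) \<le> norm B * tnorm A"
proof -
  note cl = M_clinear[OF A] M_clinear[OF B]
  let ?L = "adj (B \<odot> A) \<odot> (B \<odot> A)" and ?R = "scalar_op (complex_of_real ((norm B)\<^sup>2)) \<odot> (adj A \<odot> A)"
  have saL: "selfadjoint ?L"
    using cl by (intro selfadjointI clinear_intros) (simp_all add: adj_mult adj_adj clinear_intros)
  have saR: "selfadjoint ?R"
  proof (intro selfadjointI clinear_intros cl)
    have "adj ?R = (adj A \<odot> A) \<odot> scalar_op (complex_of_real ((norm B)\<^sup>2))"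
      using cl by (simp add: adj_mult adj_adj clinear_intros adj_scalar)
    also have "\<dots> = ?R" by (intro scalar_commute clinear_intros cl)
    finally show "adj ?R = ?R" .
  qed
  have "op_le ?L ?R"
  proof (subst op_le_selfadjoint_iff[OF saL saR], rule allI)
    fix x
    have "cinner (blinfun_apply ?L x) x = complex_of_real ((norm (blinfun_apply B (blinfun_apply A x)))\<^sup>2)"
      using cl by (simp add: cinner_adj_left clinear_intros cinner_self)
    moreover have "cinner (blinfun_apply ?R x) x
        = complex_of_real ((norm B)\<^sup>2 * (norm (blinfun_apply A x))\<^sup>2)"
      using cl by (simp add: cinner_simps cinner_adj_left cinner_self)
    moreover have "(norm (blinfun_apply B (blinfun_apply A x)))\<^sup>2 \<le> (norm B * norm (blinfun_apply A x))\<^sup>2"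
      by (intro power_mono norm_blinfun) simp
    ultimately show "Re (cinner (blinfun_apply ?L x) x) \<le> Re (cinner (blinfun_apply ?R x) x)"
      by (simp only: Re_complex_of_real power_mult_distrib)
  qed
  then have "Re (\<tau> ?L) \<le> Re (\<tau> ?R)"
    using A B by (intro tau_mono saL saR) (auto intro!: M_intros)
  also have "\<tau> ?R = complex_of_real ((norm B)\<^sup>2 * (tnorm A)\<^sup>2)"
    using A by (simp add: tau_scalar_mult M_intros tau_adj_mult_self)
  also have "\<tau> ?L = complex_of_real ((tnorm (B \<odot> A))\<^sup>2)"
    using A B by (intro tau_adj_mult_self M_intros)
  finally have "(tnorm (B \<odot> A))\<^sup>2 \<le> (norm B * tnorm A)\<^sup>2"
    by (simp only: Re_complex_of_real power_mult_distrib)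
  then show ?thesis by (rule power2_le_imp_le) (simp add: tnorm_nonneg A)
qed

text \<open>The trace property enters through \<open>tnorm_adj\<close>, which reduces multiplication
  on the right to multiplication on the left.\<close>

lemma tnorm_mult_right:
  assumes A: "A \<in> M" and B: "B \<in> M"
  shows "tnorm (A \<odot> B) \<le> norm B * tnorm A"
proof -
  note cl = M_clinear[OF A] M_clinear[OF B]
  have "tnorm (A \<odot> B) = tnorm (adj B \<odot> adj A)"
    using tnorm_adj[of "A \<odot> B"] A B cl by (simp add: adj_mult M_intros)
  also have "\<dots> \<le> norm (adj B) * tnorm (adj A)" using A B by (intro tnorm_mult_left M_intros)
  also have "\<dots> \<le> norm B * tnorm A"
    using A cl by (simp add: tnorm_adj mult_right_mono norm_adj_le tnorm_nonneg)
  finally show ?thesis .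
qed

lemma tnorm_id: "tnorm id_blinfun = 1"
  by (simp add: tnorm_def adj_id tau_id)

lemma tau_le_tnorm: "A \<in> M \<Longrightarrow> cmod (\<tau> A) \<le> tnorm A"
  using tau_Cauchy_Schwarz[OF _ M_id, of A] by (simp add: adj_id tnorm_id)

lemma tau_le_norm: "A \<in> M \<Longrightarrow> cmod (\<tau> A) \<le> norm A"
  using tau_le_tnorm[of A] tnorm_mult_left[OF M_id, of A] by (simp add: tnorm_id)

lemma tnorm_le_norm: "A \<in> M \<Longrightarrow> tnorm A \<le> norm A"
  using tnorm_mult_left[OF M_id, of A] by (simp add: tnorm_id)

text \<open>The reason for using the 2-norm: a factor in the middle of a product may be approximated
  in it, with bounded factors on both sides, and the trace follows.\<close>

lemma tau_mult3_le:
  assumes "A \<in> M" "B \<in> M" "C \<in> M"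
  shows "cmod (\<tau> (B \<odot> (A \<odot> C))) \<le> norm B * norm C * tnorm A"
proof -
  have "cmod (\<tau> (B \<odot> (A \<odot> C))) \<le> tnorm (B \<odot> (A \<odot> C))"
    using assms by (intro tau_le_tnorm M_intros)
  also have "\<dots> \<le> norm B * tnorm (A \<odot> C)" using assms by (intro tnorm_mult_left M_intros)
  also have "\<dots> \<le> norm B * (norm C * tnorm A)"
    using assms by (intro mult_left_mono tnorm_mult_right) auto
  finally show ?thesis by simp
qed

lemma tau_tendsto:
  assumes "\<And>n. A n \<in> M" "A \<longlonglongrightarrow> B"
  shows "(\<lambda>n. \<tau> (A n)) \<longlonglongrightarrow> \<tau> B"
proof -
  have B: "B \<in> M" using M_limit assms by blast
  have lim: "(\<lambda>n. norm (A n - B)) \<longlonglongrightarrow> 0"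
    using assms(2) by (simp add: LIM_zero_iff tendsto_norm_zero_iff)
  have "cmod (\<tau> (A n) - \<tau> B) \<le> norm (A n - B)" for n
    using tau_le_norm[of "A n - B"] assms(1) B by (simp add: M_diff tau_diff)
  then have "(\<lambda>n. \<tau> (A n) - \<tau> B) \<longlonglongrightarrow> 0"
    by (intro Lim_null_comparison[OF always_eventually lim]) simp
  then show ?thesis by (simp add: LIM_zero_iff)
qed

lemma tnorm_triangle:
  assumes A: "A \<in> M" and B: "B \<in> M"
  shows "tnorm (A + B) \<le> tnorm A + tnorm B"
proof -
  have cl: "A \<in> clinear_ops" "B \<in> clinear_ops" using A B M_clinear by auto
  have "adj (A + B) \<odot> (A + B) = adj A \<odot> A + adj A \<odot> B + (adj B \<odot> A + adj B \<odot> B)"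
    using cl by (simp add: adj_add op_add_left op_add_right)
  then have "complex_of_real ((tnorm (A + B))\<^sup>2)
      = complex_of_real ((tnorm A)\<^sup>2) + \<tau> (adj A \<odot> B) + (\<tau> (adj B \<odot> A) + complex_of_real ((tnorm B)\<^sup>2))"
    using A B by (simp add: tau_add M_intros tau_adj_mult_self[symmetric] del: of_real_power)
  then have "(tnorm (A + B))\<^sup>2 = (tnorm A)\<^sup>2 + Re (\<tau> (adj A \<odot> B)) + (Re (\<tau> (adj B \<odot> A)) + (tnorm B)\<^sup>2)"
    by (metis Re_complex_of_real plus_complex.sel(1))
  moreover have "Re (\<tau> (adj A \<odot> B)) \<le> tnorm A * tnorm B"
    using tau_Cauchy_Schwarz[OF B A] complex_Re_le_cmod[of "\<tau> (adj A \<odot> B)"] by (simp add: mult.commute)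
  moreover have "Re (\<tau> (adj B \<odot> A)) \<le> tnorm A * tnorm B"
    using tau_Cauchy_Schwarz[OF A B] complex_Re_le_cmod[of "\<tau> (adj B \<odot> A)"] by simp
  ultimately have "(tnorm (A + B))\<^sup>2 \<le> (tnorm A + tnorm B)\<^sup>2"
    by (simp add: power2_sum)
  then show ?thesis by (rule power2_le_imp_le) (simp add: tnorm_nonneg A B)
qed

end

section \<open>The functional calculus of the diagonal operator\<close>

locale calculus =
  fixes D0 :: "('h::complex_hilbert) op" and \<Phi> :: "(real \<Rightarrow> complex) \<Rightarrow> 'h op"
  assumes calc: "borel_functional_calculus D0 \<Phi>"
begin

abbreviation "BB \<equiv> bdd_borel (norm D0)"

lemma calc_unfolded:
  "(\<forall>f\<in>BB. \<Phi> f \<in> clinear_ops) \<and> \<Phi> (\<lambda>_. 1) = id_blinfun \<and> \<Phi> complex_of_real = D0 \<and>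
   (\<forall>f\<in>BB. \<forall>g\<in>BB. \<Phi> (\<lambda>t. f t + g t) = \<Phi> f + \<Phi> g) \<and>
   (\<forall>c. \<forall>f\<in>BB. \<Phi> (\<lambda>t. c * f t) = scalar_op c \<odot> \<Phi> f) \<and>
   (\<forall>f\<in>BB. \<forall>g\<in>BB. \<Phi> (\<lambda>t. f t * g t) = \<Phi> f \<odot> \<Phi> g) \<and>
   (\<forall>f\<in>BB. is_adjoint (\<Phi> f) (\<Phi> (\<lambda>t. cnj (f t)))) \<and>
   (\<forall>fs f C. (\<forall>n. fs n \<in> borel_measurable borel) \<and> f \<in> borel_measurable borel \<and>
        (\<forall>n. \<forall>t\<in>{- norm D0..norm D0}. cmod (fs n t) \<le> C) \<and>
        (\<forall>t\<in>{- norm D0..norm D0}. (\<lambda>n. fs n t) \<longlonglongrightarrow> f t)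
      \<longrightarrow> (\<forall>x. (\<lambda>n. blinfun_apply (\<Phi> (fs n)) x) \<longlonglongrightarrow> blinfun_apply (\<Phi> f) x))"
  using calc unfolding borel_functional_calculus_def Let_def bdd_borel_def .

lemma Phi_clinear: "f \<in> BB \<Longrightarrow> \<Phi> f \<in> clinear_ops"
  using calc_unfolded by blast

lemma Phi_one: "\<Phi> (\<lambda>_. 1) = id_blinfun"
  using calc_unfolded by blast

lemma Phi_id: "\<Phi> complex_of_real = D0"
  using calc_unfolded by blast

lemma Phi_add: "f \<in> BB \<Longrightarrow> g \<in> BB \<Longrightarrow> \<Phi> (\<lambda>t. f t + g t) = \<Phi> f + \<Phi> g"
  using calc_unfolded by blast

lemma Phi_cmult: "f \<in> BB \<Longrightarrow> \<Phi> (\<lambda>t. c * f t) = scalar_op c \<odot> \<Phi> f"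
  using calc_unfolded by blast

lemma Phi_mult: "f \<in> BB \<Longrightarrow> g \<in> BB \<Longrightarrow> \<Phi> (\<lambda>t. f t * g t) = \<Phi> f \<odot> \<Phi> g"
  using calc_unfolded by blast

lemma Phi_adj: "f \<in> BB \<Longrightarrow> adj (\<Phi> f) = \<Phi> (\<lambda>t. cnj (f t))"
  using calc_unfolded adj_eqI by blast

lemma Phi_tendsto:
  assumes "\<And>n. fs n \<in> borel_measurable borel" "f \<in> borel_measurable borel"
    "\<And>n t. t \<in> {- norm D0..norm D0} \<Longrightarrow> cmod (fs n t) \<le> C"
    "\<And>t. t \<in> {- norm D0..norm D0} \<Longrightarrow> (\<lambda>n. fs n t) \<longlonglongrightarrow> f t"
  shows "(\<lambda>n. blinfun_apply (\<Phi> (fs n)) x) \<longlonglongrightarrow> blinfun_apply (\<Phi> f) x"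
  using calc_unfolded assms by blast

lemma Phi_cong:
  assumes f: "f \<in> BB" and g: "g \<in> BB" and eq: "\<And>t. t \<in> {- norm D0..norm D0} \<Longrightarrow> f t = g t"
  shows "\<Phi> f = \<Phi> g"
proof (rule blinfun_eqI)
  fix x
  obtain C where "\<And>t. t \<in> {- norm D0..norm D0} \<Longrightarrow> cmod (f t) \<le> C" using bdd_borelE[OF f] by blast
  then have "(\<lambda>n::nat. blinfun_apply (\<Phi> f) x) \<longlonglongrightarrow> blinfun_apply (\<Phi> g) x"
    by (intro Phi_tendsto) (use f g eq bdd_borel_measurable in auto)
  then show "blinfun_apply (\<Phi> f) x = blinfun_apply (\<Phi> g) x"
    by (simp add: LIMSEQ_const_iff)
qed

lemma Phi_const: "\<Phi> (\<lambda>_. c) = scalar_op c"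
  using Phi_cmult[OF bdd_borel_const, of c 1] by (simp add: Phi_one)

lemma Phi_uminus: "f \<in> BB \<Longrightarrow> \<Phi> (\<lambda>t. - f t) = - \<Phi> f"
  using Phi_cmult[of f "-1"] by (simp add: scalar_uminus_one)

lemma Phi_diff: "f \<in> BB \<Longrightarrow> g \<in> BB \<Longrightarrow> \<Phi> (\<lambda>t. f t - g t) = \<Phi> f - \<Phi> g"
  using Phi_add[OF _ bdd_borel_uminus, of f g] by (simp add: Phi_uminus)

lemma bdd_borel_id: "complex_of_real \<in> bdd_borel r"
  using bdd_borel_power[of 1 r] by simp

lemma Phi_power: "\<Phi> (\<lambda>t. complex_of_real t ^ k) = op_pow D0 k"
proof (induction k)
  case (Suc k)
  have "\<Phi> (\<lambda>t. complex_of_real t * complex_of_real t ^ k) = \<Phi> complex_of_real \<odot> op_pow D0 k"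
    using Phi_mult[OF bdd_borel_id bdd_borel_power] Suc by simp
  then show ?case by (simp add: Phi_id op_pow_Suc)
qed (simp add: Phi_one)

text \<open>The function \<open>h\<close>, the square root of \<open>s\<^sup>2\<close> minus the
  squared modulus of \<open>f\<close>, completes \<open>f\<close> to a pair with constant sum of
  squares. Hence the squared norms of \<open>\<Phi> f x\<close> and \<open>\<Phi> h x\<close> add up
  to that of \<open>s x\<close>. The \<open>max 0\<close> only keeps the root harmless off the
  interval.\<close>

lemma Phi_norm_le:
  assumes f: "f \<in> BB" and s: "s \<ge> 0" and fs: "\<And>t. t \<in> {- norm D0..norm D0} \<Longrightarrow> cmod (f t) \<le> s"
  shows "norm (\<Phi> f) \<le> s"
proof (rule norm_blinfun_bound[OF s])
  fix x
  define h where "h t = complex_of_real (sqrt (max 0 (s\<^sup>2 - (cmod (f t))\<^sup>2)))" for t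
  have [measurable]: "f \<in> borel_measurable borel" using f by (rule bdd_borel_measurable)
  have h: "h \<in> BB"
  proof -
    have "max 0 (s\<^sup>2 - (cmod (f t))\<^sup>2) \<le> s\<^sup>2" for t using s by simp
    then have "sqrt (max 0 (s\<^sup>2 - (cmod (f t))\<^sup>2)) \<le> s" for t
      using s real_sqrt_le_mono real_sqrt_abs by (metis abs_of_nonneg)
    then show ?thesis unfolding h_def by (intro bdd_borel_of_real[of _ _ s]) auto
  qed
  have sq: "cinner (blinfun_apply (\<Phi> (\<lambda>t. cnj (g t) * g t)) x) x = complex_of_real ((norm (blinfun_apply (\<Phi> g) x))\<^sup>2)"
    if g: "g \<in> BB" for g
    using g by (simp add: Phi_mult bdd_borel_cnj Phi_adj[symmetric] cinner_adj_left Phi_clinear cinner_self)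
  have "\<Phi> (\<lambda>t. cnj (f t) * f t + cnj (h t) * h t) = \<Phi> (\<lambda>_. complex_of_real (s\<^sup>2))"
  proof (rule Phi_cong)
    fix t assume t: "t \<in> {- norm D0..norm D0}"
    have "(cmod (f t))\<^sup>2 \<le> s\<^sup>2" using fs[OF t] by (intro power_mono) auto
    then have "(cmod (h t))\<^sup>2 = s\<^sup>2 - (cmod (f t))\<^sup>2" by (simp add: h_def)
    moreover have "cnj z * z = complex_of_real ((cmod z)\<^sup>2)" for z
      using complex_norm_square[of z] by (metis mult.commute)
    ultimately show "cnj (f t) * f t + cnj (h t) * h t = complex_of_real (s\<^sup>2)"
      by (simp del: of_real_power)
  qed (intro bdd_borel_intros f h)+
  then have "\<Phi> (\<lambda>t. cnj (f t) * f t) + \<Phi> (\<lambda>t. cnj (h t) * h t) = scalar_op (complex_of_real (s\<^sup>2))"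
    by (simp add: Phi_add f h bdd_borel_intros Phi_const del: of_real_power)
  then have "cinner (blinfun_apply (\<Phi> (\<lambda>t. cnj (f t) * f t) + \<Phi> (\<lambda>t. cnj (h t) * h t)) x) x
      = complex_of_real (s\<^sup>2 * (norm x)\<^sup>2)"
    by (simp add: cinner_simps cinner_self)
  then have "complex_of_real ((norm (blinfun_apply (\<Phi> f) x))\<^sup>2 + (norm (blinfun_apply (\<Phi> h) x))\<^sup>2)
      = complex_of_real (s\<^sup>2 * (norm x)\<^sup>2)"
    unfolding blinfun.add_left cinner_add_left sq[OF f] sq[OF h] by (simp only: of_real_add)
  then have "(norm (blinfun_apply (\<Phi> f) x))\<^sup>2 + (norm (blinfun_apply (\<Phi> h) x))\<^sup>2 = (s * norm x)\<^sup>2"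
    by (simp only: of_real_eq_iff power_mult_distrib)
  then have "(norm (blinfun_apply (\<Phi> f) x))\<^sup>2 \<le> (s * norm x)\<^sup>2"
    using zero_le_power2[of "norm (blinfun_apply (\<Phi> h) x)"] by linarith
  then show "norm (blinfun_apply (\<Phi> f) x) \<le> s * norm x"
    by (rule power2_le_imp_le) (simp add: s)
qed

lemma Phi_uniform_tendsto:
  assumes u: "\<And>n. u n \<in> BB" and f: "f \<in> BB"
    and close: "\<And>n t. t \<in> {- norm D0..norm D0} \<Longrightarrow> cmod (f t - u n t) \<le> 1 / real (Suc n)"
  shows "(\<lambda>n. \<Phi> (u n)) \<longlonglongrightarrow> \<Phi> f"
proof -
  have "norm (\<Phi> (u n) - \<Phi> f) \<le> 1 / real (Suc n)" for n
    unfolding Phi_diff[OF u f, symmetric]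
    by (rule Phi_norm_le) (use close in \<open>auto intro: bdd_borel_diff u f simp: norm_minus_commute\<close>)
  then have "(\<lambda>n. \<Phi> (u n) - \<Phi> f) \<longlonglongrightarrow> 0"
    by (intro Lim_null_comparison[OF always_eventually LIMSEQ_Suc[OF lim_1_over_n]]) auto
  then show ?thesis by (simp add: LIM_zero_iff)
qed

lemma incr_bdd_borel:
  assumes "\<And>n::nat. u n \<in> borel_measurable borel" "f \<in> borel_measurable borel"
    "\<And>n t. 0 \<le> u n t" "\<And>n t. u n t \<le> f t" "\<And>t. f t \<le> C"
  shows "(\<lambda>t. complex_of_real (u n t)) \<in> bdd_borel r" "(\<lambda>t. complex_of_real (f t)) \<in> bdd_borel r"
proof -
  have "\<bar>u n t\<bar> \<le> C" "\<bar>f t\<bar> \<le> C" for n t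
    using assms(3)[of n t] assms(4)[of n t] assms(5)[of t] by linarith+
  then show "(\<lambda>t. complex_of_real (u n t)) \<in> bdd_borel r" "(\<lambda>t. complex_of_real (f t)) \<in> bdd_borel r"
    using assms(1,2) by (auto intro!: bdd_borel_of_real[of _ _ C])
qed

lemma incr_Phi_tendsto:
  assumes u: "\<And>n::nat. u n \<in> borel_measurable borel" "f \<in> borel_measurable borel"
    "\<And>n t. 0 \<le> u n t" "\<And>n t. u n t \<le> f t" "\<And>t. f t \<le> C" "\<And>t. (\<lambda>n. u n t) \<longlonglongrightarrow> f t"
  shows "(\<lambda>n. blinfun_apply (\<Phi> (\<lambda>t. complex_of_real (u n t))) x)
    \<longlonglongrightarrow> blinfun_apply (\<Phi> (\<lambda>t. complex_of_real (f t))) x"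
proof (rule Phi_tendsto[where C = C])
  show "cmod (complex_of_real (u n t)) \<le> C" for n t
    using u(3)[of n t] u(4)[of n t] u(5)[of t] by (simp)
qed (use u in \<open>auto intro: tendsto_of_real\<close>)

lemma Phi_commute:
  assumes B: "B \<in> clinear_ops" "D0 \<odot> B = B \<odot> D0" and f: "f \<in> BB"
  shows "\<Phi> f \<odot> B = B \<odot> \<Phi> f"
  using f
proof (induction rule: bdd_borel_induct)
  case (power k)
  show ?case unfolding Phi_power
  proof (induction k)
    case (Suc k)
    have "(D0 \<odot> op_pow D0 k) \<odot> B = D0 \<odot> (B \<odot> op_pow D0 k)" using Suc by (simp add: op_assoc)
    also have "\<dots> = B \<odot> (D0 \<odot> op_pow D0 k)" using B by (metis op_assoc)
    finally show ?case by (simp add: op_pow_Suc)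
  qed simp
next
  case (add f g)
  then show ?case by (simp add: Phi_add op_add_left op_add_right)
next
  case (cmult c f)
  have "(scalar_op c \<odot> \<Phi> f) \<odot> B = (scalar_op c \<odot> B) \<odot> \<Phi> f"
    by (simp add: op_assoc cmult)
  also have "\<dots> = B \<odot> (scalar_op c \<odot> \<Phi> f)"
    by (simp add: scalar_commute[OF B(1), symmetric] op_assoc)
  finally show ?case by (simp add: Phi_cmult cmult)
next
  case (uniform u f)
  have lim: "(\<lambda>n. \<Phi> (u n)) \<longlonglongrightarrow> \<Phi> f" by (rule Phi_uniform_tendsto) (use uniform in auto)
  have "(\<lambda>n. \<Phi> (u n) \<odot> B) \<longlonglongrightarrow> \<Phi> f \<odot> B" by (rule tendsto_op_mult[OF lim tendsto_const])
  moreover have "(\<lambda>n. \<Phi> (u n) \<odot> B) \<longlonglongrightarrow> B \<odot> \<Phi> f"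
  proof -
    have "(\<lambda>n. \<Phi> (u n) \<odot> B) = (\<lambda>n. B \<odot> \<Phi> (u n))" using uniform.IH by blast
    then show ?thesis using tendsto_op_mult[OF tendsto_const lim] by simp
  qed
  ultimately show ?case by (rule LIMSEQ_unique)
next
  case (increasing u f C)
  show ?case
  proof (rule blinfun_eqI)
    fix x
    note lim = incr_Phi_tendsto[of u f, OF increasing(1,2,3,5,6,7)]
    have "(\<lambda>n. blinfun_apply (\<Phi> (\<lambda>t. complex_of_real (u n t))) (blinfun_apply B x))
        \<longlonglongrightarrow> blinfun_apply (\<Phi> (\<lambda>t. complex_of_real (f t))) (blinfun_apply B x)" by (rule lim)
    moreover have "blinfun_apply (\<Phi> (\<lambda>t. complex_of_real (u n t))) (blinfun_apply B x)
        = blinfun_apply B (blinfun_apply (\<Phi> (\<lambda>t. complex_of_real (u n t))) x)" for n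
      using increasing(8)[of n] by (metis blinfun_apply_blinfun_compose)
    moreover have "(\<lambda>n. blinfun_apply B (blinfun_apply (\<Phi> (\<lambda>t. complex_of_real (u n t))) x))
        \<longlonglongrightarrow> blinfun_apply B (blinfun_apply (\<Phi> (\<lambda>t. complex_of_real (f t))) x)"
      by (intro tendsto_intros lim)
    ultimately show "blinfun_apply (\<Phi> (\<lambda>t. complex_of_real (f t)) \<odot> B) x
        = blinfun_apply (B \<odot> \<Phi> (\<lambda>t. complex_of_real (f t))) x"
      using LIMSEQ_unique by fastforce
  qed
qed

lemma Phi_bicommutant: "D0 \<in> S \<Longrightarrow> f \<in> BB \<Longrightarrow> \<Phi> f \<in> commutant (commutant S)"
  using Phi_commute Phi_clinear unfolding commutant_def by fastforce

lemma Phi_vN: "von_neumann_algebra N \<Longrightarrow> D0 \<in> N \<Longrightarrow> f \<in> BB \<Longrightarrow> \<Phi> f \<in> N"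
  using Phi_bicommutant vN_bicommutant by blast

lemma Phi_vN_generated: "D0 \<in> S \<Longrightarrow> f \<in> BB \<Longrightarrow> \<Phi> f \<in> vN_generated S"
  unfolding vN_generated_def using Phi_vN by blast

end

section \<open>The trace of a function of the diagonal operator as an integral\<close>

locale tracial_calculus = tracial_vN M \<tau> + calculus D0 \<Phi>
  for M :: "('h::complex_hilbert) op set" and \<tau> :: "'h op \<Rightarrow> complex"
    and D0 :: "'h op" and \<Phi> :: "(real \<Rightarrow> complex) \<Rightarrow> 'h op" +
  assumes D0_M: "D0 \<in> M" and D0_dist: "has_distribution \<tau> D0 uniform_01"
begin

lemma Phi_M: "f \<in> BB \<Longrightarrow> \<Phi> f \<in> M"
  using Phi_vN[OF vN D0_M] .

lemma Phi_selfadjoint: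
  assumes "(\<lambda>t. complex_of_real (f t)) \<in> BB"
  shows "selfadjoint (\<Phi> (\<lambda>t. complex_of_real (f t)))"
  using assms by (intro selfadjointI) (simp_all add: Phi_clinear Phi_adj)

lemma uniform_integral:
  fixes f :: "real \<Rightarrow> real"
  assumes [measurable]: "f \<in> borel_measurable borel"
  shows "(\<integral>t. f t \<partial>uniform_01) = (LINT t:{0..1}|lborel. f t)"
proof -
  have eq: "uniform_01 = density lborel (\<lambda>t. ennreal (indicator {0..1} t))"
    unfolding uniform_01_def uniform_measure_def
    by (intro density_cong) (auto simp: indicator_def)
  show ?thesis unfolding eq set_lebesgue_integral_def
    by (subst integral_density) auto
qed

lemma uniform_power_integral: "(LINT t:{0..1}|lborel. t ^ k) = 1 / real (Suc k)"
  using integral_power[of 0 1 k] by (simp add: set_lebesgue_integral_def mult.commute)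

lemma tau_power: "\<tau> (op_pow D0 k) = complex_of_real (LINT t:{0..1}|lborel. t ^ k)"
  using D0_dist by (simp add: has_distribution_def uniform_integral)

lemma norm_op_pow: "norm (op_pow A k) \<le> norm A ^ k" for A :: "'h op"
proof (induction k)
  case 0
  show ?case using norm_blinfun_id_le by simp
next
  case (Suc k)
  have "norm (A \<odot> op_pow A k) \<le> norm A * norm (op_pow A k)" by (rule norm_op_mult)
  also have "\<dots> \<le> norm A * norm A ^ k" by (intro mult_left_mono Suc) simp
  finally show ?case by (simp add: op_pow_Suc)
qed

text \<open>A norm below 1 would make the moments \<open>1 / (k + 1)\<close> decay geometrically.
  The bound is what places \<open>[0,1]\<close> inside the interval on which functions in
  \<open>BB\<close> are controlled.\<close>

lemma norm_D0: "norm D0 \<ge> 1"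
proof (rule ccontr)
  assume "\<not> ?thesis"
  then have r: "norm D0 < 1" by simp
  have "1 / real (Suc k) \<le> norm D0 ^ k" for k
  proof -
    have "1 / real (Suc k) = cmod (\<tau> (op_pow D0 k))"
      unfolding tau_power uniform_power_integral by (simp add: norm_divide del: of_nat_Suc)
    also have "\<dots> \<le> norm (op_pow D0 k)" by (intro tau_le_norm M_intros D0_M)
    finally show ?thesis using norm_op_pow[of D0 k] by linarith
  qed
  then have "1 \<le> real (Suc k) * norm D0 ^ k" for k by (simp add: field_simps del: of_nat_Suc)
  moreover have "(\<lambda>k. real k * norm D0 ^ k + norm D0 ^ k) \<longlonglongrightarrow> 0 + 0"
    using r by (intro tendsto_add powser_times_n_limit_0 LIMSEQ_power_zero) auto
  then have "(\<lambda>k. real (Suc k) * norm D0 ^ k) \<longlonglongrightarrow> 0" by (simp add: algebra_simps)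
  ultimately have "1 \<le> (0::real)" by (intro LIMSEQ_le_const) auto
  then show False by simp
qed

lemma unit_subset: "t \<in> {0..1} \<Longrightarrow> t \<in> {- norm D0..norm D0}"
  using norm_D0 by auto

lemma BB_integrable:
  assumes f: "f \<in> BB" shows "set_integrable lborel {0..1} f"
proof -
  obtain C where "\<And>t. t \<in> {- norm D0..norm D0} \<Longrightarrow> cmod (f t) \<le> C" using bdd_borelE[OF f] by blast
  then show ?thesis unfolding set_integrable_def
    using bdd_borel_measurable[OF f] unit_subset
    by (intro integrableI_bounded_set_indicator[of _ _ _ C]) auto
qed

lemma set_integral_norm_le:
  fixes f :: "real \<Rightarrow> 'b::{banach,second_countable_topology}"
  assumes "set_integrable lborel {0..1} f" "\<And>t. t \<in> {0..1} \<Longrightarrow> norm (f t) \<le> C"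
  shows "norm (LINT t:{0..1}|lborel. f t) \<le> C"
proof -
  have "norm (LINT t:{0..1}|lborel. f t) \<le> (LINT t:{0..1}|lborel. norm (f t))"
    by (rule set_integral_norm_bound[OF assms(1)])
  also have "\<dots> \<le> (LINT t:{0..1::real}|lborel. C)"
    by (intro set_integral_mono set_integrable_norm assms) (auto simp: set_integrable_def)
  also have "\<dots> = C" by (simp add: set_lebesgue_integral_def)
  finally show ?thesis .
qed

lemma set_integral_incseq_tendsto:
  assumes "\<And>n::nat. u n \<in> borel_measurable borel" "f \<in> borel_measurable borel"
    "\<And>n t. cmod (u n t) \<le> C" "\<And>t. (\<lambda>n. u n t) \<longlonglongrightarrow> f t"
  shows "(\<lambda>n. LINT t:{0..1::real}|lborel. u n t :: complex) \<longlonglongrightarrow> (LINT t:{0..1}|lborel. f t)"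
  unfolding set_lebesgue_integral_def
proof (rule integral_dominated_convergence[where w = "\<lambda>t. indicator {0..1} t * C"])
  show "integrable lborel (\<lambda>t. indicator {0..1::real} t * C)" by simp
  show "AE t in lborel. norm (indicator {0..1} t *\<^sub>R u n t) \<le> indicator {0..1} t * C" for n
    using assms(3) by (auto simp: indicator_def)
  show "AE t in lborel. (\<lambda>n. indicator {0..1} t *\<^sub>R u n t) \<longlonglongrightarrow> indicator {0..1} t *\<^sub>R f t"
    using assms(4) by (auto intro!: tendsto_scaleR)
qed (use assms in measurable)

text \<open>The hypothesis gives the moments of \<open>D0\<close> only. Uniform limits follow from
  norm continuity of \<tau>; for increasing limits normality on the left meets dominated convergence
  on the right.\<close>

lemma tau_Phi:
  assumes "f \<in> BB" shows "\<tau> (\<Phi> f) = (LINT t:{0..1}|lborel. f t)"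
  using assms
proof (induction rule: bdd_borel_induct)
  case (power k)
  show ?case unfolding Phi_power tau_power
    by (simp add: set_integral_complex_of_real[symmetric])
next
  case (add f g)
  then show ?case by (simp add: Phi_add tau_add Phi_M BB_integrable set_integral_add)
next
  case (cmult c f)
  then show ?case by (simp add: Phi_cmult tau_scalar_mult Phi_M)
next
  case (uniform u f)
  have "(\<lambda>n. \<tau> (\<Phi> (u n))) \<longlonglongrightarrow> \<tau> (\<Phi> f)"
    using uniform by (intro tau_tendsto Phi_uniform_tendsto Phi_M) auto
  moreover have "(\<lambda>n. \<tau> (\<Phi> (u n))) \<longlonglongrightarrow> (LINT t:{0..1}|lborel. f t)"
  proof -
    have "cmod ((LINT t:{0..1}|lborel. u n t) - (LINT t:{0..1}|lborel. f t)) \<le> 1 / real (Suc n)" for n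
    proof -
      have "(LINT t:{0..1}|lborel. u n t) - (LINT t:{0..1}|lborel. f t) = (LINT t:{0..1}|lborel. u n t - f t)"
        using uniform by (intro set_integral_diff(2)[symmetric] BB_integrable) auto
      moreover have "cmod (LINT t:{0..1}|lborel. u n t - f t) \<le> 1 / real (Suc n)"
        using uniform unit_subset
        by (intro set_integral_norm_le BB_integrable bdd_borel_diff)
          (auto simp: norm_minus_commute[of "u n _"] simp del: of_nat_Suc)
      ultimately show ?thesis by simp
    qed
    then have "(\<lambda>n. (LINT t:{0..1}|lborel. u n t) - (LINT t:{0..1}|lborel. f t)) \<longlonglongrightarrow> 0"
      by (intro Lim_null_comparison[OF always_eventually LIMSEQ_Suc[OF lim_1_over_n]]) auto
    then show ?thesis by (simp add: uniform LIM_zero_iff)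
  qed
  ultimately show ?case by (rule LIMSEQ_unique)
next
  case (increasing u f C)
  note bb = incr_bdd_borel[of u f, OF increasing(1,2,3,5,6)]
  have "(\<lambda>n. Re (\<tau> (\<Phi> (\<lambda>t. complex_of_real (u n t))))) \<longlonglongrightarrow> Re (\<tau> (\<Phi> (\<lambda>t. complex_of_real (f t))))"
  proof (rule tau_incseq)
    show "op_le (\<Phi> (\<lambda>t. complex_of_real (u n t))) (\<Phi> (\<lambda>t. complex_of_real (u (Suc n) t)))" for n
    proof -
      \<comment> \<open>The root of the increment exhibits the difference of consecutive operators
        as \<open>adj (\<Phi> h) \<odot> \<Phi> h\<close>, hence as positive.\<close>
      define h where "h t = complex_of_real (sqrt (u (Suc n) t - u n t))" for t
      have "\<bar>sqrt (u (Suc n) t - u n t)\<bar> \<le> sqrt C" for t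
        using increasing(3)[of n t] increasing(4)[of n t] increasing(5)[of "Suc n" t] increasing(6)[of t]
        by auto
      then have h: "h \<in> BB" unfolding h_def using increasing(1) by (intro bdd_borel_of_real) auto
      have "\<Phi> (\<lambda>t. complex_of_real (u (Suc n) t)) - \<Phi> (\<lambda>t. complex_of_real (u n t))
          = \<Phi> (\<lambda>t. cnj (h t) * h t)"
      proof (subst Phi_diff[OF bb(1) bb(1), symmetric], rule arg_cong[of _ _ \<Phi>], rule ext)
        fix t
        have "sqrt (u (Suc n) t - u n t) * sqrt (u (Suc n) t - u n t) = u (Suc n) t - u n t"
          using increasing(4)[of n t] by simp
        then show "complex_of_real (u (Suc n) t) - complex_of_real (u n t) = cnj (h t) * h t"
          by (simp add: h_def of_real_mult[symmetric] del: of_real_mult real_sqrt_mult_self)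
      qed
      also have "\<dots> = adj (\<Phi> h) \<odot> \<Phi> h" using h by (simp add: Phi_mult bdd_borel_cnj Phi_adj)
      finally show ?thesis
        using h by (simp add: op_le_def positive_op_def cinner_adj_left Phi_clinear cinner_self)
    qed
  qed (use bb Phi_M Phi_selfadjoint incr_Phi_tendsto[of u f, OF increasing(1,2,3,5,6,7)] in auto)
  moreover have real: "Im (\<tau> (\<Phi> (\<lambda>t. complex_of_real (g t)))) = 0"
    if "(\<lambda>t. complex_of_real (g t)) \<in> BB" for g
    using tau_adj[OF Phi_M[OF that]] adj_selfadjoint[OF Phi_selfadjoint[OF that]]
    by (simp add: complex_eq_iff)
  ultimately have "(\<lambda>n. complex_of_real (Re (\<tau> (\<Phi> (\<lambda>t. complex_of_real (u n t))))))
      \<longlonglongrightarrow> complex_of_real (Re (\<tau> (\<Phi> (\<lambda>t. complex_of_real (f t)))))"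
    by (intro tendsto_of_real)
  then have "(\<lambda>n. \<tau> (\<Phi> (\<lambda>t. complex_of_real (u n t)))) \<longlonglongrightarrow> \<tau> (\<Phi> (\<lambda>t. complex_of_real (f t)))"
  proof -
    have "complex_of_real (Re (\<tau> (\<Phi> (\<lambda>t. complex_of_real (g t))))) = \<tau> (\<Phi> (\<lambda>t. complex_of_real (g t)))"
      if "(\<lambda>t. complex_of_real (g t)) \<in> BB" for g
      using real[OF that] by (simp add: complex_eq_iff)
    then show ?thesis using \<open>(\<lambda>n. complex_of_real (Re _)) \<longlonglongrightarrow> _\<close> bb by simp
  qed
  moreover have "(\<lambda>n. \<tau> (\<Phi> (\<lambda>t. complex_of_real (u n t)))) \<longlonglongrightarrow> (LINT t:{0..1}|lborel. complex_of_real (f t))"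
    unfolding increasing(8)
  proof (rule set_integral_incseq_tendsto[where C = C])
    show "cmod (complex_of_real (u n t)) \<le> C" for n t
      using increasing(3)[of n t] increasing(5)[of n t] increasing(6)[of t] by simp
  qed (use increasing in \<open>auto intro: tendsto_of_real\<close>)
  ultimately show ?case by (rule LIMSEQ_unique)
qed

lemma tnorm_Phi:
  assumes f: "f \<in> BB"
  shows "complex_of_real ((tnorm (\<Phi> f))\<^sup>2) = (LINT t:{0..1}|lborel. cnj (f t) * f t)"
  using tau_adj_mult_self[OF Phi_M[OF f]] tau_Phi[OF bdd_borel_mult[OF bdd_borel_cnj[OF f] f]] f
  by (simp add: Phi_adj Phi_mult bdd_borel_cnj)

text \<open>The squared 2-norm of a function of \<open>D0\<close> is an integral over
  \<open>[0,1]\<close>, so dominated convergence turns the increasing limit into a 2-norm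
  limit.\<close>

lemma incr_tnorm_tendsto:
  assumes u: "\<And>n::nat. u n \<in> borel_measurable borel" "f \<in> borel_measurable borel"
    "\<And>n t. 0 \<le> u n t" "\<And>n t. u n t \<le> f t" "\<And>t. f t \<le> C" "\<And>t. (\<lambda>n. u n t) \<longlonglongrightarrow> f t"
  shows "(\<lambda>n. tnorm (\<Phi> (\<lambda>t. complex_of_real (u n t)) - \<Phi> (\<lambda>t. complex_of_real (f t)))) \<longlonglongrightarrow> 0"
proof -
  note bb = incr_bdd_borel[of u f, OF u(1-5)]
  let ?d = "\<lambda>n t. complex_of_real (u n t) - complex_of_real (f t)"
  have d: "?d n \<in> BB" for n by (intro bdd_borel_diff bb)
  have dm: "?d n \<in> borel_measurable borel" for n using d by (rule bdd_borel_measurable)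
  have "(\<lambda>n. LINT t:{0..1}|lborel. cnj (?d n t) * ?d n t) \<longlonglongrightarrow> (LINT t:{0..1::real}|lborel. 0)"
  proof (rule set_integral_incseq_tendsto[where C = "C * C"])
    show "cmod (cnj (?d n t) * ?d n t) \<le> C * C" for n t
    proof -
      have "cmod (?d n t) = \<bar>u n t - f t\<bar>" by (metis norm_of_real of_real_diff)
      then have "cmod (?d n t) \<le> C" using u(3)[of n t] u(4)[of n t] u(5)[of t] by simp
      moreover from this have "0 \<le> C" by (rule order_trans[OF norm_ge_zero])
      ultimately show ?thesis unfolding norm_mult complex_mod_cnj by (intro mult_mono) auto
    qed
    show "(\<lambda>n. cnj (?d n t) * ?d n t) \<longlonglongrightarrow> 0" for t
    proof -
      have "(\<lambda>n. ?d n t) \<longlonglongrightarrow> complex_of_real (f t) - complex_of_real (f t)"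
        by (intro tendsto_intros u)
      then have d0: "(\<lambda>n. ?d n t) \<longlonglongrightarrow> 0" by simp
      show ?thesis using tendsto_mult[OF tendsto_cnj[OF d0] d0] by simp
    qed
    show "(\<lambda>t. cnj (?d n t) * ?d n t) \<in> borel_measurable borel" for n
      using bdd_borel_measurable[OF bdd_borel_mult[OF bdd_borel_cnj[OF d] d]] .
  qed simp
  then have "(\<lambda>n. complex_of_real ((tnorm (\<Phi> (?d n)))\<^sup>2)) \<longlonglongrightarrow> 0"
    by (simp add: tnorm_Phi[OF d] del: of_real_power)
  then have "(\<lambda>n. Re (complex_of_real ((tnorm (\<Phi> (?d n)))\<^sup>2))) \<longlonglongrightarrow> Re 0" by (rule tendsto_Re)
  then have "(\<lambda>n. (tnorm (\<Phi> (?d n)))\<^sup>2) \<longlonglongrightarrow> 0"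
    by (simp only: Re_complex_of_real zero_complex.sel)
  then have "(\<lambda>n. sqrt ((tnorm (\<Phi> (?d n)))\<^sup>2)) \<longlonglongrightarrow> sqrt 0" by (rule tendsto_real_sqrt)
  then show ?thesis by (simp add: tnorm_nonneg Phi_M d Phi_diff bb M_diff)
qed

text \<open>The passage from polynomials to Borel functions under freeness: both sides are linear in
  the middle factor and continuous for the 2-norm, and \<open>bdd_borel_induct\<close> needs nothing
  more.\<close>

lemma tau_Phi_extend:
  assumes f: "f \<in> BB" and B: "B \<in> M" and C: "C \<in> M"
    and mono: "\<And>k. \<tau> (B \<odot> (op_pow D0 k \<odot> C)) = c * \<tau> (op_pow D0 k)"
  shows "\<tau> (B \<odot> (\<Phi> f \<odot> C)) = c * \<tau> (\<Phi> f)"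
proof -
  have lim: "(\<lambda>n. \<tau> (B \<odot> (A n \<odot> C))) \<longlonglongrightarrow> \<tau> (B \<odot> (A' \<odot> C)) \<and> (\<lambda>n. c * \<tau> (A n)) \<longlonglongrightarrow> c * \<tau> A'"
    if A: "\<And>n. A n \<in> M" "A' \<in> M" and t: "(\<lambda>n. tnorm (A n - A')) \<longlonglongrightarrow> 0" for A A'
  proof
    have "(\<lambda>n. \<tau> (B \<odot> (A n \<odot> C)) - \<tau> (B \<odot> (A' \<odot> C))) \<longlonglongrightarrow> 0"
    proof (rule Lim_null_comparison[OF always_eventually tendsto_mult_right_zero[OF t, of "norm B * norm C"]], rule allI)
      fix n
      have "\<tau> (B \<odot> (A n \<odot> C)) - \<tau> (B \<odot> (A' \<odot> C)) = \<tau> (B \<odot> ((A n - A') \<odot> C))"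
        using A B C by (simp add: op_diff_left op_diff_right tau_diff M_intros)
      then show "cmod (\<tau> (B \<odot> (A n \<odot> C)) - \<tau> (B \<odot> (A' \<odot> C))) \<le> norm B * norm C * tnorm (A n - A')"
        using tau_mult3_le[OF M_diff B C, of "A n" A'] A by simp
    qed
    then show "(\<lambda>n. \<tau> (B \<odot> (A n \<odot> C))) \<longlonglongrightarrow> \<tau> (B \<odot> (A' \<odot> C))" by (simp add: LIM_zero_iff)
    have "(\<lambda>n. \<tau> (A n) - \<tau> A') \<longlonglongrightarrow> 0"
      by (rule Lim_null_comparison[OF always_eventually t])
        (use A in \<open>auto simp: tau_diff[symmetric] intro!: tau_le_tnorm M_diff\<close>)
    then show "(\<lambda>n. c * \<tau> (A n)) \<longlonglongrightarrow> c * \<tau> A'" by (intro tendsto_mult_left) (simp add: LIM_zero_iff)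
  qed
  show ?thesis using f
  proof (induction rule: bdd_borel_induct)
    case (power k)
    show ?case unfolding Phi_power by (rule mono)
  next
    case (add f g)
    then show ?case
      using B C by (simp add: Phi_add tau_add Phi_M M_intros op_add_left op_add_right distrib_left)
  next
    case (cmult a f)
    have "B \<odot> ((scalar_op a \<odot> \<Phi> f) \<odot> C) = scalar_op a \<odot> (B \<odot> (\<Phi> f \<odot> C))"
      using scalar_commute[OF M_clinear[OF B], of a] by (metis op_assoc)
    then show ?case using cmult B C by (simp add: Phi_cmult tau_scalar_mult Phi_M M_intros)
  next
    case (uniform u f)
    have "(\<lambda>n. norm (\<Phi> (u n) - \<Phi> f)) \<longlonglongrightarrow> 0"
      using Phi_uniform_tendsto[of u f] uniform by (simp add: LIM_zero_iff tendsto_norm_zero_iff)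
    then have "(\<lambda>n. tnorm (\<Phi> (u n) - \<Phi> f)) \<longlonglongrightarrow> 0"
      by (rule Lim_null_comparison[rotated])
        (use uniform in \<open>auto simp: always_eventually tnorm_nonneg Phi_M M_diff tnorm_le_norm\<close>)
    from lim[OF _ _ this] uniform show ?case by (auto simp: Phi_M intro: LIMSEQ_unique)
  next
    case (increasing u f K)
    note bb = incr_bdd_borel[of u f, OF increasing(1,2,3,5,6)]
    from lim[OF _ _ incr_tnorm_tendsto[of u f, OF increasing(1,2,3,5,6,7)]] increasing(8) bb
    show ?case by (auto simp: Phi_M intro: LIMSEQ_unique)
  qed
qed

end

section \<open>The von Neumann algebra generated by the diagonal operator\<close>

text \<open>Invariance of \<open>V\<close> under \<open>adj B\<close> makes the orthogonal
  complement of \<open>V\<close> invariant under \<open>B\<close>, so \<open>B\<close> respects the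
  whole decomposition.\<close>

lemma projection_commutes:
  fixes V :: "('h::complex_hilbert) set"
  assumes P: "\<And>x. blinfun_apply P x \<in> V" "\<And>x. x \<in> V \<Longrightarrow> blinfun_apply P x = x"
    "\<And>x w. w \<in> V \<Longrightarrow> cinner (x - blinfun_apply P x) w = 0"
    and B: "B \<in> clinear_ops" "\<And>v. v \<in> V \<Longrightarrow> blinfun_apply B v \<in> V"
    "\<And>v. v \<in> V \<Longrightarrow> blinfun_apply (adj B) v \<in> V"
  shows "P \<odot> B = B \<odot> P"
proof (rule blinfun_eqI)
  fix x
  let ?u = "blinfun_apply B (x - blinfun_apply P x)"
  have u: "cinner ?u w = 0" if "w \<in> V" for w
    using P(3)[OF B(3)[OF that], of x] by (simp only: cinner_adj_right[OF B(1)])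
  have "cinner (blinfun_apply P ?u) (blinfun_apply P ?u) = 0"
    using u[OF P(1)[of ?u]] P(3)[OF P(1), of ?u ?u] by (simp add: cinner_diff_left)
  then have "blinfun_apply P ?u = 0" by simp
  then have "blinfun_apply P (blinfun_apply B x) = blinfun_apply P (blinfun_apply B (blinfun_apply P x))"
    by (simp add: blinfun.diff_right)
  also have "\<dots> = blinfun_apply B (blinfun_apply P x)" by (intro P(2) B(2) P(1))
  finally show "blinfun_apply (P \<odot> B) x = blinfun_apply (B \<odot> P) x" by simp
qed

lemma closure_invariant:
  assumes "\<And>v. v \<in> S \<Longrightarrow> blinfun_apply B v \<in> S" "v \<in> closure S"
  shows "blinfun_apply B v \<in> closure S"
proof -
  obtain u where "\<forall>n. u n \<in> S" "u \<longlonglongrightarrow> v"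
    using assms(2) unfolding closure_sequential by blast
  then show ?thesis unfolding closure_sequential
    using assms(1) by (intro exI[of _ "\<lambda>n. blinfun_apply B (u n)"]) (auto intro: tendsto_intros)
qed

lemma closure_agree:
  assumes "\<And>v. v \<in> S \<Longrightarrow> blinfun_apply A v = blinfun_apply B v" "v \<in> closure S"
  shows "blinfun_apply A v = blinfun_apply B v"
proof -
  obtain u where u: "\<forall>n. u n \<in> S" "u \<longlonglongrightarrow> v"
    using assms(2) unfolding closure_sequential by blast
  have "(\<lambda>n. blinfun_apply A (u n)) \<longlonglongrightarrow> blinfun_apply A v" by (intro tendsto_intros u)
  moreover have "(\<lambda>n. blinfun_apply B (u n)) \<longlonglongrightarrow> blinfun_apply B v" by (intro tendsto_intros u)
  moreover have "(\<lambda>n. blinfun_apply A (u n)) = (\<lambda>n. blinfun_apply B (u n))" using assms(1) u(1) by auto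
  ultimately show ?thesis using LIMSEQ_unique by metis
qed

lemma ex_measure:
  fixes L :: "real set \<Rightarrow> real"
  assumes pos: "\<And>B. 0 \<le> L B"
    and sums: "\<And>A. range A \<subseteq> sets borel \<Longrightarrow> disjoint_family A \<Longrightarrow> (\<lambda>i. L (A i)) sums L (\<Union>i. A i)"
  shows "\<exists>\<mu>. sets \<mu> = sets borel \<and> (\<forall>B\<in>sets borel. emeasure \<mu> B = ennreal (L B))"
proof -
  let ?m = "\<lambda>B. ennreal (L B)"
  let ?\<mu> = "measure_of UNIV (sets borel) ?m"
  \<comment> \<open>A convergent series of equal terms \<open>L {}\<close> forces
    \<open>L {} = 0\<close>.\<close>
  have "(\<lambda>i::nat. L {}) sums L {}" using sums[of "\<lambda>_. {}"] by (simp add: disjoint_family_on_def)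
  then have "(\<lambda>i::nat. L {}) \<longlonglongrightarrow> 0" using summable_LIMSEQ_zero sums_summable by blast
  then have L0: "L {} = 0" by (simp add: LIMSEQ_const_iff)
  have "emeasure ?\<mu> B = ?m B" if "B \<in> sets borel" for B
  proof (rule emeasure_measure_of_sigma)
    show "sigma_algebra UNIV (sets (borel :: real measure))"
      using sets.sigma_algebra_axioms[of "borel :: real measure"] by simp
    show "positive (sets borel) ?m" by (simp add: positive_def L0)
    show "countably_additive (sets borel) ?m"
      unfolding countably_additive_def by (intro allI impI suminf_ennreal_eq pos sums)
  qed fact
  moreover have "sets ?\<mu> = sets borel"
    using sets.sigma_sets_eq[of "borel :: real measure"] by (simp add: sets_measure_of)
  ultimately show ?thesis by blast
qed

section \<open>Cyclic subspaces of the commutant\<close>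

context calculus
begin

lemma D0_clinear: "D0 \<in> clinear_ops"
  using Phi_clinear[OF bdd_borel_id] by (simp add: Phi_id)

lemma adj_D0: "adj D0 = D0"
  using Phi_adj[OF bdd_borel_id] by (simp add: Phi_id)

abbreviation "N1 \<equiv> commutant {D0}"
abbreviation "N2 \<equiv> commutant N1"

lemma N1_clinear: "B \<in> N1 \<Longrightarrow> B \<in> clinear_ops"
  using commutant_clinear by blast

lemma N2_clinear: "B \<in> N2 \<Longrightarrow> B \<in> clinear_ops"
  using commutant_clinear by blast

lemma N1_adj: "B \<in> N1 \<Longrightarrow> adj B \<in> N1"
  by (rule commutant_adj) (auto simp: D0_clinear adj_D0)

lemma N2_adj: "B \<in> N2 \<Longrightarrow> adj B \<in> N2"
  by (rule commutant_adj) (auto simp: N1_clinear N1_adj)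

lemma N2_subset_N1: "N2 \<subseteq> N1"
  by (rule commutant_antimono) (simp add: commutant_def D0_clinear)

lemma N1_commute: "A \<in> N2 \<Longrightarrow> B \<in> N1 \<Longrightarrow> A \<odot> B = B \<odot> A"
  using commutantD[of A N1 B] by simp

lemma Phi_N2: "f \<in> BB \<Longrightarrow> \<Phi> f \<in> N2"
  by (rule Phi_bicommutant) simp_all

lemma N1_id: "id_blinfun \<in> N1"
  by (simp add: commutant_def clinear_id)

lemma N2_scalar: "scalar_op c \<in> N2"
  by (rule commutant_scalar) (rule commutant_clinear)

text \<open>The cyclic subspace is taken for the commutant of \<open>D0\<close>, not for
  \<open>D0\<close> itself. Its projection then commutes with \<open>N1\<close> and belongs to
  \<open>N2\<close>, and an element of \<open>N2\<close> is determined on it by its value at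
  \<open>x\<close>.\<close>

definition orbit :: "'h \<Rightarrow> 'h set" where
  "orbit x = closure {blinfun_apply B x | B. B \<in> N1}"

lemma orbit_csubspace: "closed_csubspace (orbit x)"
  unfolding orbit_def
proof (rule closed_csubspace_closure)
  show "0 \<in> {blinfun_apply B x | B. B \<in> N1}"
    by (auto intro!: exI[of _ 0] simp: commutant_def clinear_zero)
  show "u + v \<in> {blinfun_apply B x | B. B \<in> N1}"
    if "u \<in> {blinfun_apply B x | B. B \<in> N1}" "v \<in> {blinfun_apply B x | B. B \<in> N1}" for u v
    using that commutant_add by (fastforce simp: blinfun.add_left[symmetric])
  show "scaleC c u \<in> {blinfun_apply B x | B. B \<in> N1}" if u: "u \<in> {blinfun_apply B x | B. B \<in> N1}" for c u
  proof -
    obtain B where B: "u = blinfun_apply B x" "B \<in> N1" using u by blast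
    have "scalar_op c \<odot> B \<in> N1"
      using B(2) by (intro commutant_mult commutant_scalar) (auto simp: D0_clinear)
    then show ?thesis using B(1) by (auto intro!: exI[of _ "scalar_op c \<odot> B"])
  qed
qed

lemma orbit_self: "x \<in> orbit x"
  unfolding orbit_def using closure_subset N1_id by (fastforce intro!: exI[of _ id_blinfun])

lemma orbit_invariant: "B \<in> N1 \<Longrightarrow> v \<in> orbit x \<Longrightarrow> blinfun_apply B v \<in> orbit x"
  unfolding orbit_def
proof (rule closure_invariant)
  fix v assume B: "B \<in> N1" and "v \<in> {blinfun_apply B x | B. B \<in> N1}"
  then obtain C where C: "v = blinfun_apply C x" "C \<in> N1" by blast
  then have "blinfun_apply B v = blinfun_apply (B \<odot> C) x" by simp
  then show "blinfun_apply B v \<in> {blinfun_apply B x | B. B \<in> N1}"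
    using commutant_mult[OF B C(2)] by blast
qed

lemma orbit_mono:
  assumes "x \<in> orbit z" shows "orbit x \<subseteq> orbit z"
  using orbit_invariant[OF _ assms] orbit_csubspace[of z]
  unfolding orbit_def[of x] closed_csubspace_def by (intro closure_minimal) auto

definition orbit_proj :: "'h \<Rightarrow> 'h op" where
  "orbit_proj x = (SOME P. P \<in> clinear_ops \<and> (\<forall>u. blinfun_apply P u \<in> orbit x) \<and>
     (\<forall>u\<in>orbit x. blinfun_apply P u = u) \<and>
     (\<forall>u. \<forall>w\<in>orbit x. cinner (u - blinfun_apply P u) w = 0) \<and> is_adjoint P P)"

lemma orbit_proj:
  "orbit_proj x \<in> clinear_ops" "blinfun_apply (orbit_proj x) u \<in> orbit x"
  "u \<in> orbit x \<Longrightarrow> blinfun_apply (orbit_proj x) u = u"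
  "w \<in> orbit x \<Longrightarrow> cinner (u - blinfun_apply (orbit_proj x) u) w = 0"
  "is_adjoint (orbit_proj x) (orbit_proj x)"
proof -
  obtain P where "P \<in> clinear_ops" "\<And>u. blinfun_apply P u \<in> orbit x"
    "\<And>u. u \<in> orbit x \<Longrightarrow> blinfun_apply P u = u"
    "\<And>u w. w \<in> orbit x \<Longrightarrow> cinner (u - blinfun_apply P u) w = 0" "is_adjoint P P"
    using ex_projection[OF orbit_csubspace] by blast
  then have "\<exists>P. P \<in> clinear_ops \<and> (\<forall>u. blinfun_apply P u \<in> orbit x) \<and>
     (\<forall>u\<in>orbit x. blinfun_apply P u = u) \<and>
     (\<forall>u. \<forall>w\<in>orbit x. cinner (u - blinfun_apply P u) w = 0) \<and> is_adjoint P P" by blast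
  from someI_ex[OF this, folded orbit_proj_def]
  show "orbit_proj x \<in> clinear_ops" "blinfun_apply (orbit_proj x) u \<in> orbit x"
    "u \<in> orbit x \<Longrightarrow> blinfun_apply (orbit_proj x) u = u"
    "w \<in> orbit x \<Longrightarrow> cinner (u - blinfun_apply (orbit_proj x) u) w = 0"
    "is_adjoint (orbit_proj x) (orbit_proj x)"
    by blast+
qed

lemma orbit_proj_N2: "orbit_proj x \<in> N2"
proof -
  have "orbit_proj x \<odot> B = B \<odot> orbit_proj x" if B: "B \<in> N1" for B
    by (rule projection_commutes[of _ "orbit x"])
      (use orbit_proj orbit_invariant B N1_adj N1_clinear in auto)
  then show ?thesis unfolding commutant_def[of N1] using orbit_proj(1) by auto
qed

lemma orbit_proj_idem: "orbit_proj x \<odot> orbit_proj x = orbit_proj x"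
  by (rule blinfun_eqI) (simp add: orbit_proj)

lemma orbit_proj_quadratic:
  "cinner (blinfun_apply (orbit_proj x) u) u = complex_of_real ((norm (blinfun_apply (orbit_proj x) u))\<^sup>2)"
proof -
  have "cinner (blinfun_apply (orbit_proj x) u) u
      = cinner (blinfun_apply (orbit_proj x) (blinfun_apply (orbit_proj x) u)) u"
    by (simp add: orbit_proj)
  also have "\<dots> = cinner (blinfun_apply (orbit_proj x) u) (blinfun_apply (orbit_proj x) u)"
    using orbit_proj(5)[of x] unfolding is_adjoint_def by blast
  finally show ?thesis by (simp only: cinner_self)
qed

lemma orbit_proj_contract: "norm (blinfun_apply (orbit_proj x) u) \<le> norm u"
proof -
  have "(norm (blinfun_apply (orbit_proj x) u))\<^sup>2 = cmod (cinner (blinfun_apply (orbit_proj x) u) u)"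
    by (simp add: orbit_proj_quadratic norm_power)
  also have "\<dots> \<le> norm (blinfun_apply (orbit_proj x) u) * norm u" by (rule cinner_Cauchy_Schwarz)
  finally show ?thesis
    by (cases "blinfun_apply (orbit_proj x) u = 0") (auto simp: power2_eq_square)
qed

lemma orbit_proj_mono:
  assumes "orbit x \<subseteq> orbit z" shows "op_le (orbit_proj x) (orbit_proj z)"
proof -
  have "norm (blinfun_apply (orbit_proj x) u) \<le> norm (blinfun_apply (orbit_proj z) u)" for u
  proof -
    let ?v = "u - blinfun_apply (orbit_proj z) u"
    \<comment> \<open>The component of \<open>u\<close> orthogonal to the larger orbit is orthogonal
      to the smaller one too, so the smaller projection kills it.\<close>
    have "cinner ?v (blinfun_apply (orbit_proj x) ?v) = 0"
      using orbit_proj(2)[of x ?v] assms by (intro orbit_proj(4)) auto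
    then have "blinfun_apply (orbit_proj x) ?v = 0"
      using orbit_proj_quadratic[of x ?v] cinner_commute[of "blinfun_apply (orbit_proj x) ?v" ?v] by simp
    then have "blinfun_apply (orbit_proj x) u = blinfun_apply (orbit_proj x) (blinfun_apply (orbit_proj z) u)"
      by (simp add: blinfun.diff_right)
    then show ?thesis using orbit_proj_contract[of x] by metis
  qed
  then have *: "(norm (blinfun_apply (orbit_proj x) u))\<^sup>2 \<le> (norm (blinfun_apply (orbit_proj z) u))\<^sup>2" for u
    by (intro power_mono) auto
  show ?thesis
    unfolding op_le_def positive_op_def blinfun.diff_left cinner_diff_left orbit_proj_quadratic
      of_real_diff[symmetric] nonneg_Reals_of_real_iff using * by simp
qed

text \<open>Two orbits are contained in the orbit of \<open>x + (1 - e) y\<close>, where \<open>e\<close> projects onto the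
  orbit of \<open>x\<close>; this makes the family of orbit projections directed.\<close>
lemma orbit_directed: "\<exists>z. orbit x \<subseteq> orbit z \<and> orbit y \<subseteq> orbit z"
proof -
  let ?P = "orbit_proj x"
  define z where "z = x + (y - blinfun_apply ?P y)"
  have PN: "?P \<in> N1" using orbit_proj_N2 N2_subset_N1 by blast
  have "blinfun_apply ?P z = x"
    by (simp add: z_def blinfun.add_right blinfun.diff_right orbit_proj orbit_self)
  then have xz: "x \<in> orbit z" using orbit_invariant[OF PN orbit_self[of z]] by simp
  have "blinfun_apply ?P y \<in> orbit z" using orbit_proj(2) orbit_mono[OF xz] by blast
  moreover have "z - x \<in> orbit z" by (intro closed_csubspace_diff orbit_csubspace orbit_self xz)
  ultimately have "(z - x) + blinfun_apply ?P y \<in> orbit z"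
    using orbit_csubspace[of z] unfolding closed_csubspace_def by blast
  then have "y \<in> orbit z" by (simp add: z_def)
  then show ?thesis using orbit_mono xz by blast
qed

section \<open>Spectral measures and Radon-Nikodym densities\<close>

lemma Phi_indicator_sums:
  assumes A: "range A \<subseteq> sets borel" "disjoint_family A"
  shows "(\<lambda>i. blinfun_apply (\<Phi> (indicator (A i))) x) sums blinfun_apply (\<Phi> (indicator (\<Union>i. A i))) x"
proof -
  have Ab: "A i \<in> sets borel" for i using A by auto
  have eq: "(\<Sum>i<n. indicator (A i) t) = (indicator (\<Union>i<n. A i) t :: complex)" for n t
    by (rule indicator_UN_disjoint[symmetric]) (use A in \<open>auto intro: disjoint_family_on_mono\<close>)
  have sum: "\<Phi> (\<lambda>t. \<Sum>i<n. indicator (A i) t) = (\<Sum>i<n. \<Phi> (indicator (A i)))" for n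
  proof (induction n)
    case 0
    show ?case using Phi_const[of 0] by (simp add: scalar_zero)
  next
    case (Suc n)
    then show ?case by (simp add: Phi_add bdd_borel_sum bdd_borel_indicator Ab)
  qed
  have "(\<lambda>n. blinfun_apply (\<Phi> (indicator (\<Union>i<n. A i))) x) \<longlonglongrightarrow> blinfun_apply (\<Phi> (indicator (\<Union>i. A i))) x"
  proof (rule Phi_tendsto[where C = 1])
    show "indicator (\<Union>i<n. A i) \<in> borel_measurable borel" for n
      by (intro borel_measurable_indicator sets.finite_UN) (use Ab in auto)
    show "indicator (\<Union>i. A i) \<in> borel_measurable borel"
      by (intro borel_measurable_indicator sets.countable_UN) (use Ab in auto)
    show "(\<lambda>n. indicator (\<Union>i<n. A i) t) \<longlonglongrightarrow> indicator (\<Union>i. A i) t" for t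
      by (rule LIMSEQ_indicator_UN)
  qed (auto simp: indicator_def)
  moreover have "blinfun_apply (\<Phi> (indicator (\<Union>i<n. A i))) x = (\<Sum>i<n. blinfun_apply (\<Phi> (indicator (A i))) x)" for n
    unfolding blinfun.sum_left[symmetric] sum[symmetric] eq by simp
  ultimately show ?thesis by (simp add: sums_def)
qed

text \<open>As \<open>C\<close> commutes with the selfadjoint idempotent \<open>P\<close>, the set
  function \<open>B \<mapsto> \<langle>C P x, x\<rangle>\<close> is a quadratic form at
  \<open>P x\<close>. This makes its positivity and its domination by \<open>norm C\<close>
  visible.\<close>

lemma cinner_indicator:
  assumes C: "C \<in> N2" and B: "B \<in> sets borel"
  defines "P \<equiv> \<Phi> (indicator B)"
  shows "cinner (blinfun_apply (C \<odot> P) x) x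
    = cinner (blinfun_apply C (blinfun_apply P x)) (blinfun_apply P x)"
proof -
  have bB: "indicator B \<in> BB" using B by (rule bdd_borel_indicator)
  have "(\<lambda>t. cnj (indicator B t)) = indicator B" by (auto simp: indicator_def)
  then have PP: "adj P = P" using Phi_adj[OF bB] by (simp add: P_def)
  have idem: "P \<odot> P = P"
    unfolding P_def Phi_mult[OF bB bB, symmetric]
    by (rule arg_cong[of _ _ \<Phi>]) (auto simp: indicator_def)
  have cm: "C \<odot> P = P \<odot> C" using N1_commute[OF C] Phi_N2[OF bB] N2_subset_N1 by (auto simp: P_def)
  have "C \<odot> P = P \<odot> (C \<odot> P)" by (metis cm idem op_assoc)
  then have "cinner (blinfun_apply (C \<odot> P) x) x = cinner (blinfun_apply P (blinfun_apply C (blinfun_apply P x))) x"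
    by (metis blinfun_apply_blinfun_compose)
  also have "\<dots> = cinner (blinfun_apply C (blinfun_apply P x)) (blinfun_apply P x)"
    using cinner_adj_right[OF Phi_clinear[OF bB]] PP by (metis P_def)
  finally show ?thesis .
qed

lemma ex_spectral_measure:
  assumes C: "C \<in> N2" and pos: "positive_op C"
  shows "\<exists>\<mu>. sets \<mu> = sets borel \<and>
    (\<forall>B\<in>sets borel. emeasure \<mu> B = ennreal (Re (cinner (blinfun_apply (C \<odot> \<Phi> (indicator B)) x) x)) \<and>
      0 \<le> Re (cinner (blinfun_apply (C \<odot> \<Phi> (indicator B)) x) x) \<and>
      Im (cinner (blinfun_apply (C \<odot> \<Phi> (indicator B)) x) x) = 0)"
proof -
  define L where "L B = (if B \<in> sets borel then Re (cinner (blinfun_apply (C \<odot> \<Phi> (indicator B)) x) x) else 0)" for B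
  have nn: "cinner (blinfun_apply (C \<odot> \<Phi> (indicator B)) x) x \<in> \<real>\<^sub>\<ge>\<^sub>0" if "B \<in> sets borel" for B
    using pos unfolding cinner_indicator[OF C that] positive_op_def by blast
  have "\<exists>\<mu>. sets \<mu> = sets borel \<and> (\<forall>B\<in>sets borel. emeasure \<mu> B = ennreal (L B))"
  proof (rule ex_measure)
    show "0 \<le> L B" for B using nn[of B] by (auto simp: L_def complex_nonneg_Reals_iff)
    show "(\<lambda>i. L (A i)) sums L (\<Union>i. A i)" if A: "range A \<subseteq> sets borel" "disjoint_family A" for A
    proof -
      have Ab: "A i \<in> sets borel" "(\<Union>i. A i) \<in> sets borel" for i using A by auto
      have "(\<lambda>i. Re (cinner (blinfun_apply C (blinfun_apply (\<Phi> (indicator (A i))) x)) x))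
          sums Re (cinner (blinfun_apply C (blinfun_apply (\<Phi> (indicator (\<Union>i. A i))) x)) x)"
        by (intro sums_Re bounded_linear.sums[OF bounded_linear_cinner_left]
            bounded_linear.sums[OF blinfun.bounded_linear_right] Phi_indicator_sums A)
      then show ?thesis by (simp add: L_def Ab)
    qed
  qed
  then show ?thesis using nn by (auto simp: L_def complex_nonneg_Reals_iff)
qed

text \<open>The integral is restricted to the interval because the values of \<open>f\<close>
  outside it leave \<open>\<Phi> f\<close> unchanged and need not be bounded.\<close>

lemma spectral_measure_integral:
  assumes sets: "sets \<mu> = sets borel"
    and em: "\<And>B. B \<in> sets borel \<Longrightarrow> emeasure \<mu> B = ennreal (Re (cinner (blinfun_apply (\<Phi> (indicator B)) x) x)) \<and>
      0 \<le> Re (cinner (blinfun_apply (\<Phi> (indicator B)) x) x) \<and>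
      Im (cinner (blinfun_apply (\<Phi> (indicator B)) x) x) = 0"
    and f: "f \<in> BB"
  shows "cinner (blinfun_apply (\<Phi> f) x) x = (LINT t:{- norm D0..norm D0}|\<mu>. f t)"
proof -
  let ?K = "{- norm D0..norm D0}"
  have sp: "space \<mu> = UNIV" using sets_eq_imp_space_eq[OF sets] by simp
  have meas: "g \<in> borel_measurable borel \<Longrightarrow> g \<in> borel_measurable \<mu>" for g :: "real \<Rightarrow> 'b::topological_space"
    by (subst measurable_cong_sets[OF sets refl])
  interpret finite_measure \<mu>
    by standard (use em[of UNIV] in \<open>simp add: sp\<close>)
  have K: "?K \<in> sets \<mu>" by (simp add: sets)
  have int: "set_integrable \<mu> ?K g" if g: "g \<in> BB" for g
  proof -
    obtain C where "\<And>t. t \<in> ?K \<Longrightarrow> cmod (g t) \<le> C" using bdd_borelE[OF g] by blast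
    then show ?thesis unfolding set_integrable_def
      using meas[OF bdd_borel_measurable[OF g]] K
      by (intro integrableI_bounded_set_indicator[of _ _ _ C]) (auto simp: less_top[symmetric])
  qed
  show ?thesis using f
  proof (induction rule: bdd_borel_induct_indicator)
    case (indicator A)
    have AK: "A \<inter> ?K \<in> sets borel" using indicator by auto
    have "\<Phi> (indicator A) = \<Phi> (indicator (A \<inter> ?K))"
      by (rule Phi_cong) (use indicator AK in \<open>auto intro: bdd_borel_indicator simp: indicator_def\<close>)
    moreover have "cinner (blinfun_apply (\<Phi> (indicator (A \<inter> ?K))) x) x = complex_of_real (measure \<mu> (A \<inter> ?K))"
      using em[OF AK] by (simp add: measure_def complex_eq_iff)
    moreover have "(LINT t:?K|\<mu>. indicator A t :: complex) = complex_of_real (measure \<mu> (A \<inter> ?K))"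
    proof -
      have "(LINT t:?K|\<mu>. indicator A t :: complex) = (LINT t|\<mu>. complex_of_real (indicator (A \<inter> ?K) t))"
        unfolding set_lebesgue_integral_def by (intro Bochner_Integration.integral_cong) (auto simp: indicator_def)
      then show ?thesis using AK by (simp add: sets sp)
    qed
    ultimately show ?case by simp
  next
    case (add f g)
    then show ?case by (simp add: Phi_add blinfun.add_left cinner_simps set_integral_add int)
  next
    case (cmult c f)
    then show ?case by (simp add: Phi_cmult cinner_simps)
  next
    case (cong f g)
    have "(LINT t:?K|\<mu>. f t) = (LINT t:?K|\<mu>. g t)"
      using cong K by (intro set_lebesgue_integral_cong) auto
    then show ?case using cong Phi_cong[of f g] by simp
  next
    case (increasing u f C)
    have "(\<lambda>n. cinner (blinfun_apply (\<Phi> (\<lambda>t. complex_of_real (u n t))) x) x)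
        \<longlonglongrightarrow> cinner (blinfun_apply (\<Phi> (\<lambda>t. complex_of_real (f t))) x) x"
      by (intro tendsto_cinner_left incr_Phi_tendsto[of u f, OF increasing(1,2,3,5,6,7)])
    moreover have "(\<lambda>n. LINT t:?K|\<mu>. complex_of_real (u n t)) \<longlonglongrightarrow> (LINT t:?K|\<mu>. complex_of_real (f t))"
      unfolding set_lebesgue_integral_def
    proof (rule integral_dominated_convergence[where w = "\<lambda>t. C"])
      show "AE t in \<mu>. norm (indicator ?K t *\<^sub>R complex_of_real (u n t)) \<le> C" for n
      proof (rule AE_I2)
        fix t
        show "norm (indicator ?K t *\<^sub>R complex_of_real (u n t)) \<le> C"
          using increasing(3)[of n t] increasing(5)[of n t] increasing(6)[of t]
          by (auto simp: indicator_def)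
      qed
      show "AE t in \<mu>. (\<lambda>n. indicator ?K t *\<^sub>R complex_of_real (u n t)) \<longlonglongrightarrow> indicator ?K t *\<^sub>R complex_of_real (f t)"
        using increasing(7) by (auto intro!: tendsto_scaleR tendsto_of_real)
      show "(\<lambda>t. indicator ?K t *\<^sub>R complex_of_real (f t)) \<in> borel_measurable \<mu>"
        using increasing(2) by (intro meas) measurable
      show "(\<lambda>t. indicator ?K t *\<^sub>R complex_of_real (u n t)) \<in> borel_measurable \<mu>" for n
        using increasing(1) by (intro meas) measurable
    qed simp
    ultimately show ?case using increasing(8) by (simp add: LIMSEQ_unique)
  qed
qed

text \<open>Radon-Nikodym for the measures \<open>\<langle>C \<Phi>(1\<^sub>B) x, x\<rangle> \<le> \<parallel>C\<parallel> \<langle>\<Phi>(1\<^sub>B) x, x\<rangle>\<close>.\<close>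
lemma ex_density_at:
  assumes C: "C \<in> N2" and pos: "positive_op C"
  shows "\<exists>g\<in>BB. (\<forall>t. cmod (g t) \<le> norm C) \<and> blinfun_apply C x = blinfun_apply (\<Phi> g) x"
proof -
  have Ccl: "C \<in> clinear_ops" using C by (rule N2_clinear)
  have id: "id_blinfun \<in> N2" "positive_op (id_blinfun :: 'h op)"
    using N2_scalar[of 1] by (auto simp: scalar_one positive_op_def cinner_self simp del: of_real_power)
  obtain \<mu> where \<mu>: "sets \<mu> = sets borel" "\<And>B. B \<in> sets borel \<Longrightarrow>
      emeasure \<mu> B = ennreal (Re (cinner (blinfun_apply (\<Phi> (indicator B)) x) x)) \<and>
      0 \<le> Re (cinner (blinfun_apply (\<Phi> (indicator B)) x) x) \<and>
      Im (cinner (blinfun_apply (\<Phi> (indicator B)) x) x) = 0"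
    using ex_spectral_measure[OF id, of x] by auto
  obtain \<nu> where \<nu>: "sets \<nu> = sets borel" "\<And>B. B \<in> sets borel \<Longrightarrow>
      emeasure \<nu> B = ennreal (Re (cinner (blinfun_apply (C \<odot> \<Phi> (indicator B)) x) x)) \<and>
      0 \<le> Re (cinner (blinfun_apply (C \<odot> \<Phi> (indicator B)) x) x) \<and>
      Im (cinner (blinfun_apply (C \<odot> \<Phi> (indicator B)) x) x) = 0"
    using ex_spectral_measure[OF C pos, of x] by blast
  have sp: "space \<mu> = UNIV" "space \<nu> = UNIV"
    using sets_eq_imp_space_eq[OF \<mu>(1)] sets_eq_imp_space_eq[OF \<nu>(1)] by simp_all
  interpret \<mu>: finite_measure \<mu> by standard (use \<mu>(2)[of UNIV] in \<open>simp add: sp\<close>)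
  interpret \<nu>: finite_measure \<nu> by standard (use \<nu>(2)[of UNIV] in \<open>simp add: sp\<close>)
  have meas: "g \<in> borel_measurable borel \<longleftrightarrow> g \<in> borel_measurable \<mu>" for g :: "real \<Rightarrow> 'b::topological_space"
    by (subst measurable_cong_sets[OF \<mu>(1) refl]) simp
  \<comment> \<open>This domination is used twice: for absolute continuity and for the bound on the
    density.\<close>
  have le: "emeasure \<nu> B \<le> ennreal (norm C) * emeasure \<mu> B" if B: "B \<in> sets borel" for B
  proof -
    let ?P = "\<Phi> (indicator B)"
    let ?y = "blinfun_apply ?P x"
    have "cinner (blinfun_apply (C \<odot> ?P) x) x = cinner (blinfun_apply C ?y) ?y"
      by (rule cinner_indicator[OF C B])
    moreover have "cinner ?y x = cinner ?y ?y"
      using cinner_indicator[OF id(1) B, of x] by simp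
    moreover have "Re (cinner (blinfun_apply C ?y) ?y) \<le> norm C * (norm ?y)\<^sup>2"
    proof -
      have "Re (cinner (blinfun_apply C ?y) ?y) \<le> norm (blinfun_apply C ?y) * norm ?y"
        using complex_Re_le_cmod cinner_Cauchy_Schwarz order_trans by blast
      also have "\<dots> \<le> norm C * norm ?y * norm ?y" by (intro mult_right_mono norm_blinfun) simp
      finally show ?thesis by (simp add: power2_eq_square)
    qed
    moreover have "Re (cinner ?y ?y) = (norm ?y)\<^sup>2" by (simp only: cinner_self Re_complex_of_real)
    ultimately have "Re (cinner (blinfun_apply (C \<odot> ?P) x) x) \<le> norm C * Re (cinner ?y x)" by metis
    then have "ennreal (Re (cinner (blinfun_apply (C \<odot> ?P) x) x)) \<le> ennreal (norm C * Re (cinner ?y x))"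
      by (rule ennreal_leI)
    then show ?thesis using \<mu>(2)[OF B] \<nu>(2)[OF B] by (simp add: ennreal_mult)
  qed
  have "absolutely_continuous \<mu> \<nu>"
  proof (unfold absolutely_continuous_def, rule subsetI)
    fix A assume "A \<in> null_sets \<mu>"
    then have "A \<in> sets borel" "emeasure \<mu> A = 0" using \<mu>(1) by auto
    then have "emeasure \<nu> A = 0" using le[of A] by simp
    then show "A \<in> null_sets \<nu>" using \<open>A \<in> sets borel\<close> \<nu>(1) by auto
  qed
  then obtain h where h: "h \<in> borel_measurable \<mu>" "density \<mu> h = \<nu>"
    using \<mu>.Radon_Nikodym[of \<nu>] \<mu>(1) \<nu>(1) by auto
  \<comment> \<open>On the set \<open>A\<close> where the bound fails, domination leaves no room for
    the excess of \<open>h\<close> over \<open>norm C\<close>. The integral of the constant over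
    \<open>A\<close> is finite, so the subtraction of extended reals is legitimate.\<close>
  have hc: "AE t in \<mu>. h t \<le> ennreal (norm C)"
  proof -
    define A where "A = {t. ennreal (norm C) < h t}"
    have A: "A \<in> sets \<mu>" using h(1) borel_measurable_less[of "\<lambda>_. ennreal (norm C)" \<mu> h] by (simp add: A_def sp)
    note [measurable] = h(1) A
    have "(\<integral>\<^sup>+t. h t * indicator A t \<partial>\<mu>) = emeasure \<nu> A"
      using emeasure_density[OF h(1) A] h(2) by simp
    also have "\<dots> \<le> (\<integral>\<^sup>+t. ennreal (norm C) * indicator A t \<partial>\<mu>)"
      using le[of A] A \<mu>(1) by (simp add: nn_integral_cmult_indicator)
    finally have i: "(\<integral>\<^sup>+t. h t * indicator A t \<partial>\<mu>) \<le> (\<integral>\<^sup>+t. ennreal (norm C) * indicator A t \<partial>\<mu>)" .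
    have fin: "(\<integral>\<^sup>+t. ennreal (norm C) * indicator A t \<partial>\<mu>) \<noteq> \<infinity>"
      using A \<mu>.emeasure_finite[of A] by (simp add: nn_integral_cmult_indicator ennreal_mult_eq_top_iff)
    have "(\<integral>\<^sup>+t. h t * indicator A t - ennreal (norm C) * indicator A t \<partial>\<mu>)
        = (\<integral>\<^sup>+t. h t * indicator A t \<partial>\<mu>) - (\<integral>\<^sup>+t. ennreal (norm C) * indicator A t \<partial>\<mu>)"
    proof (rule nn_integral_diff)
      show "AE t in \<mu>. ennreal (norm C) * indicator A t \<le> h t * indicator A t"
        by (rule AE_I2) (auto simp: A_def indicator_def)
    qed (use fin in simp_all)
    also have "\<dots> = 0" using fin i by (intro diff_eq_0_ennreal) (auto simp: less_top intro: le_less_trans)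
    finally have "AE t in \<mu>. h t * indicator A t - ennreal (norm C) * indicator A t = 0"
      by (subst (asm) nn_integral_0_iff_AE) simp_all
    then show ?thesis
    proof (eventually_elim)
      case (elim t)
      show ?case
      proof (rule ccontr)
        assume "\<not> h t \<le> ennreal (norm C)"
        then have "t \<in> A" "ennreal (norm C) < h t" by (auto simp: A_def)
        then show False using elim diff_gt_0_iff_gt_ennreal[of "h t" "ennreal (norm C)"] by simp
      qed
    qed
  qed
  \<comment> \<open>Truncation alters \<open>h\<close> on a null set only and yields a real function
    bounded everywhere, as membership in \<open>BB\<close> demands.\<close>
  define g where "g t = enn2real (min (h t) (ennreal (norm C)))" for t
  have g0: "0 \<le> g t" "g t \<le> norm C" for t
    by (auto simp: g_def intro: enn2real_leI)
  have gm: "g \<in> borel_measurable borel"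
    unfolding meas g_def using h(1) by measurable
  have gh: "AE t in \<mu>. h t = ennreal (g t)"
    using hc
  proof eventually_elim
    case (elim t)
    then show ?case by (auto simp: g_def min_def le_ennreal_iff intro!: ennreal_enn2real[symmetric] elim: order_le_less_trans)
  qed
  let ?g = "\<lambda>t. complex_of_real (g t)"
  have gB: "?g \<in> BB" using gm g0 by (intro bdd_borel_of_real[of _ _ "norm C"]) auto
  have key: "cinner (blinfun_apply (C \<odot> \<Phi> (indicator B)) x) x = cinner (blinfun_apply (\<Phi> (\<lambda>t. indicator B t * ?g t)) x) x"
    if B: "B \<in> sets borel" for B
  proof -
    let ?K = "{- norm D0..norm D0}"
    have BK: "B \<inter> ?K \<in> sets borel" using B by auto
    have "\<Phi> (indicator B) = \<Phi> (indicator (B \<inter> ?K))"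
      by (rule Phi_cong) (use B BK in \<open>auto intro: bdd_borel_indicator simp: indicator_def\<close>)
    then have 1: "cinner (blinfun_apply (C \<odot> \<Phi> (indicator B)) x) x = complex_of_real (measure \<nu> (B \<inter> ?K))"
      using \<nu>(2)[OF BK] by (simp add: measure_def complex_eq_iff)
    have "emeasure \<nu> (B \<inter> ?K) = (\<integral>\<^sup>+t. h t * indicator (B \<inter> ?K) t \<partial>\<mu>)"
      using emeasure_density[OF h(1), of "B \<inter> ?K"] h(2) BK \<mu>(1) by simp
    also have "\<dots> = (\<integral>\<^sup>+t. ennreal (g t * indicator (B \<inter> ?K) t) \<partial>\<mu>)"
      using gh by (intro nn_integral_cong_AE) (auto simp: indicator_def elim!: eventually_mono)
    finally have 2: "emeasure \<nu> (B \<inter> ?K) = (\<integral>\<^sup>+t. ennreal (g t * indicator (B \<inter> ?K) t) \<partial>\<mu>)" .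
    have "measure \<nu> (B \<inter> ?K) = (LINT t|\<mu>. g t * indicator (B \<inter> ?K) t)"
    proof (subst integral_eq_nn_integral)
      show "(\<lambda>t. g t * indicator (B \<inter> ?K) t) \<in> borel_measurable \<mu>"
        by (intro meas[THEN iffD1] borel_measurable_times borel_measurable_indicator BK gm)
    qed (use g0 2 in \<open>auto simp: measure_def\<close>)
    also have "complex_of_real \<dots> = (LINT t:?K|\<mu>. indicator B t * ?g t)"
      unfolding set_lebesgue_integral_def integral_complex_of_real[symmetric]
      by (intro Bochner_Integration.integral_cong) (auto simp: indicator_def)
    also have "\<dots> = cinner (blinfun_apply (\<Phi> (\<lambda>t. indicator B t * ?g t)) x) x"
      by (rule spectral_measure_integral[symmetric, OF \<mu>])
        (auto intro!: bdd_borel_mult bdd_borel_indicator B gB)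
    finally show ?thesis using 1 by simp
  qed
  \<comment> \<open>The difference \<open>z\<close> vanishes: it is orthogonal to every
    \<open>\<Phi> f x\<close>, by \<open>key\<close> on indicators and induction, and it lies in
    their closed span, because the projection onto that span commutes with \<open>D0\<close> and
    therefore with \<open>C\<close>.\<close>
  define z where "z = blinfun_apply C x - blinfun_apply (\<Phi> ?g) x"
  have orth: "cinner (blinfun_apply (\<Phi> f) z) x = 0" if f: "f \<in> BB" for f
    using f
  proof (induction rule: bdd_borel_induct_indicator)
    case (indicator A)
    have bA: "indicator A \<in> BB" using indicator by (rule bdd_borel_indicator)
    have "C \<odot> \<Phi> (indicator A) = \<Phi> (indicator A) \<odot> C"
      using N1_commute[OF C] Phi_N2[OF bA] N2_subset_N1 by blast
    then have "blinfun_apply (\<Phi> (indicator A)) (blinfun_apply C x) = blinfun_apply (C \<odot> \<Phi> (indicator A)) x"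
      by (metis blinfun_apply_blinfun_compose)
    moreover have "blinfun_apply (\<Phi> (indicator A)) (blinfun_apply (\<Phi> ?g) x)
        = blinfun_apply (\<Phi> (\<lambda>t. indicator A t * ?g t)) x"
      using Phi_mult[OF bA gB] by simp
    ultimately show ?case using key[OF indicator] by (simp add: z_def blinfun.diff_right cinner_simps)
  next
    case (add f g)
    then show ?case by (simp add: Phi_add blinfun.add_left cinner_simps)
  next
    case (cmult c f)
    then show ?case by (simp add: Phi_cmult cinner_simps)
  next
    case (cong f g)
    then show ?case using Phi_cong[of f g] by simp
  next
    case (increasing u f C)
    have "(\<lambda>n. cinner (blinfun_apply (\<Phi> (\<lambda>t. complex_of_real (u n t))) z) x)
        \<longlonglongrightarrow> cinner (blinfun_apply (\<Phi> (\<lambda>t. complex_of_real (f t))) z) x"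
      by (intro tendsto_cinner_left incr_Phi_tendsto[of u f, OF increasing(1,2,3,5,6,7)])
    then show ?case using increasing(8) by (simp add: LIMSEQ_const_iff)
  qed
  let ?S = "{blinfun_apply (\<Phi> f) x | f. f \<in> BB}"
  have W: "closed_csubspace (closure ?S)"
  proof (rule closed_csubspace_closure)
    show "0 \<in> ?S"
      using Phi_const[of 0] by (auto intro!: exI[of _ "\<lambda>_. 0"] bdd_borel_const simp: scalar_zero)
    show "u + v \<in> ?S" if uv: "u \<in> ?S" "v \<in> ?S" for u v
    proof -
      obtain f f' where "u = blinfun_apply (\<Phi> f) x" "f \<in> BB" "v = blinfun_apply (\<Phi> f') x" "f' \<in> BB"
        using uv by blast
      then show ?thesis
        by (intro CollectI exI[of _ "\<lambda>t. f t + f' t"]) (simp add: Phi_add blinfun.add_left bdd_borel_add)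
    qed
    show "scaleC c u \<in> ?S" if u: "u \<in> ?S" for c u
    proof -
      obtain f where "u = blinfun_apply (\<Phi> f) x" "f \<in> BB" using u by blast
      then show ?thesis
        by (intro CollectI exI[of _ "\<lambda>t. c * f t"]) (simp add: Phi_cmult bdd_borel_cmult)
    qed
  qed
  obtain P where P: "P \<in> clinear_ops" "\<And>u. blinfun_apply P u \<in> closure ?S"
    "\<And>u. u \<in> closure ?S \<Longrightarrow> blinfun_apply P u = u"
    "\<And>u w. w \<in> closure ?S \<Longrightarrow> cinner (u - blinfun_apply P u) w = 0" "is_adjoint P P"
    using ex_projection[OF W] by blast
  have inv: "blinfun_apply D0 v \<in> closure ?S" if "v \<in> closure ?S" for v
  proof (rule closure_invariant[OF _ that])
    fix v assume "v \<in> ?S"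
    then obtain f where f: "v = blinfun_apply (\<Phi> f) x" "f \<in> BB" by blast
    then have "blinfun_apply D0 v = blinfun_apply (\<Phi> (\<lambda>t. complex_of_real t * f t)) x"
      by (simp add: Phi_mult bdd_borel_id Phi_id)
    then show "blinfun_apply D0 v \<in> ?S" using bdd_borel_mult[OF bdd_borel_id f(2)] by blast
  qed
  have "P \<odot> D0 = D0 \<odot> P"
    by (rule projection_commutes[of P "closure ?S"]) (use P D0_clinear inv adj_D0 in auto)
  then have "P \<in> N1" using P(1) by (simp add: commutant_def)
  then have CP: "C \<odot> P = P \<odot> C" by (rule N1_commute[OF C])
  have xS: "x \<in> closure ?S"
  proof (rule subsetD[OF closure_subset], intro CollectI exI conjI)
    show "x = blinfun_apply (\<Phi> (\<lambda>_. 1)) x" by (simp add: Phi_one)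
  qed (rule bdd_borel_const)
  have "blinfun_apply (C \<odot> P) x = blinfun_apply (P \<odot> C) x" by (simp only: CP)
  then have "blinfun_apply C x = blinfun_apply P (blinfun_apply C x)"
    by (simp add: P(3)[OF xS])
  then have "blinfun_apply C x \<in> closure ?S" using P(2)[of "blinfun_apply C x"] by simp
  moreover have "blinfun_apply (\<Phi> ?g) x \<in> closure ?S" using gB closure_subset[of ?S] by blast
  ultimately have zS: "z \<in> closure ?S" unfolding z_def by (rule closed_csubspace_diff[OF W])
  have orth': "cinner z w = 0" if w: "w \<in> ?S" for w
  proof -
    obtain f where f: "w = blinfun_apply (\<Phi> f) x" "f \<in> BB" using w by blast
    have "cinner z w = cinner (blinfun_apply (adj (\<Phi> f)) z) x"
      using f by (simp add: cinner_adj_left Phi_clinear)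
    then show ?thesis using orth[OF bdd_borel_cnj[OF f(2)]] f(2) by (simp add: Phi_adj)
  qed
  obtain w where w: "\<forall>n. w n \<in> ?S" "w \<longlonglongrightarrow> z" using zS unfolding closure_sequential by blast
  have "(\<lambda>n. cinner z (w n)) \<longlonglongrightarrow> cinner z z" by (rule tendsto_cinner_right[OF w(2)])
  then have "z = 0" using orth' w(1) by (simp add: LIMSEQ_const_iff)
  then show ?thesis using gB g0 by (intro bexI[of _ ?g]) (auto simp: z_def)
qed

text \<open>Both \<open>C\<close> and \<open>\<Phi> g\<close> commute with \<open>N1\<close>, so
  agreement at \<open>x\<close> spreads to all \<open>B x\<close> with \<open>B\<close> in
  \<open>N1\<close> and then to the closure.\<close>

lemma ex_density_on_orbit:
  assumes C: "C \<in> N2" and pos: "positive_op C"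
  shows "\<exists>g\<in>BB. norm (\<Phi> g) \<le> norm C \<and> C \<odot> orbit_proj x = \<Phi> g \<odot> orbit_proj x"
proof -
  obtain g where g: "g \<in> BB" "\<And>t. cmod (g t) \<le> norm C" "blinfun_apply C x = blinfun_apply (\<Phi> g) x"
    using ex_density_at[OF C pos] by blast
  have eq: "blinfun_apply C v = blinfun_apply (\<Phi> g) v" if "v \<in> orbit x" for v
    using that unfolding orbit_def
  proof (rule closure_agree[rotated])
    fix v assume "v \<in> {blinfun_apply B x | B. B \<in> N1}"
    then obtain B where B: "v = blinfun_apply B x" "B \<in> N1" by blast
    show "blinfun_apply C v = blinfun_apply (\<Phi> g) v"
      using N1_commute[OF C B(2)] N1_commute[OF Phi_N2[OF g(1)] B(2)] g(3) B(1)
      by (metis blinfun_apply_blinfun_compose)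
  qed
  have "C \<odot> orbit_proj x = \<Phi> g \<odot> orbit_proj x"
    by (rule blinfun_eqI) (simp add: eq orbit_proj(2))
  moreover have "norm (\<Phi> g) \<le> norm C" by (rule Phi_norm_le) (use g in auto)
  ultimately show ?thesis using g(1) by blast
qed

end

section \<open>Approximation of the bicommutant in the 2-norm\<close>

context tracial_calculus
begin

lemma N2_M: "A \<in> N2 \<Longrightarrow> A \<in> M"
proof -
  have "commutant M \<subseteq> N1" using D0_M by (intro commutant_antimono) simp
  then have "N2 \<subseteq> commutant (commutant M)" by (rule commutant_antimono)
  then show "A \<in> N2 \<Longrightarrow> A \<in> M" using vN_bicommutant[OF vN] by blast
qed

lemma orbit_proj_selfadjoint: "selfadjoint (orbit_proj x)"
  using orbit_proj(5) by (simp add: selfadjoint_def)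

text \<open>Each vector lies in its own orbit, so any upper bound of the orbit projections dominates
  the identity. Normality for this directed family, which need not be a sequence, brings the traces
  up to 1.\<close>

lemma ex_large_orbit:
  assumes "\<epsilon> > 0" shows "\<exists>x. 1 - \<epsilon> < Re (\<tau> (orbit_proj x))"
proof -
  have "Re (\<tau> id_blinfun) = (SUP B\<in>range orbit_proj. Re (\<tau> B))"
  proof (rule tau_SUP)
    show "\<exists>D\<in>range orbit_proj. op_le B D \<and> op_le C D"
      if "B \<in> range orbit_proj" "C \<in> range orbit_proj" for B C
      using that orbit_directed orbit_proj_mono by (metis (no_types, lifting) rangeE rangeI)
    show "op_le B id_blinfun" if Br: "B \<in> range orbit_proj" for B
    proof -
      obtain x where B: "B = orbit_proj x" using Br by blast
      have "(norm (blinfun_apply (orbit_proj x) u))\<^sup>2 \<le> (norm u)\<^sup>2" for u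
        by (intro power_mono orbit_proj_contract) simp
      then show ?thesis
        unfolding op_le_def positive_op_def blinfun.diff_left cinner_diff_left B orbit_proj_quadratic
        by (simp add: cinner_self of_real_diff[symmetric] del: of_real_diff of_real_power)
    qed
    show "op_le id_blinfun C" if C: "C \<in> M" "selfadjoint C" "\<And>B. B \<in> range orbit_proj \<Longrightarrow> op_le B C" for C
    proof -
      have "cinner (blinfun_apply C x) x - cinner (blinfun_apply (orbit_proj x) x) x \<in> \<real>\<^sub>\<ge>\<^sub>0" for x
        using C(3)[of "orbit_proj x"] unfolding op_le_iff by blast
      then show ?thesis unfolding op_le_iff by (simp add: orbit_proj(3)[OF orbit_self])
    qed
    show "selfadjoint (id_blinfun :: 'h op)" by (simp add: selfadjoint_def is_adjoint_def)
  qed (auto intro: N2_M orbit_proj_N2 orbit_proj_selfadjoint M_id)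
  then have "1 - \<epsilon> < (SUP B\<in>range orbit_proj. Re (\<tau> B))" using assms by (simp add: tau_id)
  moreover have "bdd_above ((\<lambda>B. Re (\<tau> B)) ` range orbit_proj)"
  proof (rule bdd_aboveI2)
    fix B assume "B \<in> range orbit_proj"
    then obtain x where B: "B = orbit_proj x" by blast
    have "norm B \<le> 1" unfolding B by (rule norm_blinfun_bound) (auto simp: orbit_proj_contract)
    then show "Re (\<tau> B) \<le> 1"
      using tau_le_norm[OF N2_M[OF orbit_proj_N2], of x] complex_Re_le_cmod[of "\<tau> B"] B by simp
  qed
  ultimately show ?thesis by (subst (asm) less_cSUP_iff) auto
qed

definition approximable :: "'h op \<Rightarrow> bool" where
  "approximable A \<longleftrightarrow> (\<forall>\<epsilon>>0. \<exists>g\<in>BB. tnorm (A - \<Phi> g) < \<epsilon>)"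

text \<open>The error \<open>C - \<Phi> g\<close> vanishes on the orbit, so it factors through the
  complementary projection, whose 2-norm is small, while its operator norm is at most
  \<open>2 * norm C\<close> whatever the orbit.\<close>

lemma approximable_positive:
  assumes C: "C \<in> N2" "positive_op C" shows "approximable C"
  unfolding approximable_def
proof (intro allI impI)
  fix \<epsilon> :: real assume e: "\<epsilon> > 0"
  \<comment> \<open>Squared because the squared 2-norm of a projection is its trace; the summand 1
    keeps the denominator positive when \<open>C = 0\<close>.\<close>
  define d where "d = (\<epsilon> / (2 * norm C + 1))\<^sup>2"
  have n0: "0 < 2 * norm C + 1" using norm_ge_zero[of C] by linarith
  then have "d > 0" using e by (simp add: d_def)
  then obtain x where x: "1 - d < Re (\<tau> (orbit_proj x))" using ex_large_orbit by blast
  let ?P = "orbit_proj x"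
  let ?Q = "id_blinfun - ?P"
  have PM: "?P \<in> M" by (intro N2_M orbit_proj_N2)
  have QM: "?Q \<in> M" by (intro M_diff M_id PM)
  obtain g where g: "g \<in> BB" "norm (\<Phi> g) \<le> norm C" "C \<odot> ?P = \<Phi> g \<odot> ?P"
    using ex_density_on_orbit[OF C] by blast
  have M: "C \<in> M" "\<Phi> g \<in> M" using C(1) g(1) N2_M Phi_M by auto
  have "adj ?Q \<odot> ?Q = ?Q"
    using adj_selfadjoint[OF orbit_proj_selfadjoint[of x]] orbit_proj(1)
    by (simp add: adj_diff clinear_id adj_id op_diff_left op_diff_right orbit_proj_idem)
  then have "(tnorm ?Q)\<^sup>2 = Re (\<tau> ?Q)"
    using tau_adj_mult_self[OF QM] by (metis Re_complex_of_real)
  also have "\<dots> < d" using x PM by (simp add: tau_diff M_id tau_id)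
  finally have "(tnorm ?Q)\<^sup>2 < (\<epsilon> / (2 * norm C + 1))\<^sup>2" by (simp add: d_def)
  then have tQ: "tnorm ?Q < \<epsilon> / (2 * norm C + 1)"
    by (rule power_less_imp_less_base) (use e n0 in simp)
  have "C - \<Phi> g = (C - \<Phi> g) \<odot> ?Q" using g(3) by (simp add: op_diff_left op_diff_right)
  then have "tnorm (C - \<Phi> g) \<le> norm (C - \<Phi> g) * tnorm ?Q"
    using tnorm_mult_left[OF QM M_diff[OF M]] by simp
  also have "\<dots> \<le> (2 * norm C + 1) * tnorm ?Q"
    using norm_triangle_ineq4[of C "\<Phi> g"] g(2) by (intro mult_right_mono tnorm_nonneg QM) linarith
  also have "\<dots> < \<epsilon>"
    using tQ n0 by (simp add: field_simps)
  finally show "\<exists>g\<in>BB. tnorm (C - \<Phi> g) < \<epsilon>" using g(1) by blast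
qed

lemma approximable_add:
  assumes A: "A \<in> M" "approximable A" and B: "B \<in> M" "approximable B"
  shows "approximable (A + B)"
  unfolding approximable_def
proof (intro allI impI)
  fix \<epsilon> :: real assume "\<epsilon> > 0"
  then obtain f g where f: "f \<in> BB" "tnorm (A - \<Phi> f) < \<epsilon> / 2" and g: "g \<in> BB" "tnorm (B - \<Phi> g) < \<epsilon> / 2"
    using A B unfolding approximable_def by (meson half_gt_zero)
  have eq: "A + B - \<Phi> (\<lambda>t. f t + g t) = (A - \<Phi> f) + (B - \<Phi> g)" using f g by (simp add: Phi_add)
  have "tnorm (A + B - \<Phi> (\<lambda>t. f t + g t)) \<le> tnorm (A - \<Phi> f) + tnorm (B - \<Phi> g)"
    unfolding eq using A B f g by (intro tnorm_triangle M_diff Phi_M)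
  then show "\<exists>g\<in>BB. tnorm (A + B - \<Phi> g) < \<epsilon>"
    using f g by (intro bexI[of _ "\<lambda>t. f t + g t"]) (auto intro: bdd_borel_add)
qed

lemma approximable_scalar_mult:
  assumes A: "A \<in> M" "approximable A" shows "approximable (scalar_op c \<odot> A)"
  unfolding approximable_def
proof (intro allI impI)
  fix \<epsilon> :: real assume e: "\<epsilon> > 0"
  have n: "norm (scalar_op c :: 'h op) \<le> cmod c" by (rule norm_blinfun_bound) (auto simp: norm_scaleC)
  have "\<epsilon> / (cmod c + 1) > 0" using e by (simp add: add_nonneg_pos)
  then obtain f where f: "f \<in> BB" "tnorm (A - \<Phi> f) < \<epsilon> / (cmod c + 1)"
    using A unfolding approximable_def by blast
  have "scalar_op c \<odot> A - \<Phi> (\<lambda>t. c * f t) = scalar_op c \<odot> (A - \<Phi> f)"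
    using f by (simp add: Phi_cmult op_diff_right)
  then have "tnorm (scalar_op c \<odot> A - \<Phi> (\<lambda>t. c * f t)) \<le> norm (scalar_op c :: 'h op) * tnorm (A - \<Phi> f)"
    using tnorm_mult_left[of "A - \<Phi> f" "scalar_op c"] A f by (simp add: M_diff Phi_M M_scalar)
  also have "\<dots> \<le> (cmod c + 1) * tnorm (A - \<Phi> f)"
    using n A f by (intro mult_right_mono tnorm_nonneg M_diff Phi_M) auto
  also have "\<dots> < \<epsilon>"
  proof -
    have "0 < cmod c + 1" by (simp add: add_nonneg_pos)
    then show ?thesis using f(2) by (simp add: field_simps)
  qed
  finally show "\<exists>g\<in>BB. tnorm (scalar_op c \<odot> A - \<Phi> g) < \<epsilon>"
    using f by (intro bexI[of _ "\<lambda>t. c * f t"]) (auto intro: bdd_borel_cmult)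
qed

lemma approximable_Phi: "f \<in> BB \<Longrightarrow> approximable (\<Phi> f)"
  unfolding approximable_def by (intro allI impI bexI[of _ f]) (simp_all add: tnorm_def adj_zero tau_zero)

text \<open>Positivity is reached by adding the scalar \<open>norm H\<close> to a selfadjoint
  \<open>H\<close>; a general \<open>C\<close> is a combination of \<open>C + adj C\<close> and
  \<open>\<i> C - \<i> adj C\<close>.\<close>

lemma approximable_N2:
  assumes C: "C \<in> N2" shows "approximable C"
proof -
  have sa: "approximable H" if H: "H \<in> N2" "adj H = H" for H
  proof -
    let ?c = "complex_of_real (norm H)"
    have "positive_op (H + scalar_op ?c)"
      unfolding positive_op_def
    proof
      fix x
      have "selfadjoint H" using H N2_clinear by (intro selfadjointI) auto
      have "Re (cinner (blinfun_apply H x) x) \<ge> - (norm H * norm x * norm x)"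
      proof -
        have "cmod (cinner (blinfun_apply H x) x) \<le> norm H * norm x * norm x"
          using cinner_Cauchy_Schwarz[of "blinfun_apply H x" x] norm_blinfun[of H x]
          by (meson mult_right_mono norm_ge_zero order_trans)
        then show ?thesis using abs_Re_le_cmod[of "cinner (blinfun_apply H x) x"] by linarith
      qed
      then have "0 \<le> Re (cinner (blinfun_apply H x) x) + norm H * (norm x)\<^sup>2"
        by (simp add: power2_eq_square)
      moreover have "cinner (blinfun_apply (H + scalar_op ?c) x) x
          = complex_of_real (Re (cinner (blinfun_apply H x) x) + norm H * (norm x)\<^sup>2)"
      proof -
        have "cinner (blinfun_apply (H + scalar_op ?c) x) x
            = cinner (blinfun_apply H x) x + complex_of_real (norm H * (norm x)\<^sup>2)"
          by (simp add: blinfun.add_left cinner_simps cinner_self)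
        also have "\<dots> = complex_of_real (Re (cinner (blinfun_apply H x) x)) + complex_of_real (norm H * (norm x)\<^sup>2)"
          by (subst selfadjoint_cinner_real[OF \<open>selfadjoint H\<close>]) (rule refl)
        finally show ?thesis by (simp only: of_real_add)
      qed
      ultimately show "cinner (blinfun_apply (H + scalar_op ?c) x) x \<in> \<real>\<^sub>\<ge>\<^sub>0"
        by (simp only: nonneg_Reals_of_real_iff)
    qed
    then have "approximable (H + scalar_op ?c)"
      by (intro approximable_positive commutant_add H N2_scalar)
    then have "approximable ((H + scalar_op ?c) + \<Phi> (\<lambda>_. - ?c))"
      by (intro approximable_add[OF _ _ _ approximable_Phi[OF bdd_borel_const]] M_add M_scalar
          N2_M[OF H(1)] Phi_M bdd_borel_const)
    moreover have "(H + scalar_op ?c) + \<Phi> (\<lambda>_. - ?c) = H"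
      by (simp add: Phi_const add.assoc scalar_add scalar_zero)
    ultimately show ?thesis by simp
  qed
  have Ccl: "C \<in> clinear_ops" using C by (rule N2_clinear)
  have C': "adj C \<in> N2" using C by (rule N2_adj)
  let ?A = "C + adj C" and ?B = "scalar_op \<i> \<odot> C + scalar_op (-\<i>) \<odot> adj C"
  have AM: "?A \<in> M" and BM: "?B \<in> M"
    using N2_M[OF C] N2_M[OF C'] by (simp_all add: M_intros)
  have ap: "approximable ?A"
    using Ccl by (intro sa commutant_add C C') (simp add: adj_add adj_adj adj_clinear add.commute)
  have bp: "approximable ?B"
    using Ccl by (intro sa commutant_add commutant_mult N2_scalar C C')
      (simp add: adj_add adj_mult adj_adj adj_scalar clinear_intros scalar_commute add.commute)
  have "approximable (scalar_op (1/2) \<odot> ?A + scalar_op (-\<i>/2) \<odot> ?B)"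
    by (rule approximable_add[OF M_mult[OF M_scalar AM] approximable_scalar_mult[OF AM ap]
          M_mult[OF M_scalar BM] approximable_scalar_mult[OF BM bp]])
  moreover have "scalar_op (1/2) \<odot> ?A + scalar_op (-\<i>/2) \<odot> ?B = C"
  proof (rule blinfun_eqI)
    fix x
    have "scaleC (1/2) y + scaleC (1/2) y = y" for y :: 'h
      by (simp add: scaleC_add_left[symmetric])
    moreover have "scaleC (- (1/2)) y + scaleC (1/2) y = 0" for y :: 'h
      by (simp add: scaleC_add_left[symmetric])
    ultimately show "blinfun_apply (scalar_op (1/2) \<odot> ?A + scalar_op (-\<i>/2) \<odot> ?B) x = blinfun_apply C x"
      by (simp add: blinfun.add_left scaleC_add_right scaleC_scaleC algebra_simps)
  qed
  ultimately show ?thesis by simp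
qed

text \<open>Testing \<open>C\<close> against functions of \<open>D0\<close> close to
  \<open>adj C\<close> gives \<open>\<tau> (C \<odot> adj C) = 0\<close>, and \<tau> is faithful.
  Borel functions thus separate the bicommutant without each of its elements being shown to be
  one.\<close>

lemma N2_eq_0:
  assumes C: "C \<in> N2" and 0: "\<And>f. f \<in> BB \<Longrightarrow> \<tau> (C \<odot> \<Phi> f) = 0"
  shows "C = 0"
proof -
  have CM: "C \<in> M" "adj C \<in> M" and Ccl: "C \<in> clinear_ops"
    using C N2_M N2_adj N2_clinear by auto
  have le: "cmod (\<tau> (C \<odot> adj C)) \<le> \<epsilon> * tnorm (adj C)" if "\<epsilon> > 0" for \<epsilon>
  proof -
    obtain g where g: "g \<in> BB" "tnorm (adj C - \<Phi> g) < \<epsilon>"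
      using approximable_N2[OF N2_adj[OF C]] \<open>\<epsilon> > 0\<close> unfolding approximable_def by blast
    have "\<tau> (C \<odot> adj C) = \<tau> (C \<odot> (adj C - \<Phi> g))"
      using 0[OF g(1)] CM g(1) by (simp add: op_diff_right tau_diff M_mult Phi_M)
    also have "cmod \<dots> \<le> tnorm (adj C - \<Phi> g) * tnorm (adj C)"
      using tau_Cauchy_Schwarz[of "adj C - \<Phi> g" "adj C"] CM g(1) Ccl by (simp add: adj_adj M_diff Phi_M)
    also have "\<dots> \<le> \<epsilon> * tnorm (adj C)"
      using g(2) CM by (intro mult_right_mono tnorm_nonneg) auto
    finally show ?thesis .
  qed
  have "\<tau> (C \<odot> adj C) = 0"
  proof (rule ccontr)
    assume "\<tau> (C \<odot> adj C) \<noteq> 0"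
    then obtain p where p: "p = cmod (\<tau> (C \<odot> adj C))" "p > 0" by simp
    obtain t where t: "t = tnorm (adj C)" "t \<ge> 0" using CM(2) tnorm_nonneg by blast
    have "p / (2 * (t + 1)) > 0" using p t by simp
    from le[OF this] have "p \<le> p / (2 * (t + 1)) * t" by (simp add: p t)
    also have "\<dots> < p" using p t by (simp add: field_simps add_pos_nonneg)
    finally show False by simp
  qed
  then have "adj C = 0" using tau_faithful[OF CM(2)] Ccl by (simp add: adj_adj)
  then show ?thesis using adj_adj[OF Ccl] adj_zero by metis
qed

end

section \<open>Chebyshev polynomials of a semicircular element\<close>

text \<open>Chebyshev polynomials of the second kind in the variable \<open>t / 2\<close>,
  orthogonal for the semicircle law on \<open>[-2,2]\<close>.\<close>

fun cheb :: "nat \<Rightarrow> real \<Rightarrow> real" where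
  "cheb 0 t = 1"
| "cheb (Suc 0) t = t"
| "cheb (Suc (Suc n)) t = t * cheb (Suc n) t - cheb n t"

lemma cheb_cos: "cheb n (2 * cos \<theta>) * sin \<theta> = sin (real (Suc n) * \<theta>)"
proof (induction n rule: cheb.induct[of "\<lambda>n _. _ n", simplified])
  case 2
  show ?case by (simp add: sin_double)
next
  case (3 n)
  have "cheb (Suc (Suc n)) (2 * cos \<theta>) * sin \<theta>
      = 2 * cos \<theta> * sin (real (Suc (Suc n)) * \<theta>) - sin (real (Suc n) * \<theta>)"
    using 3 by (simp add: algebra_simps)
  also have "\<dots> = sin (real (Suc (Suc n)) * \<theta> + \<theta>)"
  proof -
    have "sin (real (Suc n) * \<theta>) = sin (real (Suc (Suc n)) * \<theta> - \<theta>)" by (simp add: algebra_simps)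
    then show ?thesis by (simp only: sin_diff sin_add) (simp add: algebra_simps)
  qed
  also have "\<dots> = sin (real (Suc (Suc (Suc n))) * \<theta>)" by (simp add: algebra_simps)
  finally show ?case .
qed simp

lemma continuous_on_cheb [continuous_intros]: "continuous_on S (cheb n)"
proof (induction n rule: cheb.induct[of "\<lambda>n _. _ n", simplified])
  case 1
  show ?case by (simp add: cheb.simps[abs_def])
next
  case 2
  show ?case by (simp add: cheb.simps[abs_def])
next
  case (3 n)
  have "cheb (Suc (Suc n)) = (\<lambda>t. t * cheb (Suc n) t - cheb n t)" by (rule ext) simp
  then show ?case using 3 by (auto intro!: continuous_intros)
qed

lemma cheb_measurable [measurable]: "cheb n \<in> borel_measurable borel"
  by (intro borel_measurable_continuous_onI continuous_intros)

text \<open>With \<open>t = 2 cos \<theta>\<close> the integrand is \<open>2 sin ((n+1)\<theta>) sin \<theta> = cos (n\<theta>) - cos ((n+2)\<theta>)\<close>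
  up to the factor \<open>d\<theta>/dt\<close>.\<close>
lemma cheb_has_integral:
  assumes n: "n \<ge> 1"
  shows "((\<lambda>t. cheb n t * sqrt (4 - t\<^sup>2)) has_integral 0) {-2..2}"
proof -
  \<comment> \<open>The antiderivative, with sign and factor 2 from
    \<open>dt = -2 sin \<theta> d\<theta>\<close>. At both endpoints \<theta> is 0 or \<pi>, so all
    sines vanish; the division by \<open>n\<close> is where \<open>n \<ge> 1\<close> enters.\<close>
  define G where "G t = - (sin (real n * arccos (t / 2)) / real n
      - sin (real (n + 2) * arccos (t / 2)) / real (n + 2)) * 2" for t
  have "((\<lambda>t. cheb n t * sqrt (4 - t\<^sup>2)) has_integral (G 2 - G (-2))) {-2..2}"
  proof (rule fundamental_theorem_of_calculus_interior)
    show "continuous_on {-2..2} G"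
      unfolding G_def by (intro continuous_intros) (use n in auto)
    fix t :: real assume t: "t \<in> {-2<..<2}"
    define \<theta> where "\<theta> = arccos (t / 2)"
    have t2: "-1 < t / 2" "t / 2 < 1" using t by auto
    have cos: "2 * cos \<theta> = t" using t2 by (simp add: \<theta>_def cos_arccos)
    have sin: "sin \<theta> = sqrt (1 - (t / 2)\<^sup>2)" using t2 by (simp add: \<theta>_def sin_arccos)
    have s4: "sqrt (4 - t\<^sup>2) = 2 * sin \<theta>"
    proof -
      have "4 - t\<^sup>2 = 2\<^sup>2 * (1 - (t / 2)\<^sup>2)" by (simp add: power_divide)
      then show ?thesis unfolding sin by (simp only: real_sqrt_mult real_sqrt_abs)
    qed
    have sp: "sin \<theta> > 0"
    proof -
      have "(t / 2)\<^sup>2 < 1" using t2 by (simp add: abs_square_less_1)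
      then show ?thesis unfolding sin by simp
    qed
    have "((\<lambda>t. arccos (t / 2)) has_real_derivative (inverse (- sqrt (1 - (t / 2)\<^sup>2)) * (1 / 2))) (at t)"
      by (rule DERIV_chain2[where g = "\<lambda>t. t / 2", OF DERIV_arccos[OF t2]])
        (auto intro!: derivative_eq_intros)
    then have D: "((\<lambda>t. arccos (t / 2)) has_real_derivative (- inverse (sin \<theta>) * (1 / 2))) (at t)"
      by (simp add: sin)
    have "(G has_real_derivative
        (- (cos (real n * \<theta>) * (real n * (- inverse (sin \<theta>) * (1 / 2))) / real n
         - cos (real (n + 2) * \<theta>) * (real (n + 2) * (- inverse (sin \<theta>) * (1 / 2))) / real (n + 2)) * 2)) (at t)"
    proof -
      have "((\<lambda>t. sin (m * arccos (t / 2))) has_real_derivative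
          cos (m * \<theta>) * (m * (- inverse (sin \<theta>) * (1 / 2)))) (at t)" for m
        using DERIV_chain2[where g = "\<lambda>t. m * arccos (t / 2)", OF DERIV_sin DERIV_cmult[OF D]]
        by (simp only: \<theta>_def)
      then show ?thesis unfolding G_def
        by (intro DERIV_cmult_right DERIV_minus DERIV_diff DERIV_cdivide)
    qed
    also have "- (cos (real n * \<theta>) * (real n * (- inverse (sin \<theta>) * (1 / 2))) / real n
         - cos (real (n + 2) * \<theta>) * (real (n + 2) * (- inverse (sin \<theta>) * (1 / 2))) / real (n + 2)) * 2
        = (cos (real n * \<theta>) - cos (real (n + 2) * \<theta>)) / sin \<theta>"
    proof -
      have e: "- (c * (k * (- inverse s * (1 / 2))) / k - c' * (m * (- inverse s * (1 / 2))) / m) * 2 = (c - c') / s"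
        if "k \<noteq> 0" "m \<noteq> 0" for c c' k m s :: real
      proof -
        obtain d where d: "d = - inverse s * (1 / 2)" by simp
        have "c * (k * d) / k = c * d" "c' * (m * d) / m = c' * d" using that by simp_all
        then have "- (c * (k * d) / k - c' * (m * d) / m) * 2 = (c - c') * (- 2 * d)" by algebra
        also have "- 2 * d = inverse s" by (simp add: d)
        finally show ?thesis by (simp only: d divide_inverse)
      qed
      show ?thesis by (rule e) (use n in auto)
    qed
    also have "\<dots> = cheb n t * sqrt (4 - t\<^sup>2)"
    proof -
      have "cos (real n * \<theta>) = cos (real (Suc n) * \<theta> - \<theta>)" "cos (real (n + 2) * \<theta>) = cos (real (Suc n) * \<theta> + \<theta>)"
        by (simp_all add: algebra_simps)
      then have "cos (real n * \<theta>) - cos (real (n + 2) * \<theta>) = 2 * sin (real (Suc n) * \<theta>) * sin \<theta>"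
        by (simp only: cos_diff cos_add)
      also have "\<dots> = 2 * (cheb n t * sin \<theta>) * sin \<theta>" using cheb_cos[of n \<theta>] by (simp add: cos)
      finally show ?thesis using sp by (simp add: s4)
    qed
    finally show "(G has_vector_derivative cheb n t * sqrt (4 - t\<^sup>2)) (at t)"
      by (simp add: has_real_derivative_iff_has_vector_derivative)
  qed simp
  moreover have "G 2 = 0" "G (-2) = 0" using sin_npi[of "n + 2"] by (simp_all add: G_def sin_npi)
  ultimately show ?thesis by simp
qed

lemma cheb_semicircle:
  assumes n: "n \<ge> 1" shows "(\<integral>t. cheb n t \<partial>standard_semicircle) = 0"
proof -
  let ?h = "\<lambda>t. cheb n t * sqrt (4 - t\<^sup>2)"
  have "(\<integral>t. cheb n t \<partial>standard_semicircle)
      = (\<integral>t. (1 / (2 * pi) * sqrt (4 - t\<^sup>2) * indicator {-2..2} t) *\<^sub>R cheb n t \<partial>lborel)"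
    unfolding standard_semicircle_def
  proof (rule integral_density)
    show "AE t in lborel. 0 \<le> 1 / (2 * pi) * sqrt (4 - t\<^sup>2) * indicat_real {- 2..2} t"
    proof (rule AE_I2)
      fix t :: real
      show "0 \<le> 1 / (2 * pi) * sqrt (4 - t\<^sup>2) * indicat_real {- 2..2} t"
      proof (cases "t \<in> {-2..2}")
        case True
        then have "t\<^sup>2 \<le> 2\<^sup>2" using abs_le_square_iff[of t 2] by auto
        then show ?thesis by simp
      qed simp
    qed
  qed measurable
  also have "\<dots> = (\<integral>t. 1 / (2 * pi) * (indicator {-2..2} t *\<^sub>R ?h t) \<partial>lborel)"
    by (intro Bochner_Integration.integral_cong) auto
  also have "\<dots> = 1 / (2 * pi) * (LINT t:{-2..2}|lborel. ?h t)"
    unfolding set_lebesgue_integral_def by (rule integral_mult_right_zero)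
  also have "(LINT t:{-2..2}|lborel. ?h t) = integral {-2..2} ?h"
  proof (rule set_borel_integral_eq_integral(2))
    have "continuous_on {-2..2} ?h" by (intro continuous_intros)
    then show "set_integrable lborel {-2..2} ?h"
      unfolding set_integrable_def by (intro borel_integrable_compact) auto
  qed
  also have "\<dots> = 0" using cheb_has_integral[OF n] by (rule integral_unique)
  finally show ?thesis by simp
qed

fun cheb_op :: "('h::complex_hilbert) op \<Rightarrow> nat \<Rightarrow> 'h op" where
  "cheb_op X 0 = id_blinfun"
| "cheb_op X (Suc 0) = X"
| "cheb_op X (Suc (Suc n)) = X \<odot> cheb_op X (Suc n) - cheb_op X n"

lemma cheb_op_mult: "X \<odot> cheb_op X (Suc n) = cheb_op X (Suc (Suc n)) + cheb_op X n"
  by simp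

declare cheb_op.simps(3) [simp del]

lemma cheb_op_alg: "cheb_op X n \<in> unital_algebra_gen {X}"
proof (induction X n rule: cheb_op.induct)
  case (1 X)
  show ?case using unital_algebra_gen.scalar[of 1] by (simp add: scalar_one)
next
  case (3 X n)
  have "X \<odot> cheb_op X (Suc n) + scalar_op (-1) \<odot> cheb_op X n \<in> unital_algebra_gen {X}"
    by (intro unital_algebra_gen.intros 3) simp
  then show ?case by (simp add: scalar_uminus_one cheb_op.simps(3))
qed (auto intro: unital_algebra_gen.gen)

lemma op_pow_alg: "op_pow A k \<in> unital_algebra_gen {A}"
proof (induction k)
  case 0
  show ?case using unital_algebra_gen.scalar[of 1] by (simp add: scalar_one)
next
  case (Suc k)
  then show ?case by (auto simp: op_pow_Suc intro: unital_algebra_gen.intros)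
qed

lemma op_pow_commute: "op_pow A k \<odot> A = A \<odot> op_pow A k"
  by (induction k) (simp_all add: op_pow_Suc op_assoc)

definition op_prod :: "('h::complex_hilbert) op list \<Rightarrow> 'h op" where
  "op_prod As = foldr (o\<^sub>L) As id_blinfun"

lemma op_prod_simps [simp]: "op_prod [] = id_blinfun" "op_prod (A # As) = A \<odot> op_prod As"
  by (simp_all add: op_prod_def)

lemma op_prod_append: "op_prod (As @ Bs) = op_prod As \<odot> op_prod Bs"
  by (induction As) (simp_all add: op_assoc)

locale dt_pair = tracial_calculus M \<tau> D0 \<Phi>
  for M :: "('h::complex_hilbert) op set" and \<tau> :: "'h op \<Rightarrow> complex"
    and D0 :: "'h op" and \<Phi> :: "(real \<Rightarrow> complex) \<Rightarrow> 'h op" +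
  fixes X :: "'h op"
  assumes X_M: "X \<in> M" and X_sa: "selfadjoint X" and X_dist: "has_distribution \<tau> X standard_semicircle"
    and free: "free_pair \<tau> D0 X"
begin

abbreviation "U \<equiv> cheb_op X"

lemma cheb_op_M: "U n \<in> M"
  by (induction n rule: cheb.induct[of "\<lambda>n _. _ n", simplified]) (auto intro: M_intros X_M simp: cheb_op.simps(3))

lemma semicircle_integrable:
  fixes f :: "real \<Rightarrow> real" assumes f: "continuous_on UNIV f"
  shows "integrable standard_semicircle f"
proof -
  obtain R where P: "prob_space standard_semicircle" and s: "sets standard_semicircle = sets borel"
    and R: "AE t in standard_semicircle. \<bar>t\<bar> \<le> R"
    using X_dist by (auto simp: has_distribution_def)
  interpret prob_space standard_semicircle by fact
  have "continuous_on {-R..R} f" by (rule continuous_on_subset[OF f]) simp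
  then have "bounded (f ` {-R..R})" by (intro compact_imp_bounded compact_continuous_image compact_Icc)
  then obtain B where "\<forall>y\<in>f ` {-R..R}. norm y \<le> B" unfolding bounded_iff by blast
  then have B: "\<And>t. t \<in> {-R..R} \<Longrightarrow> norm (f t) \<le> B" by simp
  show ?thesis
  proof (rule integrable_const_bound[of _ B])
    show "AE t in standard_semicircle. norm (f t) \<le> B"
      using R by eventually_elim (use B in \<open>auto simp: abs_le_iff\<close>)
    show "f \<in> borel_measurable standard_semicircle"
      using borel_measurable_continuous_onI[OF f] by (subst measurable_cong_sets[OF s refl])
  qed
qed

text \<open>The power of \<open>X\<close> is carried along because the recursion for
  \<open>U\<close> multiplies by \<open>X\<close>, so the induction on \<open>n\<close> has to raise
  \<open>k\<close>.\<close>

lemma tau_pow_cheb: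
  "\<tau> (op_pow X k \<odot> U n) = complex_of_real (\<integral>t. t ^ k * cheb n t \<partial>standard_semicircle)"
proof (induction n arbitrary: k rule: cheb.induct[of "\<lambda>n _. _ n", simplified])
  case 1
  show ?case using X_dist by (simp add: has_distribution_def)
next
  case 2
  have "op_pow X k \<odot> X = op_pow X (Suc k)" by (simp add: op_pow_Suc op_pow_commute)
  then show ?case using X_dist by (simp add: has_distribution_def mult.commute)
next
  case (3 n)
  have "op_pow X k \<odot> U (Suc (Suc n)) = op_pow X (Suc k) \<odot> U (Suc n) - op_pow X k \<odot> U n"
    using op_assoc[of "op_pow X k" X "U (Suc n)"]
    by (simp add: op_diff_right op_pow_Suc op_pow_commute cheb_op.simps(3))
  then have "\<tau> (op_pow X k \<odot> U (Suc (Suc n)))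
      = \<tau> (op_pow X (Suc k) \<odot> U (Suc n)) - \<tau> (op_pow X k \<odot> U n)"
    by (simp add: tau_diff M_mult M_op_pow X_M cheb_op_M)
  also have "\<dots> = complex_of_real ((\<integral>t. t ^ Suc k * cheb (Suc n) t \<partial>standard_semicircle)
      - (\<integral>t. t ^ k * cheb n t \<partial>standard_semicircle))"
    by (simp only: 3 of_real_diff)
  also have "(\<integral>t. t ^ Suc k * cheb (Suc n) t \<partial>standard_semicircle) - (\<integral>t. t ^ k * cheb n t \<partial>standard_semicircle)
      = (\<integral>t. t ^ Suc k * cheb (Suc n) t - t ^ k * cheb n t \<partial>standard_semicircle)"
    by (intro Bochner_Integration.integral_diff[symmetric] semicircle_integrable continuous_intros)
  also have "\<dots> = (\<integral>t. t ^ k * cheb (Suc (Suc n)) t \<partial>standard_semicircle)"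
    by (intro Bochner_Integration.integral_cong refl) (simp add: algebra_simps)
  finally show ?case .
qed

lemma tau_cheb: "n \<ge> 1 \<Longrightarrow> \<tau> (U n) = 0"
  using tau_pow_cheb[of 0 n] by (simp add: cheb_semicircle)

end

section \<open>The Schwinger-Dyson equation\<close>

text \<open>\<open>DL f\<close> stands for \<open>f(D\<^sub>0)\<close> and \<open>UL n\<close> for the Chebyshev polynomial \<open>U\<^sub>n(X)\<close>.\<close>
datatype letter = DL "real \<Rightarrow> complex" | UL nat

fun is_DL :: "letter \<Rightarrow> bool" where
  "is_DL (DL f) = True"
| "is_DL (UL n) = False"

section \<open>Reduced words and freeness\<close>

context dt_pair
begin

fun lop :: "letter \<Rightarrow> 'h op" where
  "lop (DL f) = \<Phi> f"
| "lop (UL n) = U n"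

fun centred :: "letter \<Rightarrow> bool" where
  "centred (DL f) \<longleftrightarrow> f \<in> BB \<and> \<tau> (\<Phi> f) = 0"
| "centred (UL n) \<longleftrightarrow> n \<ge> 1"

abbreviation "alternating \<equiv> successively (\<lambda>a b. is_DL a \<noteq> is_DL b)"

definition reduced :: "letter list \<Rightarrow> bool" where
  "reduced w \<longleftrightarrow> (\<forall>a\<in>set w. centred a) \<and> alternating w"

lemma lop_M: "centred a \<Longrightarrow> lop a \<in> M"
  by (cases a) (auto intro: Phi_M cheb_op_M)

lemma op_prod_M: "(\<And>A. A \<in> set As \<Longrightarrow> A \<in> M) \<Longrightarrow> op_prod As \<in> M"
  by (induction As) (auto intro: M_intros)

lemma alg_D0_M: "A \<in> unital_algebra_gen {D0} \<Longrightarrow> A \<in> M"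
  by (induction rule: unital_algebra_gen.induct) (auto intro: M_intros D0_M)

lemma alg_X_M: "A \<in> unital_algebra_gen {X} \<Longrightarrow> A \<in> M"
  by (induction rule: unital_algebra_gen.induct) (auto intro: M_intros X_M)

text \<open>This interpolates between freeness, where \<open>v\<close> is empty, and vanishing on
  reduced words, where \<open>u\<close> is empty. The letters of \<open>v\<close> are moved one by
  one into \<open>u\<close>, which admits polynomials only; a function of \<open>D0\<close> gets
  there through centred powers and \<open>tau_Phi_extend\<close>.\<close>

lemma free_mixed:
  assumes "\<forall>(i, A)\<in>set u. A \<in> unital_algebra_gen {if i then D0 else X} \<and> \<tau> A = 0"
    and "\<forall>a\<in>set v. centred a"
    and "successively (\<noteq>) (map fst u @ map is_DL v)" and "u \<noteq> [] \<or> v \<noteq> []"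
  shows "\<tau> (op_prod (map snd u) \<odot> op_prod (map lop v)) = 0"
  using assms
proof (induction v arbitrary: u)
  case Nil
  have "free_algebras \<tau> (\<lambda>i::bool. unital_algebra_gen {if i then D0 else X})"
    using free by (simp add: free_pair_def)
  moreover have "successively (\<lambda>a b. fst a \<noteq> fst b) u"
    using Nil(3) by (simp add: successively_map)
  ultimately show ?case using Nil by (simp add: free_algebras_def op_prod_def)
next
  case (Cons a v)
  have uM: "op_prod (map snd u) \<in> M"
    using Cons.prems(1) alg_D0_M alg_X_M by (intro op_prod_M) (auto split: if_splits)
  have vM: "op_prod (map lop v) \<in> M"
    using Cons.prems(2) lop_M by (intro op_prod_M) auto
  have step: "\<tau> (op_prod (map snd u) \<odot> (A \<odot> op_prod (map lop v))) = 0"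
    if "A \<in> unital_algebra_gen {if is_DL a then D0 else X}" "\<tau> A = 0" for A
  proof -
    have "\<tau> (op_prod (map snd (u @ [(is_DL a, A)])) \<odot> op_prod (map lop v)) = 0"
      using Cons.prems that by (intro Cons.IH) auto
    then show ?thesis by (simp add: op_prod_append op_assoc)
  qed
  show ?case
  proof (cases a)
    case (UL n)
    then show ?thesis using step[of "U n"] cheb_op_alg[of X n] Cons.prems(2) by (simp add: tau_cheb)
  next
    case (DL f)
    let ?B = "op_prod (map snd u)" and ?C = "op_prod (map lop v)"
    \<comment> \<open>Undoing the centring of the power leaves the factor
      \<open>\<tau> (?B \<odot> ?C)\<close>, which does not depend on \<open>k\<close>; for the
      centred \<open>f\<close> the extended identity then has right-hand side 0.\<close>
    have "\<tau> (?B \<odot> (op_pow D0 k \<odot> ?C)) = \<tau> (?B \<odot> ?C) * \<tau> (op_pow D0 k)" for k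
    proof -
      let ?t = "\<tau> (op_pow D0 k)"
      let ?A = "op_pow D0 k + scalar_op (- ?t)"
      have "?A \<in> unital_algebra_gen {D0}" by (intro unital_algebra_gen.intros op_pow_alg)
      moreover have "\<tau> ?A = 0" by (simp add: tau_add M_intros D0_M tau_scalar)
      ultimately have "\<tau> (?B \<odot> (?A \<odot> ?C)) = 0" using step[of ?A] DL by simp
      moreover have "?B \<odot> (?A \<odot> ?C) = ?B \<odot> (op_pow D0 k \<odot> ?C) + scalar_op (- ?t) \<odot> (?B \<odot> ?C)"
      proof -
        have "?B \<odot> (scalar_op (- ?t) \<odot> ?C) = scalar_op (- ?t) \<odot> (?B \<odot> ?C)"
          by (simp only: op_assoc[symmetric] scalar_commute[OF M_clinear[OF uM]])
        then show ?thesis by (simp add: op_add_left op_add_right)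
      qed
      ultimately show ?thesis using uM vM by (simp add: tau_add M_intros D0_M tau_scalar_mult)
    qed
    from tau_Phi_extend[OF _ uM vM this] show ?thesis using Cons.prems(2) DL by simp
  qed
qed

lemma reduced_tau: "reduced w \<Longrightarrow> w \<noteq> [] \<Longrightarrow> \<tau> (op_prod (map lop w)) = 0"
  using free_mixed[of "[]" w] by (simp add: reduced_def successively_map)

section \<open>The free difference quotient on words\<close>

lemma scalar_left_commute:
  "A \<in> M \<Longrightarrow> A \<odot> (scalar_op c \<odot> S) = scalar_op c \<odot> (A \<odot> S)"
  by (simp only: op_assoc[symmetric] scalar_commute[OF M_clinear])

text \<open>A differential letter \<open>(A, L)\<close> is an operator together with a list of pairs representing its
  image \<open>\<Sum> P \<otimes> Q\<close> under the free difference quotient \<open>\<partial>\<^sub>X\<close>.\<close>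
type_synonym (in -) 'k dletter = "'k op \<times> ('k op \<times> 'k op) list"

text \<open>This is \<tau> \<otimes> \<tau> applied to the tensor of the letter, with the context
  \<open>P\<close> multiplied on its left leg from the left and \<open>S\<close> on its right leg
  from the right.\<close>

definition pair_sum :: "'h op \<Rightarrow> ('h op \<times> 'h op) list \<Rightarrow> 'h op \<Rightarrow> complex" where
  "pair_sum P L S = (\<Sum>(A, B)\<leftarrow>L. \<tau> (P \<odot> A) * \<tau> (B \<odot> S))"

definition ev :: "'h dletter list \<Rightarrow> 'h op" where
  "ev w = op_prod (map fst w)"

text \<open>The Leibniz rule: each letter is differentiated in turn, and \<open>P\<close> collects
  the letters already passed.\<close>

fun delta :: "'h op \<Rightarrow> 'h dletter list \<Rightarrow> 'h op \<Rightarrow> complex" where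
  "delta P [] S = 0"
| "delta P (a # w) S = pair_sum P (snd a) (ev w \<odot> S) + delta (P \<odot> fst a) w S"

text \<open>A property of the word, not of the operator \<open>ev w\<close>, since the derivative
  belongs to a chosen presentation. Every rewriting of words must therefore be checked on the value
  and on the derivative.\<close>

definition SD :: "'h dletter list \<Rightarrow> bool" where
  "SD w \<longleftrightarrow> \<tau> (X \<odot> ev w) = delta id_blinfun w id_blinfun"

definition in_algebra :: "'h dletter \<Rightarrow> bool" where
  "in_algebra a \<longleftrightarrow> fst a \<in> M \<and> (\<forall>(P, Q)\<in>set (snd a). P \<in> M \<and> Q \<in> M)"

lemma ev_simps [simp]: "ev [] = id_blinfun" "ev (a # w) = fst a \<odot> ev w"
  by (simp_all add: ev_def)

lemma ev_append: "ev (u @ v) = ev u \<odot> ev v"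
  by (simp add: ev_def op_prod_append)

lemma ev_M: "(\<And>a. a \<in> set w \<Longrightarrow> in_algebra a) \<Longrightarrow> ev w \<in> M"
  unfolding ev_def by (rule op_prod_M) (auto simp: in_algebra_def)

lemma pair_sum_Nil [simp]: "pair_sum P [] S = 0"
  by (simp add: pair_sum_def)

lemma pair_sum_append: "pair_sum P (L @ K) S = pair_sum P L S + pair_sum P K S"
  by (simp add: pair_sum_def)

lemma pair_sum_linear_right:
  assumes "S1 \<in> M" "S2 \<in> M" "\<forall>(P, Q)\<in>set L. P \<in> M \<and> Q \<in> M"
  shows "pair_sum P L (scalar_op c \<odot> S1 + scalar_op d \<odot> S2) = c * pair_sum P L S1 + d * pair_sum P L S2"
  using assms(3)
proof (induction L)
  case (Cons a L)
  obtain A B where a: "a = (A, B)" by (cases a)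
  have B: "B \<in> M" using Cons.prems a by simp
  have "B \<odot> (scalar_op c \<odot> S1 + scalar_op d \<odot> S2) = scalar_op c \<odot> (B \<odot> S1) + scalar_op d \<odot> (B \<odot> S2)"
    by (simp only: op_add_right scalar_left_commute[OF B])
  then show ?case using Cons B assms by (simp add: pair_sum_def a tau_add tau_scalar_mult M_intros algebra_simps)
qed simp

lemma pair_sum_linear_left:
  assumes "P1 \<in> M" "P2 \<in> M" "\<forall>(P, Q)\<in>set L. P \<in> M \<and> Q \<in> M"
  shows "pair_sum (scalar_op c \<odot> P1 + scalar_op d \<odot> P2) L S = c * pair_sum P1 L S + d * pair_sum P2 L S"
  using assms(3)
proof (induction L)
  case (Cons a L)
  obtain A B where a: "a = (A, B)" by (cases a)
  have A: "A \<in> M" using Cons.prems a by simp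
  then show ?case using Cons assms
    by (simp add: pair_sum_def a tau_add tau_scalar_mult M_intros op_add_left op_assoc algebra_simps)
qed simp

lemma delta_linear_right:
  assumes "S1 \<in> M" "S2 \<in> M" "\<And>a. a \<in> set w \<Longrightarrow> in_algebra a"
  shows "delta P w (scalar_op c \<odot> S1 + scalar_op d \<odot> S2) = c * delta P w S1 + d * delta P w S2"
  using assms(3)
proof (induction w arbitrary: P)
  case (Cons a w)
  have w: "ev w \<in> M" using Cons.prems by (intro ev_M) auto
  have "ev w \<odot> (scalar_op c \<odot> S1 + scalar_op d \<odot> S2) = scalar_op c \<odot> (ev w \<odot> S1) + scalar_op d \<odot> (ev w \<odot> S2)"
    by (simp only: op_add_right scalar_left_commute[OF w])
  moreover have "delta (P \<odot> fst a) w (scalar_op c \<odot> S1 + scalar_op d \<odot> S2)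
      = c * delta (P \<odot> fst a) w S1 + d * delta (P \<odot> fst a) w S2"
    using Cons.prems by (intro Cons.IH) auto
  moreover have "\<forall>(P, Q)\<in>set (snd a). P \<in> M \<and> Q \<in> M" using Cons.prems[of a] by (simp add: in_algebra_def)
  ultimately show ?case using w assms(1,2)
    by (simp add: pair_sum_linear_right M_mult algebra_simps)
qed simp

lemma delta_linear_left:
  assumes "P1 \<in> M" "P2 \<in> M" "\<And>a. a \<in> set w \<Longrightarrow> in_algebra a"
  shows "delta (scalar_op c \<odot> P1 + scalar_op d \<odot> P2) w S = c * delta P1 w S + d * delta P2 w S"
  using assms
proof (induction w arbitrary: P1 P2)
  case (Cons a w)
  have a: "fst a \<in> M" "\<forall>(P, Q)\<in>set (snd a). P \<in> M \<and> Q \<in> M" using Cons.prems(3)[of a] by (auto simp: in_algebra_def)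
  have "delta (scalar_op c \<odot> (P1 \<odot> fst a) + scalar_op d \<odot> (P2 \<odot> fst a)) w S
      = c * delta (P1 \<odot> fst a) w S + d * delta (P2 \<odot> fst a) w S"
    using Cons.prems a by (intro Cons.IH M_intros) auto
  then show ?case using Cons.prems a
    by (simp add: pair_sum_linear_left op_add_left op_assoc algebra_simps)
qed simp

lemma delta_append: "delta P (u @ v) S = delta P u (ev v \<odot> S) + delta (P \<odot> ev u) v S"
  by (induction u arbitrary: P) (simp_all add: ev_append op_assoc)

text \<open>The rewriting principle: a linear relation between tails that holds for values and, in
  every left context, for derivatives transfers the equation past any prefix
  \<open>W\<close>.\<close>

lemma SD_linear:
  assumes W: "\<And>a. a \<in> set W \<Longrightarrow> in_algebra a" and V: "\<And>a. a \<in> set Va \<Longrightarrow> in_algebra a" "\<And>a. a \<in> set Vb \<Longrightarrow> in_algebra a"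
    and ev: "ev V = scalar_op c \<odot> ev Va + scalar_op d \<odot> ev Vb"
    and delta: "\<And>P. P \<in> M \<Longrightarrow> delta P V id_blinfun = c * delta P Va id_blinfun + d * delta P Vb id_blinfun"
    and SD: "SD (W @ Va)" "SD (W @ Vb)"
  shows "SD (W @ V)"
proof -
  have M: "ev W \<in> M" "ev Va \<in> M" "ev Vb \<in> M" by (intro ev_M W V; assumption)+
  have XW: "X \<odot> ev W \<in> M" using M X_M by (intro M_intros)
  have "X \<odot> ev (W @ V) = scalar_op c \<odot> (X \<odot> ev (W @ Va)) + scalar_op d \<odot> (X \<odot> ev (W @ Vb))"
    by (simp only: ev_append ev op_add_right op_assoc[symmetric] scalar_commute[OF M_clinear[OF XW]]
        scalar_commute[OF M_clinear[OF X_M]] scalar_commute[OF M_clinear[OF M(1)]])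
  then have "\<tau> (X \<odot> ev (W @ V)) = c * \<tau> (X \<odot> ev (W @ Va)) + d * \<tau> (X \<odot> ev (W @ Vb))"
    using M X_M by (simp add: tau_add tau_scalar_mult M_intros ev_append)
  also have "\<dots> = c * delta id_blinfun (W @ Va) id_blinfun + d * delta id_blinfun (W @ Vb) id_blinfun"
    using SD by (simp add: SD_def)
  also have "\<dots> = delta id_blinfun (W @ V) id_blinfun"
    using M W by (simp add: delta_append delta[OF M(1)] ev delta_linear_right algebra_simps)
  finally show ?thesis by (simp add: SD_def)
qed

text \<open>Functions of \<open>D0\<close> are constants for \<open>\<partial>\<close>, and
  \<open>\<partial> U\<^sub>n\<close> is the sum of \<open>U\<^sub>a \<otimes> U\<^sub>b\<close>
  over \<open>a + b = n - 1\<close>.\<close>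

fun dl :: "letter \<Rightarrow> 'h dletter" where
  "dl (DL f) = (\<Phi> f, [])"
| "dl (UL n) = (U n, map (\<lambda>a. (U a, U (n - 1 - a))) [0..<n])"

lemma fst_dl [simp]: "fst (dl a) = lop a"
  by (cases a) auto

lemma ev_dl: "ev (map dl w) = op_prod (map lop w)"
  by (simp add: ev_def comp_def)

lemma in_algebra_dl: "is_DL a \<longrightarrow> lop a \<in> M \<Longrightarrow> in_algebra (dl a)"
  by (cases a) (auto simp: in_algebra_def cheb_op_M)

lemma in_algebra_dl_centred: "centred a \<Longrightarrow> in_algebra (dl a)"
  by (intro in_algebra_dl impI lop_M)

lemma pair_sum_UL:
  "pair_sum P (map (\<lambda>a. (U a, U (n - Suc a))) [0..<n]) S = (\<Sum>a<n. \<tau> (P \<odot> U a) * \<tau> (U (n - Suc a) \<odot> S))"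
  by (simp add: pair_sum_def comp_def interv_sum_list_conv_sum_set_nat atLeast0LessThan)

lemma reduced_ConsD: "reduced (a # w) \<Longrightarrow> reduced w"
  by (cases w) (auto simp: reduced_def)

lemma reduced_appendD: "reduced (u @ v) \<Longrightarrow> reduced u \<and> reduced v"
  by (auto simp: reduced_def successively_append_iff)

lemma reduced_replace:
  "reduced (u @ a # v) \<Longrightarrow> centred b \<Longrightarrow> is_DL a = is_DL b \<Longrightarrow> reduced (u @ b # v)"
  by (cases v) (auto simp: reduced_def successively_append_iff)

text \<open>Differentiating a letter \<open>UL n\<close> leaves on the left the trace of
  \<open>u\<close> followed by some \<open>U i\<close>. That word is reduced for
  \<open>i \<ge> 1\<close>, and for \<open>i = 0\<close> it is \<open>u\<close> itself, which is not
  empty; so every term vanishes.\<close>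

lemma delta_reduced_0:
  assumes "u \<noteq> []" "reduced (u @ r)"
  shows "delta (ev (map dl u)) (map dl r) id_blinfun = 0"
  using assms
proof (induction r arbitrary: u)
  case (Cons a r)
  have "delta (ev (map dl (u @ [a]))) (map dl r) id_blinfun = 0"
    using Cons.prems by (intro Cons.IH) auto
  then have rest: "delta (ev (map dl u) \<odot> lop a) (map dl r) id_blinfun = 0"
    by (simp add: ev_append)
  have "pair_sum (ev (map dl u)) (snd (dl a)) (ev (map dl r)) = 0"
  proof (cases a)
    case (UL n)
    have "\<tau> (ev (map dl u) \<odot> U i) = 0" for i
    proof (cases "i = 0")
      case True
      moreover have "reduced u" using reduced_appendD[OF Cons.prems(2)] by blast
      ultimately show ?thesis using reduced_tau[of u] Cons.prems(1) by (simp add: ev_dl)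
    next
      case False
      have "reduced (u @ UL i # r)"
        by (rule reduced_replace[OF Cons.prems(2)]) (use UL False in simp_all)
      then have "reduced (u @ [UL i])" using reduced_appendD[of "u @ [UL i]" r] by simp
      from reduced_tau[OF this] show ?thesis by (simp add: ev_dl op_prod_append)
    qed
    then show ?thesis by (simp add: UL pair_sum_UL)
  qed simp
  then show ?case using rest by simp
qed simp

text \<open>If the word starts with a function of \<open>D0\<close>, both sides vanish. If it starts
  with \<open>U n\<close>, the recurrence for \<open>X \<odot> U n\<close> leaves the trace of
  \<open>U (n - 1)\<close> times the rest; in the derivative the same term survives alone, as
  \<open>\<tau> (U a) = 0\<close> for \<open>a \<ge> 1\<close>.\<close>

lemma SD_reduced:
  assumes r: "reduced r" shows "SD (map dl r)"
proof (cases r)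
  case Nil
  then show ?thesis using tau_cheb[of 1] by (simp add: SD_def)
next
  case (Cons a r')
  have z: "delta (lop a) (map dl r') id_blinfun = 0"
    using delta_reduced_0[of "[a]" r'] r Cons by simp
  show ?thesis
  proof (cases a)
    case (DL f)
    have "reduced (UL 1 # r)" using r Cons DL by (auto simp: reduced_def)
    then have "\<tau> (X \<odot> ev (map dl r)) = 0" using reduced_tau[of "UL 1 # r"] by (simp add: ev_dl)
    then show ?thesis using z Cons DL by (simp add: SD_def)
  next
    case (UL n)
    then obtain m where n: "n = Suc m" using r Cons by (cases n) (auto simp: reduced_def)
    let ?R = "ev (map dl r')"
    have RM: "?R \<in> M" using r Cons by (intro ev_M) (auto simp: reduced_def in_algebra_dl_centred)
    have "\<tau> (U (Suc n) \<odot> ?R) = 0"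
      using reduced_tau[OF reduced_replace[of "[]" a r' "UL (Suc n)"]] r Cons UL by (simp add: ev_dl)
    moreover have "X \<odot> (U n \<odot> ?R) = U (Suc n) \<odot> ?R + U m \<odot> ?R"
      by (simp only: op_assoc[symmetric] n cheb_op_mult op_add_left)
    ultimately have "\<tau> (X \<odot> ev (map dl r)) = \<tau> (U m \<odot> ?R)"
      using RM by (simp add: Cons UL tau_add M_mult cheb_op_M)
    moreover have "delta id_blinfun (map dl r) id_blinfun = (\<Sum>a<n. \<tau> (U a) * \<tau> (U (n - 1 - a) \<odot> ?R))"
      using z by (simp add: Cons UL pair_sum_UL)
    moreover have "\<dots> = \<tau> (U m \<odot> ?R)"
      by (simp add: n sum.lessThan_Suc_shift tau_cheb tau_id del: sum.lessThan_Suc cheb_op.simps(2,3))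
    ultimately show ?thesis by (simp add: SD_def)
  qed
qed

definition raw :: "letter \<Rightarrow> bool" where
  "raw a \<longleftrightarrow> a = UL 1 \<or> (\<exists>f\<in>BB. a = DL f)"

lemma in_algebra_raw: "raw a \<Longrightarrow> in_algebra (dl a)"
  by (rule in_algebra_dl) (auto simp: raw_def intro: Phi_M)

lemma delta_UL_Cons:
  "delta P (dl (UL n) # V) S = (\<Sum>a<n. \<tau> (P \<odot> U a) * \<tau> (U (n - 1 - a) \<odot> (ev V \<odot> S))) + delta (P \<odot> U n) V S"
  by (simp add: pair_sum_UL)

text \<open>The three-term recurrence is compatible with \<open>\<partial>\<close>. After the lowest
  terms are split off, the recurrence on the left legs produces the sums for
  \<open>U (Suc (Suc m))\<close> and for \<open>U m\<close>.\<close>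

lemma delta_X_UL:
  assumes P: "P \<in> M" and V: "\<And>a. a \<in> set V \<Longrightarrow> in_algebra a"
  shows "delta P (dl (UL 1) # dl (UL (Suc m)) # V) id_blinfun
    = delta P (dl (UL (Suc (Suc m))) # V) id_blinfun + delta P (dl (UL m) # V) id_blinfun"
proof -
  let ?R = "ev V"
  let ?t = "\<lambda>a. \<tau> (P \<odot> U a)" and ?s = "\<lambda>a. \<tau> (U a \<odot> ?R)"
  have RM: "?R \<in> M" using V by (rule ev_M)
  have X0: "\<tau> ((P \<odot> X) \<odot> U 0) = ?t 1" by simp
  have XS: "\<tau> ((P \<odot> X) \<odot> U (Suc a)) = ?t (Suc (Suc a)) + ?t a" for a
    unfolding op_assoc cheb_op_mult op_add_right using P by (simp add: tau_add M_mult cheb_op_M)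
  have "delta ((P \<odot> X) \<odot> U (Suc m)) V id_blinfun
      = delta (scalar_op 1 \<odot> (P \<odot> U (Suc (Suc m))) + scalar_op 1 \<odot> (P \<odot> U m)) V id_blinfun"
    unfolding op_assoc cheb_op_mult op_add_right by (simp add: scalar_one del: cheb_op.simps)
  also have "\<dots> = delta (P \<odot> U (Suc (Suc m))) V id_blinfun + delta (P \<odot> U m) V id_blinfun"
    using P V by (subst delta_linear_left) (auto intro: M_mult cheb_op_M simp del: cheb_op.simps)
  finally have d: "delta ((P \<odot> X) \<odot> U (Suc m)) V id_blinfun
      = delta (P \<odot> U (Suc (Suc m))) V id_blinfun + delta (P \<odot> U m) V id_blinfun" .
  have s1: "(\<Sum>a<Suc m. \<tau> ((P \<odot> X) \<odot> U a) * ?s (m - a))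
      = ?t 1 * ?s m + (\<Sum>a<m. (?t (Suc (Suc a)) + ?t a) * ?s (m - Suc a))"
    unfolding sum.lessThan_Suc_shift by (simp add: XS X0 del: cheb_op.simps)
  have s2: "(\<Sum>a<Suc (Suc m). ?t a * ?s (Suc m - a))
      = ?t 0 * ?s (Suc m) + (?t 1 * ?s m + (\<Sum>a<m. ?t (Suc (Suc a)) * ?s (m - Suc a)))"
    unfolding sum.lessThan_Suc_shift by (simp del: cheb_op.simps)
  have "delta P (dl (UL 1) # dl (UL (Suc m)) # V) id_blinfun
      = ?t 0 * \<tau> (U 0 \<odot> (U (Suc m) \<odot> ?R)) + ((\<Sum>a<Suc m. \<tau> ((P \<odot> X) \<odot> U a) * ?s (m - a))
        + delta ((P \<odot> X) \<odot> U (Suc m)) V id_blinfun)"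
    unfolding delta_UL_Cons by (simp del: cheb_op.simps(3) sum.lessThan_Suc)
  also have "\<dots> = (\<Sum>a<Suc (Suc m). ?t a * ?s (Suc m - a)) + (\<Sum>a<m. ?t a * ?s (m - Suc a))
      + delta (P \<odot> U (Suc (Suc m))) V id_blinfun + delta (P \<odot> U m) V id_blinfun"
    unfolding d s1 s2 by (simp add: sum.distrib distrib_right del: cheb_op.simps(2,3))
  also have "\<dots> = delta P (dl (UL (Suc (Suc m))) # V) id_blinfun + delta P (dl (UL m) # V) id_blinfun"
    unfolding delta_UL_Cons by (simp del: cheb_op.simps sum.lessThan_Suc)
  finally show ?thesis .
qed

text \<open>The rightmost raw letter is absorbed into the reduced tail by \<open>X U\<^sub>n = U\<^sub>n\<^sub>+\<^sub>1 + U\<^sub>n\<^sub>-\<^sub>1\<close> and by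
  centring.\<close>
lemma SD_raw_reduced:
  assumes "\<And>a. a \<in> set w \<Longrightarrow> raw a" "reduced r"
  shows "SD (map dl w @ map dl r)"
  using assms
proof (induction w arbitrary: r rule: rev_induct)
  case Nil
  then show ?case using SD_reduced by simp
next
  case (snoc a w)
  have W: "\<And>b. b \<in> set (map dl w) \<Longrightarrow> in_algebra b" using snoc.prems(1) in_algebra_raw by auto
  have wr: "\<And>b. b \<in> set (map dl s) \<Longrightarrow> in_algebra b" if "reduced s" for s
    using that in_algebra_dl_centred by (auto simp: reduced_def)
  have IH: "SD (map dl w @ map dl s)" if "reduced s" for s using snoc that by simp
  \<comment> \<open>Splitting off the mean \<open>t\<close> gives two reduced tails, one with the
    centred function in front and one without it; both are covered by the induction
    hypothesis.\<close>
  have centre: "SD (map dl w @ dl (DL f) # map dl s)"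
    if f: "f \<in> BB" and s: "reduced s" "s = [] \<or> \<not> is_DL (hd s)" for f s
  proof -
    define t where "t = \<tau> (\<Phi> f)"
    define g where "g x = f x - t" for x
    have g: "g \<in> BB" "\<Phi> g = \<Phi> f - scalar_op t"
      unfolding g_def using f by (auto simp: Phi_diff bdd_borel_const Phi_const intro: bdd_borel_diff)
    have tg: "\<tau> (\<Phi> g) = 0" by (simp add: g tau_diff Phi_M f M_scalar tau_scalar t_def)
    have red: "reduced (DL g # s)"
      using s g tg by (cases s) (auto simp: reduced_def)
    have fg: "\<Phi> f = scalar_op 1 \<odot> \<Phi> g + scalar_op t" by (simp add: g scalar_one)
    show ?thesis
    proof (rule SD_linear[where Va = "map dl (DL g # s)" and Vb = "map dl s" and c = 1 and d = t])
      show "ev (dl (DL f) # map dl s) = scalar_op 1 \<odot> ev (map dl (DL g # s)) + scalar_op t \<odot> ev (map dl s)"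
        by (simp add: fg op_add_left scalar_one)
      fix P assume P: "P \<in> M"
      have "P \<odot> \<Phi> f = scalar_op 1 \<odot> (P \<odot> \<Phi> g) + scalar_op t \<odot> P"
        by (simp add: fg op_add_right scalar_one scalar_commute M_clinear P)
      then have "delta (P \<odot> \<Phi> f) (map dl s) id_blinfun
          = 1 * delta (P \<odot> \<Phi> g) (map dl s) id_blinfun + t * delta P (map dl s) id_blinfun"
        using delta_linear_left[OF M_mult[OF P Phi_M[OF g(1)]] P wr[OF s(1)], where c = 1 and d = t and S = id_blinfun and w = "map dl s"] by simp
      then show "delta P (dl (DL f) # map dl s) id_blinfun
          = 1 * delta P (map dl (DL g # s)) id_blinfun + t * delta P (map dl s) id_blinfun"
        by simp
    qed (use W wr red s IH in blast)+
  qed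
  have "SD (map dl w @ dl a # map dl r)"
  proof (cases "a = UL 1")
    case False
    then obtain f where f: "a = DL f" "f \<in> BB" using snoc.prems(1)[of a] by (auto simp: raw_def)
    show ?thesis
    proof (cases "r = [] \<or> \<not> is_DL (hd r)")
      case True
      then show ?thesis using centre f snoc.prems(2) by simp
    next
      case False
      then obtain b r' where r: "r = b # r'" "is_DL b" by (cases r) auto
      then obtain g where b: "b = DL g" by (cases b) auto
      have g: "g \<in> BB" using snoc.prems(2) r b by (simp add: reduced_def)
      have r': "reduced r'" "r' = [] \<or> \<not> is_DL (hd r')"
        using snoc.prems(2) r reduced_ConsD by (auto simp: reduced_def successively_Cons)
      \<comment> \<open>Two neighbouring functions of \<open>D0\<close> merge into their product
        without changing value or derivative, and the merged letter is then centred.\<close>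
      have "SD (map dl w @ dl (DL (\<lambda>t. f t * g t)) # map dl r')"
        by (intro centre bdd_borel_mult f g r')
      moreover have "SD (map dl w @ dl (DL f) # dl (DL g) # map dl r')
          \<longleftrightarrow> SD (map dl w @ dl (DL (\<lambda>t. f t * g t)) # map dl r')"
        by (simp add: SD_def ev_append delta_append Phi_mult f g op_assoc)
      ultimately show ?thesis by (simp add: f b r)
    qed
  next
    case a: True
    show ?thesis
    proof (cases "r = [] \<or> is_DL (hd r)")
      case True
      then have "reduced (a # r)" using snoc.prems(2) a by (cases r) (auto simp: reduced_def)
      from IH[OF this] show ?thesis by simp
    next
      case False
      then obtain b r' where r: "r = b # r'" "\<not> is_DL b" by (cases r) auto
      then obtain n where "b = UL n" by (cases b) auto
      moreover from this obtain m where "n = Suc m"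
        using snoc.prems(2) r by (cases n) (auto simp: reduced_def)
      ultimately have b: "b = UL (Suc m)" by simp
      have r': "reduced r'" using snoc.prems(2) r reduced_ConsD by auto
      have red1: "reduced (UL (Suc (Suc m)) # r')"
        using reduced_replace[of "[]" b r' "UL (Suc (Suc m))"] snoc.prems(2) r b by simp
      \<comment> \<open>\<open>UL 0\<close> is the identity and not an admissible letter of a
        reduced word, so for \<open>m = 0\<close> it is dropped.\<close>
      have SD2: "SD (map dl w @ dl (UL m) # map dl r')"
      proof (cases "m = 0")
        case True
        then show ?thesis using IH[OF r'] by (simp add: SD_def ev_append delta_append)
      next
        case False
        then have "reduced (UL m # r')"
          using reduced_replace[of "[]" b r' "UL m"] snoc.prems(2) r b by simp
        from IH[OF this] show ?thesis by (simp del: dl.simps)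
      qed
      have "SD (map dl w @ dl (UL 1) # dl (UL (Suc m)) # map dl r')"
      proof (rule SD_linear[where Va = "dl (UL (Suc (Suc m))) # map dl r'" and Vb = "dl (UL m) # map dl r'"
            and c = 1 and d = 1])
        show "ev (dl (UL 1) # dl (UL (Suc m)) # map dl r') = scalar_op 1 \<odot> ev (dl (UL (Suc (Suc m))) # map dl r')
            + scalar_op 1 \<odot> ev (dl (UL m) # map dl r')"
          using op_assoc[of X "U (Suc m)" "ev (map dl r')", symmetric]
          by (simp add: scalar_one cheb_op_mult op_add_left)
        show "delta P (dl (UL 1) # dl (UL (Suc m)) # map dl r') id_blinfun
            = 1 * delta P (dl (UL (Suc (Suc m))) # map dl r') id_blinfun + 1 * delta P (dl (UL m) # map dl r') id_blinfun"
          if "P \<in> M" for P using delta_X_UL[OF that, of "map dl r'" m] wr[OF r'] by (simp del: dl.simps delta.simps)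
        show "SD (map dl w @ dl (UL (Suc (Suc m))) # map dl r')" using IH[OF red1] by (simp del: dl.simps)
        have wU: "in_algebra (dl (UL k))" for k by (rule in_algebra_dl) simp
        show "in_algebra c" if "c \<in> set (dl (UL (Suc (Suc m))) # map dl r')" for c
          using that wU wr[OF r', of c] by (auto simp del: dl.simps)
        show "in_algebra c" if "c \<in> set (dl (UL m) # map dl r')" for c
          using that wU wr[OF r', of c] by (auto simp del: dl.simps)
      qed (use W SD2 in auto)
      then show ?thesis by (simp add: a b r del: dl.simps)
    qed
  qed
  then show ?case by simp
qed

text \<open>A relation, not a function: an operator has one list for each way of building it, and
  the equation is established for every such list.\<close>

inductive der :: "'h op \<Rightarrow> ('h op \<times> 'h op) list \<Rightarrow> bool" where
  der_Phi: "f \<in> BB \<Longrightarrow> der (\<Phi> f) []"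
| der_X: "der X [(id_blinfun, id_blinfun)]"
| der_add: "der A L \<Longrightarrow> der B K \<Longrightarrow> der (A + B) (L @ K)"
| der_mult: "der A L \<Longrightarrow> der B K \<Longrightarrow>
    der (A \<odot> B) (map (\<lambda>(P, Q). (P, Q \<odot> B)) L @ map (\<lambda>(P, Q). (A \<odot> P, Q)) K)"

lemma der_in_algebra: "der A L \<Longrightarrow> in_algebra (A, L)"
  by (induction rule: der.induct) (auto simp: in_algebra_def intro: Phi_M X_M M_intros)

lemma pair_sum_der_mult:
  "pair_sum P (map (\<lambda>(A, B). (A, B \<odot> C)) L) S = pair_sum P L (C \<odot> S)"
  "pair_sum P (map (\<lambda>(A, B). (C \<odot> A, B)) L) S = pair_sum (P \<odot> C) L S"
  by (simp_all add: pair_sum_def comp_def case_prod_unfold op_assoc)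

text \<open>The hypothesis on \<open>v\<close> ranges over all raw prefixes so that a product can be
  treated as two consecutive letters: \<open>(B, K)\<close> is put in front of \<open>v\<close>
  first, then \<open>(A, L)\<close> in front of the result.\<close>

lemma SD_der:
  assumes "der A L" "\<And>a. a \<in> set v \<Longrightarrow> in_algebra a"
    "\<And>u. (\<And>a. a \<in> set u \<Longrightarrow> raw a) \<Longrightarrow> SD (map dl u @ v)"
    "\<And>a. a \<in> set u \<Longrightarrow> raw a"
  shows "SD (map dl u @ (A, L) # v)"
  using assms
proof (induction arbitrary: u v rule: der.induct)
  case (der_Phi f)
  have "SD (map dl (u @ [DL f]) @ v)" using der_Phi by (intro der_Phi(3)) (auto simp: raw_def)
  then show ?case by simp
next
  case der_X
  have "SD (map dl (u @ [UL 1]) @ v)" using der_X by (intro der_X(2)) (auto simp: raw_def)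
  then show ?case by simp
next
  case (der_add A L B K)
  have AB: "A \<in> M" "B \<in> M" using der_in_algebra der_add.hyps by (auto simp: in_algebra_def)
  show ?case
  proof (rule SD_linear[where Va = "(A, L) # v" and Vb = "(B, K) # v" and c = 1 and d = 1])
    fix P assume P: "P \<in> M"
    have "delta (scalar_op 1 \<odot> (P \<odot> A) + scalar_op 1 \<odot> (P \<odot> B)) v id_blinfun
        = 1 * delta (P \<odot> A) v id_blinfun + 1 * delta (P \<odot> B) v id_blinfun"
      using P AB der_add.prems(1) by (intro delta_linear_left M_mult)
    then show "delta P ((A + B, L @ K) # v) id_blinfun
        = 1 * delta P ((A, L) # v) id_blinfun + 1 * delta P ((B, K) # v) id_blinfun"
      by (simp add: pair_sum_append op_add_right scalar_one)
  next
    show "SD (map dl u @ (A, L) # v)" by (rule der_add.IH(1)[OF der_add.prems])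
    show "SD (map dl u @ (B, K) # v)" by (rule der_add.IH(2)[OF der_add.prems])
  qed (use der_add.prems der_add.hyps der_in_algebra in_algebra_raw in \<open>auto simp: scalar_one op_add_left\<close>)
next
  case (der_mult A L B K)
  have "SD (map dl u @ (A, L) # (B, K) # v)"
  proof (rule der_mult.IH(1))
    show "SD (map dl u @ (B, K) # v)" if "\<And>a. a \<in> set u \<Longrightarrow> raw a" for u
      by (rule der_mult.IH(2)[OF der_mult.prems(1,2) that])
  qed (use der_mult.prems der_mult.hyps der_in_algebra in auto)
  then show ?case
    by (simp add: SD_def ev_append delta_append pair_sum_append pair_sum_der_mult op_assoc add.assoc)
qed

theorem Schwinger_Dyson:
  assumes "der A L" shows "\<tau> (X \<odot> A) = (\<Sum>(P, Q)\<leftarrow>L. \<tau> P * \<tau> Q)"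
proof -
  have "SD (map dl u)" if "\<And>a. a \<in> set u \<Longrightarrow> raw a" for u
    using SD_raw_reduced[of u "[]"] that by (simp add: reduced_def)
  then have "SD (map dl [] @ (A, L) # [])" using assms by (intro SD_der) auto
  then show ?thesis by (simp add: SD_def pair_sum_def)
qed

end

section \<open>The DT-operator\<close>

context tracial_calculus
begin

text \<open>Faithfulness makes functions of \<open>D0\<close> insensitive to null sets of
  \<open>[0,1]\<close>. This is what allows the closed dyadic intervals to share endpoints.\<close>

lemma Phi_AE_eq:
  assumes f: "f \<in> BB" and g: "g \<in> BB" and S: "finite S"
    and eq: "\<And>t. t \<in> {0..1} \<Longrightarrow> t \<notin> S \<Longrightarrow> f t = g t"
  shows "\<Phi> f = \<Phi> g"
proof -
  let ?d = "\<lambda>t. f t - g t"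
  have d: "?d \<in> BB" by (intro bdd_borel_diff f g)
  have "AE t in lborel. t \<notin> S"
    using finite_imp_null_set_lborel[OF S] by (rule AE_not_in)
  then have "AE t in lborel. indicator {0..1} t *\<^sub>R (cnj (?d t) * ?d t) = 0"
    by eventually_elim (use eq in \<open>auto simp: indicator_def\<close>)
  then have "(LINT t:{0..1}|lborel. cnj (?d t) * ?d t) = 0"
    unfolding set_lebesgue_integral_def by (rule integral_eq_zero_AE)
  then have "tnorm (\<Phi> ?d) = 0" using tnorm_Phi[OF d] by simp
  then have "\<Phi> ?d = 0" by (rule tnorm_eq_0[OF Phi_M[OF d]])
  then show ?thesis using Phi_diff[OF f g] by simp
qed

definition iproj :: "real \<Rightarrow> real \<Rightarrow> 'h op" where
  "iproj a b = \<Phi> (indicator {a..b})"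

lemma indicator_BB: "indicator {a..b::real} \<in> BB"
  by (rule bdd_borel_indicator) simp

lemma iproj_M: "iproj a b \<in> M"
  unfolding iproj_def by (intro Phi_M indicator_BB)

lemma iproj_refl: "iproj a a = 0"
proof -
  have "iproj a a = \<Phi> (\<lambda>_. 0)"
    unfolding iproj_def by (rule Phi_AE_eq[OF indicator_BB bdd_borel_const, of "{a}"]) auto
  then show ?thesis by (simp add: Phi_const scalar_zero)
qed

lemma iproj_add:
  assumes "a \<le> b" "b \<le> c" shows "iproj a b + iproj b c = iproj a c"
  unfolding iproj_def Phi_add[OF indicator_BB indicator_BB, symmetric]
  by (rule Phi_AE_eq[OF bdd_borel_add[OF indicator_BB indicator_BB] indicator_BB, of "{b}"])
    (use assms in \<open>auto simp: indicator_def\<close>)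

lemma iproj_mult_0:
  assumes "b \<le> c" shows "iproj a b \<odot> iproj c d = 0" "iproj c d \<odot> iproj a b = 0"
proof -
  have "\<Phi> (\<lambda>t. indicator {a..b} t * indicator {c..d} t) = \<Phi> (\<lambda>_. 0)"
    by (rule Phi_AE_eq[OF bdd_borel_mult[OF indicator_BB indicator_BB] bdd_borel_const, of "{b}"])
      (use assms in \<open>auto simp: indicator_def\<close>)
  then have "\<Phi> (\<lambda>t. indicator {a..b} t * indicator {c..d} t) = 0" by (simp add: Phi_const scalar_zero)
  moreover have "\<Phi> (\<lambda>t. indicator {c..d} t * indicator {a..b} t) = \<Phi> (\<lambda>t. indicator {a..b} t * indicator {c..d} t)"
    by (simp only: mult.commute)
  ultimately show "iproj a b \<odot> iproj c d = 0" "iproj c d \<odot> iproj a b = 0"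
    unfolding iproj_def by (simp_all add: Phi_mult indicator_BB)
qed

lemma iproj_idem: "iproj a b \<odot> iproj a b = iproj a b"
  unfolding iproj_def Phi_mult[OF indicator_BB indicator_BB, symmetric]
  by (rule arg_cong[of _ _ \<Phi>]) (auto simp: indicator_def)

lemma iproj_adj: "adj (iproj a b) = iproj a b"
proof -
  have "(\<lambda>t. cnj (indicator {a..b} t)) = indicator {a..b}" by (auto simp: indicator_def)
  then show ?thesis unfolding iproj_def by (simp add: Phi_adj indicator_BB)
qed

lemma iproj_norm: "norm (iproj a b) \<le> 1"
  unfolding iproj_def by (rule Phi_norm_le) (auto intro: indicator_BB simp: indicator_def)

lemma iproj_unit: "iproj 0 1 = id_blinfun"
proof -
  have "iproj 0 1 = \<Phi> (\<lambda>_. 1)"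
    unfolding iproj_def by (rule Phi_AE_eq[OF indicator_BB bdd_borel_const, of "{}"]) auto
  then show ?thesis by (simp add: Phi_one)
qed

text \<open>Using the idempotent twice gives a bound linear in the trace of the projection, where
  Cauchy-Schwarz alone gives its square root. Such bounds can be summed over the cells.\<close>

lemma tau_iproj_le:
  assumes A: "A \<in> M" shows "cmod (\<tau> (A \<odot> iproj a b)) \<le> norm A * Re (\<tau> (iproj a b))"
proof -
  let ?P = "iproj a b"
  have tP: "(tnorm ?P)\<^sup>2 = Re (\<tau> ?P)"
    using tau_adj_mult_self[OF iproj_M[of a b]] by (simp add: iproj_adj iproj_idem)
  have "\<tau> (A \<odot> ?P) = \<tau> ((A \<odot> ?P) \<odot> ?P)" by (simp add: op_assoc iproj_idem)
  also have "\<dots> = \<tau> (adj ?P \<odot> (A \<odot> ?P))"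
    by (simp add: iproj_adj tau_commute[of "A \<odot> ?P" ?P] A M_mult iproj_M)
  also have "cmod \<dots> \<le> tnorm (A \<odot> ?P) * tnorm ?P"
    by (intro tau_Cauchy_Schwarz M_mult A iproj_M)
  also have "\<dots> \<le> (norm A * tnorm ?P) * tnorm ?P"
    by (intro mult_right_mono tnorm_mult_left tnorm_nonneg A iproj_M)
  finally show ?thesis by (simp add: tP[symmetric] power2_eq_square)
qed

lemma tau_iproj_nonneg: "0 \<le> Re (\<tau> (iproj a b))"
  using tau_iproj_le[OF M_id, of a b] norm_ge_zero[of "\<tau> (iproj a b)"] complex_Re_le_cmod
    tau_adj_mult_self[OF iproj_M[of a b]] by (simp add: iproj_adj iproj_idem)

definition cell :: "nat \<Rightarrow> nat \<Rightarrow> 'h op" where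
  "cell N j = iproj (real (j - 1) / 2 ^ N) (real j / 2 ^ N)"

lemma cell_M: "cell N j \<in> M"
  unfolding cell_def by (rule iproj_M)

lemma cell_idem: "cell N j \<odot> cell N j = cell N j"
  unfolding cell_def by (rule iproj_idem)

lemma cell_adj: "adj (cell N j) = cell N j"
  unfolding cell_def by (rule iproj_adj)

lemma cell_orthogonal: "j \<noteq> k \<Longrightarrow> cell N j \<odot> cell N k = 0"
proof (cases "j < k")
  case True
  then show ?thesis unfolding cell_def by (intro iproj_mult_0(1)) (simp add: divide_right_mono)
next
  case False
  assume "j \<noteq> k"
  with False show ?thesis unfolding cell_def by (intro iproj_mult_0(2)) (simp add: divide_right_mono)
qed

lemma cell_sum: "a \<le> b \<Longrightarrow> (\<Sum>k\<in>{a<..b}. cell N k) = iproj (real a / 2 ^ N) (real b / 2 ^ N)"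
proof (induction b rule: dec_induct)
  case base
  then show ?case by (simp add: iproj_refl)
next
  case (step b)
  then have "{a<..Suc b} = insert (Suc b) {a<..b}" by auto
  then have "(\<Sum>k\<in>{a<..Suc b}. cell N k) = iproj (real a / 2 ^ N) (real b / 2 ^ N) + cell N (Suc b)"
    using step by (simp add: add.commute)
  also have "\<dots> = iproj (real a / 2 ^ N) (real (Suc b) / 2 ^ N)"
    unfolding cell_def diff_Suc_1 using step by (intro iproj_add divide_right_mono) auto
  finally show ?case .
qed

lemma cell_sum_all: "(\<Sum>k = 1..2 ^ N. cell N k) = id_blinfun"
proof -
  have "{1..2 ^ N} = {0<..2 ^ N :: nat}" by auto
  then show ?thesis using cell_sum[of 0 "2 ^ N" N] by (simp add: iproj_unit)
qed

lemma cell_trace_sum: "(\<Sum>k = 1..2 ^ N. Re (\<tau> (cell N k))) = 1"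
proof -
  have "(\<Sum>k = 1..2 ^ N. \<tau> (cell N k)) = \<tau> id_blinfun"
    unfolding cell_sum_all[of N, symmetric] by (rule tau_sum[symmetric]) (rule cell_M)
  then have "Re (\<Sum>k = 1..2 ^ N. \<tau> (cell N k)) = 1" by (simp add: tau_id)
  then show ?thesis by simp
qed

text \<open>\<open>True\<close> stands for \<open>T\<close>, whose approximants couple a cell with
  the later ones, and \<open>False\<close> for its adjoint.\<close>

definition rel :: "bool \<Rightarrow> nat \<Rightarrow> nat \<Rightarrow> bool" where
  "rel b j k \<longleftrightarrow> (if b then j < k else k < j)"

definition side :: "bool \<Rightarrow> real \<Rightarrow> 'h op" where
  "side b c = (if b then iproj c 1 else iproj 0 c)"

text \<open>The endpoint of cell \<open>j\<close> that faces the cells related to it: the right one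
  for \<open>True\<close>, the left one for \<open>False\<close>.\<close>

definition gridpt :: "bool \<Rightarrow> nat \<Rightarrow> nat \<Rightarrow> real" where
  "gridpt b N j = (if b then real j / 2 ^ N else real (j - 1) / 2 ^ N)"

lemma rel_sum:
  assumes "j \<in> {1..2 ^ N}"
  shows "(\<Sum>k = 1..2 ^ N. if rel b j k then cell N k else 0) = side b (gridpt b N j)"
proof (cases b)
  case True
  have "(\<Sum>k = 1..2 ^ N. if rel b j k then cell N k else 0) = (\<Sum>k\<in>{j<..2 ^ N}. cell N k)"
    by (subst sum.inter_filter[symmetric]) (use assms True in \<open>auto simp: rel_def intro!: sum.cong\<close>)
  then show ?thesis using cell_sum[of j "2 ^ N" N] assms True by (simp add: side_def gridpt_def)
next
  case False
  have "(\<Sum>k = 1..2 ^ N. if rel b j k then cell N k else 0) = (\<Sum>k\<in>{0<..j - 1}. cell N k)"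
    by (subst sum.inter_filter[symmetric]) (use assms False in \<open>auto simp: rel_def intro!: sum.cong\<close>)
  then show ?thesis using cell_sum[of 0 "j - 1" N] assms False by (simp add: side_def gridpt_def)
qed

text \<open>The covariance on the grid: \<open>B\<close> is the word enclosed by a contracted pair,
  averaged over one side of the grid point, and \<open>C\<close> is what remains of the
  trace.\<close>

definition beta :: "bool \<Rightarrow> nat \<Rightarrow> 'h op \<Rightarrow> 'h op \<Rightarrow> complex" where
  "beta b N B C = (\<Sum>j = 1..2 ^ N. \<tau> (B \<odot> side b (gridpt b N j)) * \<tau> (C \<odot> cell N j))"

lemma side_M: "side b c \<in> M"
  by (simp add: side_def iproj_M)

lemma side_norm: "norm (side b c) \<le> 1"
  by (simp add: side_def iproj_norm)

text \<open>Uniform in \<open>N\<close>, because the traces of the cells add up to 1. Thus the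
  convergence of the words and that of the grid can be treated separately.\<close>

lemma beta_bound:
  assumes B: "B \<in> M" and C: "C \<in> M" shows "cmod (beta b N B C) \<le> norm B * norm C"
proof -
  have "cmod (beta b N B C) \<le> (\<Sum>j = 1..2 ^ N. norm B * (norm C * Re (\<tau> (cell N j))))"
    unfolding beta_def
  proof (rule sum_norm_le)
    fix j
    have "cmod (\<tau> (B \<odot> side b (gridpt b N j))) \<le> norm (B \<odot> side b (gridpt b N j))"
      by (intro tau_le_norm M_mult B side_M)
    also have "\<dots> \<le> norm B * 1"
      using norm_op_mult side_norm by (meson mult_left_mono norm_ge_zero order_trans)
    finally have "cmod (\<tau> (B \<odot> side b (gridpt b N j))) \<le> norm B" by simp
    then show "cmod (\<tau> (B \<odot> side b (gridpt b N j)) * \<tau> (C \<odot> cell N j)) \<le> norm B * (norm C * Re (\<tau> (cell N j)))"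
      unfolding norm_mult using tau_iproj_le[OF C] by (intro mult_mono) (auto simp: cell_def)
  qed
  also have "\<dots> = norm B * norm C"
    by (simp only: sum_distrib_left[symmetric] cell_trace_sum mult_1_right)
  finally show ?thesis .
qed

lemma beta_diff_left: "B \<in> M \<Longrightarrow> B' \<in> M \<Longrightarrow> beta b N (B - B') C = beta b N B C - beta b N B' C"
  by (simp add: beta_def op_diff_left tau_diff M_mult side_M sum_subtractf left_diff_distrib)

lemma beta_diff_right: "C \<in> M \<Longrightarrow> C' \<in> M \<Longrightarrow> beta b N B (C - C') = beta b N B C - beta b N B C'"
  by (simp add: beta_def op_diff_left tau_diff M_mult cell_M sum_subtractf right_diff_distrib)

lemma beta_tendsto:
  assumes B: "\<And>N. B N \<in> M" "B \<longlonglongrightarrow> B'" and C: "\<And>N. C N \<in> M" "C \<longlonglongrightarrow> C'"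
    and lim: "(\<lambda>N. beta b N B' C') \<longlonglongrightarrow> z"
  shows "(\<lambda>N. beta b N (B N) (C N)) \<longlonglongrightarrow> z"
proof -
  have B': "B' \<in> M" and C': "C' \<in> M" using M_limit B C by blast+
  have nB: "(\<lambda>N. norm (B N - B')) \<longlonglongrightarrow> 0" and nC: "(\<lambda>N. norm (C N - C')) \<longlonglongrightarrow> 0"
    using B(2) C(2) by (simp_all add: LIM_zero_iff tendsto_norm_zero_iff)
  have t: "(\<lambda>N. norm (B N - B') * norm (C N) + norm B' * norm (C N - C')) \<longlonglongrightarrow> 0 * norm C' + norm B' * 0"
    by (intro tendsto_intros nB nC C(2))
  have "(\<lambda>N. beta b N (B N) (C N) - beta b N B' C') \<longlonglongrightarrow> 0"
  proof (rule Lim_null_comparison[OF always_eventually])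
    show "\<forall>N. norm (beta b N (B N) (C N) - beta b N B' C')
        \<le> norm (B N - B') * norm (C N) + norm B' * norm (C N - C')"
    proof
      fix N
      have "beta b N (B N) (C N) - beta b N B' C' = beta b N (B N - B') (C N) + beta b N B' (C N - C')"
        by (simp add: beta_diff_left beta_diff_right B B' C C')
      then show "norm (beta b N (B N) (C N) - beta b N B' C')
          \<le> norm (B N - B') * norm (C N) + norm B' * norm (C N - C')"
        using norm_triangle_mono[OF beta_bound[OF M_diff[OF B(1) B'] C(1), of b N N N]
          beta_bound[OF B' M_diff[OF C(1) C'], of b N N]] by simp
    qed
    show "(\<lambda>N. norm (B N - B') * norm (C N) + norm B' * norm (C N - C')) \<longlonglongrightarrow> 0" using t by simp
  qed
  from tendsto_add[OF this lim] show ?thesis by simp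
qed

text \<open>\<open>dens A F\<close>: the function \<open>F\<close> represents \<open>E\<^sub>D(A)\<close>.\<close>
definition dens :: "'h op \<Rightarrow> (real \<Rightarrow> complex) \<Rightarrow> bool" where
  "dens A F \<longleftrightarrow> F \<in> BB \<and> (\<forall>h\<in>BB. \<tau> (A \<odot> \<Phi> h) = \<tau> (\<Phi> F \<odot> \<Phi> h))"

lemma dens_add:
  "A \<in> M \<Longrightarrow> B \<in> M \<Longrightarrow> dens A F \<Longrightarrow> dens B G \<Longrightarrow> dens (A + B) (\<lambda>t. F t + G t)"
  by (auto simp: dens_def bdd_borel_add op_add_left tau_add M_mult Phi_M Phi_add)

lemma dens_scalar_mult:
  "A \<in> M \<Longrightarrow> dens A F \<Longrightarrow> dens (scalar_op c \<odot> A) (\<lambda>t. c * F t)"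
  by (auto simp: dens_def bdd_borel_cmult op_assoc tau_scalar_mult M_mult Phi_M Phi_cmult)

lemma dens_id: "dens id_blinfun (\<lambda>_. 1)"
  by (auto simp: dens_def bdd_borel_const Phi_one)

text \<open>A Riemann sum: \<open>beta\<close> replaces \<open>S\<close> on each cell by its value
  at the grid point, so the Lipschitz bound costs a multiple of the mesh, weighted by the traces of
  the cells.\<close>

lemma beta_dens_tendsto:
  assumes A: "dens A F" and B: "dens B G" and f: "f \<in> BB" and S: "S \<in> BB"
    and side: "\<And>c. c \<in> {0..1} \<Longrightarrow> \<tau> (\<Phi> F \<odot> side b c) = S c"
    and lip: "\<And>x y. x \<in> {0..1} \<Longrightarrow> y \<in> {0..1} \<Longrightarrow> cmod (S x - S y) \<le> K * \<bar>x - y\<bar>"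
  shows "(\<lambda>N. beta b N A (B \<odot> \<Phi> f)) \<longlonglongrightarrow> \<tau> (\<Phi> (\<lambda>t. S t * G t) \<odot> \<Phi> f)"
proof -
  have FG: "F \<in> BB" "G \<in> BB" using A B by (auto simp: dens_def)
  obtain CG where CG: "CG \<ge> 0" "\<And>t. t \<in> {- norm D0..norm D0} \<Longrightarrow> cmod (G t) \<le> CG"
    using bdd_borelE[OF FG(2)] by blast
  obtain Cf where Cf: "Cf \<ge> 0" "\<And>t. t \<in> {- norm D0..norm D0} \<Longrightarrow> cmod (f t) \<le> Cf"
    using bdd_borelE[OF f] by blast
  have "0 \<le> K * \<bar>0 - 1\<bar>" by (rule order_trans[OF norm_ge_zero lip]) auto
  then have K: "K \<ge> 0" by simp
  let ?h = "\<lambda>t. S t * G t * f t"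
  have h: "?h \<in> BB" by (intro bdd_borel_mult S FG f)
  have tot: "\<tau> (\<Phi> (\<lambda>t. S t * G t) \<odot> \<Phi> f) = (\<Sum>j = 1..2 ^ N. \<tau> (\<Phi> ?h \<odot> cell N j))" for N
  proof -
    have "\<Phi> (\<lambda>t. S t * G t) \<odot> \<Phi> f = \<Phi> ?h \<odot> (\<Sum>j = 1..2 ^ N. cell N j)"
      unfolding cell_sum_all by (simp add: Phi_mult bdd_borel_mult S FG f)
    then show ?thesis by (simp only: op_sum_right) (intro tau_sum M_mult Phi_M h cell_M)
  qed
  have beta: "beta b N A (B \<odot> \<Phi> f) = (\<Sum>j = 1..2 ^ N. \<tau> (\<Phi> (\<lambda>t. S (gridpt b N j) * G t * f t) \<odot> cell N j))" for N
    unfolding beta_def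
  proof (rule sum.cong[OF refl])
    fix j assume j: "j \<in> {1..2 ^ N::nat}"
    have c: "gridpt b N j \<in> {0..1}"
    proof -
      have "real j \<le> 2 ^ N" using j by (metis atLeastAtMost_iff numeral_power_eq_of_nat_cancel_iff of_nat_le_iff)
      then show ?thesis by (auto simp: gridpt_def field_simps)
    qed
    have sB: "side b (gridpt b N j) = \<Phi> (indicator (if b then {gridpt b N j..1} else {0..gridpt b N j}))"
      by (simp add: side_def iproj_def)
    have 1: "\<tau> (A \<odot> side b (gridpt b N j)) = S (gridpt b N j)"
      using A side[OF c] by (auto simp: dens_def sB indicator_BB split: if_splits)
    have "(B \<odot> \<Phi> f) \<odot> cell N j = B \<odot> \<Phi> (\<lambda>t. f t * indicator {real (j - 1) / 2 ^ N..real j / 2 ^ N} t)"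
      by (simp add: Phi_mult f indicator_BB op_assoc cell_def iproj_def)
    then have "\<tau> ((B \<odot> \<Phi> f) \<odot> cell N j) = \<tau> (\<Phi> G \<odot> \<Phi> (\<lambda>t. f t * indicator {real (j - 1) / 2 ^ N..real j / 2 ^ N} t))"
      using B bdd_borel_mult[OF f indicator_BB] by (simp add: dens_def)
    also have "\<dots> = \<tau> ((\<Phi> G \<odot> \<Phi> f) \<odot> cell N j)"
      by (simp add: Phi_mult f indicator_BB op_assoc cell_def iproj_def)
    finally have 2: "\<tau> ((B \<odot> \<Phi> f) \<odot> cell N j) = \<tau> ((\<Phi> G \<odot> \<Phi> f) \<odot> cell N j)" .
    have "\<Phi> (\<lambda>t. S (gridpt b N j) * G t * f t) = scalar_op (S (gridpt b N j)) \<odot> (\<Phi> G \<odot> \<Phi> f)"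
      using Phi_cmult[OF bdd_borel_mult[OF FG(2) f], of "S (gridpt b N j)"] by (simp add: Phi_mult FG f mult.assoc)
    then show "\<tau> (A \<odot> side b (gridpt b N j)) * \<tau> ((B \<odot> \<Phi> f) \<odot> cell N j)
        = \<tau> (\<Phi> (\<lambda>t. S (gridpt b N j) * G t * f t) \<odot> cell N j)"
      by (simp add: 1 2[unfolded op_assoc] op_assoc tau_scalar_mult M_mult Phi_M FG f cell_M)
  qed
  have est: "cmod (beta b N A (B \<odot> \<Phi> f) - \<tau> (\<Phi> (\<lambda>t. S t * G t) \<odot> \<Phi> f)) \<le> K * CG * Cf * (1 / 2 ^ N)" for N
  proof -
    have "beta b N A (B \<odot> \<Phi> f) - \<tau> (\<Phi> (\<lambda>t. S t * G t) \<odot> \<Phi> f)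
        = (\<Sum>j = 1..2 ^ N. \<tau> (\<Phi> (\<lambda>t. S (gridpt b N j) * G t * f t) \<odot> cell N j) - \<tau> (\<Phi> ?h \<odot> cell N j))"
      unfolding beta tot[of N] by (rule sum_subtractf[symmetric])
    also have "cmod \<dots> \<le> (\<Sum>j = 1..2 ^ N. (K * CG * Cf * (1 / 2 ^ N)) * Re (\<tau> (cell N j)))"
    proof (rule sum_norm_le)
      fix j assume j: "j \<in> {1..2 ^ N::nat}"
      let ?c = "gridpt b N j" and ?J = "{real (j - 1) / 2 ^ N..real j / 2 ^ N}"
      \<comment> \<open>The difference of the two terms on cell \<open>j\<close> is one function of
        \<open>D0\<close> supported in that cell, and its supremum is controlled by the Lipschitz
        bound.\<close>
      let ?g = "\<lambda>t. (S ?c - S t) * G t * f t * indicator ?J t"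
      have jN: "real j \<le> 2 ^ N" using j by (metis atLeastAtMost_iff numeral_power_eq_of_nat_cancel_iff of_nat_le_iff)
      have g: "?g \<in> BB" by (intro bdd_borel_mult bdd_borel_diff bdd_borel_const S FG f indicator_BB)
      have cst: "(\<lambda>t. S ?c * G t * f t) \<in> BB" by (intro bdd_borel_mult bdd_borel_const FG f)
      have "\<Phi> ?g = \<Phi> (\<lambda>t. (S ?c * G t * f t - ?h t) * indicator ?J t)"
        by (rule arg_cong[of _ _ \<Phi>]) (simp add: algebra_simps)
      also have "\<dots> = (\<Phi> (\<lambda>t. S ?c * G t * f t) - \<Phi> ?h) \<odot> cell N j"
        using Phi_mult[OF bdd_borel_diff[OF cst h] indicator_BB] Phi_diff[OF cst h]
        by (simp add: cell_def iproj_def)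
      finally have "\<Phi> ?g \<odot> cell N j = (\<Phi> (\<lambda>t. S ?c * G t * f t) - \<Phi> ?h) \<odot> cell N j"
        by (simp add: op_assoc cell_idem)
      then have e: "\<tau> (\<Phi> (\<lambda>t. S ?c * G t * f t) \<odot> cell N j) - \<tau> (\<Phi> ?h \<odot> cell N j) = \<tau> (\<Phi> ?g \<odot> cell N j)"
        by (simp add: op_diff_left tau_diff M_mult Phi_M cst h cell_M)
      have "cmod (\<tau> (\<Phi> ?g \<odot> cell N j)) \<le> norm (\<Phi> ?g) * Re (\<tau> (cell N j))"
        unfolding cell_def by (rule tau_iproj_le) (rule Phi_M[OF g])
      also have "\<dots> \<le> (K * CG * Cf * (1 / 2 ^ N)) * Re (\<tau> (cell N j))"
      proof (rule mult_right_mono)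
        show "norm (\<Phi> ?g) \<le> K * CG * Cf * (1 / 2 ^ N)"
        proof (rule Phi_norm_le[OF g])
          show "0 \<le> K * CG * Cf * (1 / 2 ^ N)" using K CG Cf by simp
          fix t assume t: "t \<in> {- norm D0..norm D0}"
          show "cmod (?g t) \<le> K * CG * Cf * (1 / 2 ^ N)"
          proof (cases "t \<in> ?J")
            case True
            have d: "real j / 2 ^ N - real (j - 1) / 2 ^ N = 1 / 2 ^ N"
              using j by (simp add: diff_divide_distrib[symmetric] of_nat_diff)
            have t01: "t \<in> {0..1}"
            proof -
              have "real j / 2 ^ N \<le> 1" using jN by simp
              moreover have "0 \<le> real (j - 1) / 2 ^ N" by simp
              moreover have "real (j - 1) / 2 ^ N \<le> t" "t \<le> real j / 2 ^ N" using True by auto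
              ultimately show ?thesis unfolding atLeastAtMost_iff by (intro conjI) linarith+
            qed
            have c01: "?c \<in> {0..1}" using jN by (auto simp: gridpt_def field_simps)
            have "\<bar>?c - t\<bar> \<le> 1 / 2 ^ N" using True d by (auto simp: gridpt_def abs_le_iff)
            then have "K * \<bar>?c - t\<bar> \<le> K * (1 / 2 ^ N)" using K by (rule mult_left_mono)
            then have "cmod (S ?c - S t) \<le> K * (1 / 2 ^ N)" using lip[OF c01 t01] by linarith
            then have "cmod (S ?c - S t) * cmod (G t) * cmod (f t) \<le> (K * (1 / 2 ^ N)) * CG * Cf"
              using K CG Cf t by (intro mult_mono) auto
            then show ?thesis using True by (simp add: norm_mult mult_ac)
          qed (use K CG Cf in simp)
        qed
      qed (simp add: cell_def tau_iproj_nonneg)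
      finally show "cmod (\<tau> (\<Phi> (\<lambda>t. S ?c * G t * f t) \<odot> cell N j) - \<tau> (\<Phi> ?h \<odot> cell N j))
          \<le> (K * CG * Cf * (1 / 2 ^ N)) * Re (\<tau> (cell N j))" unfolding e .
    qed
    also have "\<dots> = K * CG * Cf * (1 / 2 ^ N)"
      by (simp only: sum_distrib_left[symmetric] cell_trace_sum mult_1_right)
    finally show ?thesis .
  qed
  have "(\<lambda>N. (1 / 2) ^ N :: real) \<longlonglongrightarrow> 0" by (rule LIMSEQ_power_zero) simp
  then have "(\<lambda>N. 1 / 2 ^ N :: real) \<longlonglongrightarrow> 0" by (simp add: power_one_over)
  from tendsto_mult_right_zero[OF this, of "K * CG * Cf"]
  have "(\<lambda>N. beta b N A (B \<odot> \<Phi> f) - \<tau> (\<Phi> (\<lambda>t. S t * G t) \<odot> \<Phi> f)) \<longlonglongrightarrow> 0"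
    by (rule Lim_null_comparison[OF always_eventually, rotated]) (use est in blast)
  then show ?thesis by (simp add: LIM_zero_iff)
qed

end

section \<open>Derivatives of the approximants\<close>

context dt_pair
begin

definition derivation :: "'h op \<Rightarrow> (('h op \<Rightarrow> complex) \<Rightarrow> ('h op \<Rightarrow> complex) \<Rightarrow> complex) \<Rightarrow> bool" where
  "derivation A \<phi> \<longleftrightarrow> (\<exists>L. der A L \<and> (\<forall>G H. (\<Sum>(P, Q)\<leftarrow>L. G P * H Q) = \<phi> G H))"

lemma derivation_Phi: "f \<in> BB \<Longrightarrow> derivation (\<Phi> f) (\<lambda>G H. 0)"
  unfolding derivation_def by (intro exI[of _ "[]"]) (simp add: der_Phi)

lemma derivation_X: "derivation X (\<lambda>G H. G id_blinfun * H id_blinfun)"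
  unfolding derivation_def by (intro exI[of _ "[(id_blinfun, id_blinfun)]"]) (simp add: der_X)

lemma derivation_add: "derivation A \<phi> \<Longrightarrow> derivation B \<psi> \<Longrightarrow> derivation (A + B) (\<lambda>G H. \<phi> G H + \<psi> G H)"
  unfolding derivation_def
proof (elim exE conjE)
  fix L K assume "der A L" "\<forall>G H. (\<Sum>(P, Q)\<leftarrow>L. G P * H Q) = \<phi> G H"
    "der B K" "\<forall>G H. (\<Sum>(P, Q)\<leftarrow>K. G P * H Q) = \<psi> G H"
  then show "\<exists>L. der (A + B) L \<and> (\<forall>G H. (\<Sum>(P, Q)\<leftarrow>L. G P * H Q) = \<phi> G H + \<psi> G H)"
    by (intro exI[of _ "L @ K"]) (simp add: der_add)
qed

lemma derivation_mult:
  "derivation A \<phi> \<Longrightarrow> derivation B \<psi> \<Longrightarrow>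
    derivation (A \<odot> B) (\<lambda>G H. \<phi> G (\<lambda>Q. H (Q \<odot> B)) + \<psi> (\<lambda>P. G (A \<odot> P)) H)"
  unfolding derivation_def
proof (elim exE conjE)
  fix L K assume L: "der A L" "\<forall>G H. (\<Sum>(P, Q)\<leftarrow>L. G P * H Q) = \<phi> G H"
    and K: "der B K" "\<forall>G H. (\<Sum>(P, Q)\<leftarrow>K. G P * H Q) = \<psi> G H"
  show "\<exists>L. der (A \<odot> B) L \<and> (\<forall>G H. (\<Sum>(P, Q)\<leftarrow>L. G P * H Q)
      = \<phi> G (\<lambda>Q. H (Q \<odot> B)) + \<psi> (\<lambda>P. G (A \<odot> P)) H)"
    unfolding L(2)[rule_format, symmetric] K(2)[rule_format, symmetric]
    by (intro exI[of _ "map (\<lambda>(P, Q). (P, Q \<odot> B)) L @ map (\<lambda>(P, Q). (A \<odot> P, Q)) K"] conjI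
        der_mult[OF L(1) K(1)]) (simp add: comp_def case_prod_unfold)
qed

lemma derivation_cong: "derivation A \<phi> \<Longrightarrow> A = B \<Longrightarrow> (\<And>G H. \<phi> G H = \<psi> G H) \<Longrightarrow> derivation B \<psi>"
  unfolding derivation_def by auto

lemma derivation_zero: "derivation 0 (\<lambda>G H. 0)"
  using derivation_Phi[OF bdd_borel_const, of 0] by (simp add: Phi_const scalar_zero)

lemma derivation_sum:
  assumes "finite J" "\<And>j. j \<in> J \<Longrightarrow> derivation (A j) (\<phi> j)"
  shows "derivation (\<Sum>j\<in>J. A j) (\<lambda>G H. \<Sum>j\<in>J. \<phi> j G H)"
  using assms
proof (induction J rule: finite_induct)
  case (insert j J)
  show ?case
    by (rule derivation_cong[OF derivation_add[of "A j" "\<phi> j" "\<Sum>j\<in>J. A j" "\<lambda>G H. \<Sum>j\<in>J. \<phi> j G H"]])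
      (use insert in auto)
qed (simp add: derivation_zero)

lemma Schwinger_Dyson_derivation: "derivation A \<phi> \<Longrightarrow> \<tau> (X \<odot> A) = \<phi> \<tau> \<tau>"
  unfolding derivation_def using Schwinger_Dyson by force

lemma derivation_cell_X_cell: "derivation (cell N j \<odot> (X \<odot> cell N k)) (\<lambda>G H. G (cell N j) * H (cell N k))"
proof -
  have p: "derivation (cell N i) (\<lambda>G H. 0)" for i
    unfolding cell_def iproj_def by (rule derivation_Phi[OF indicator_BB])
  show ?thesis
    by (rule derivation_cong[OF derivation_mult[OF p derivation_mult[OF derivation_X p]]]) simp_all
qed

definition TN :: "bool \<Rightarrow> nat \<Rightarrow> 'h op" where
  "TN b N = (\<Sum>j = 1..2 ^ N. \<Sum>k = 1..2 ^ N. if rel b j k then cell N j \<odot> (X \<odot> cell N k) else 0)"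

lemma derivation_TN:
  "derivation (TN b N) (\<lambda>G H. \<Sum>j = 1..2 ^ N. \<Sum>k = 1..2 ^ N. if rel b j k then G (cell N j) * H (cell N k) else 0)"
  unfolding TN_def
proof (intro derivation_sum finite_atLeastAtMost)
  show "derivation (if rel b j k then cell N j \<odot> (X \<odot> cell N k) else 0)
     (\<lambda>G H. if rel b j k then G (cell N j) * H (cell N k) else 0)" for j k
    by (cases "rel b j k") (simp_all add: derivation_cell_X_cell derivation_zero)
qed

text \<open>Cutting the right-hand projection of \<open>DT_approx\<close> into cells puts both sides
  of \<open>X\<close> on one grid, where the orthogonality of cells can act and the adjoint just
  reverses the order.\<close>

lemma TN_True: "TN True N = DT_approx \<Phi> X N"
  unfolding TN_def DT_approx_def
proof (rule sum.cong[OF refl])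
  fix j assume j: "j \<in> {1..2 ^ N::nat}"
  have "(\<Sum>k = 1..2 ^ N. if rel True j k then cell N j \<odot> (X \<odot> cell N k) else 0)
      = (cell N j \<odot> X) \<odot> (\<Sum>k = 1..2 ^ N. if rel True j k then cell N k else 0)"
    unfolding op_sum_right by (rule sum.cong) (auto simp: op_assoc)
  also have "\<dots> = (cell N j \<odot> X) \<odot> side True (gridpt True N j)" by (simp only: rel_sum[OF j])
  also have "\<dots> = (\<Phi> (indicator {(real j - 1) / 2 ^ N..real j / 2 ^ N}) \<odot> X)
      \<odot> \<Phi> (indicator {real j / 2 ^ N..1})"
    using j by (simp add: cell_def iproj_def side_def gridpt_def of_nat_diff)
  finally show "(\<Sum>k = 1..2 ^ N. if rel True j k then cell N j \<odot> (X \<odot> cell N k) else 0)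
      = (\<Phi> (indicator {(real j - 1) / 2 ^ N..real j / 2 ^ N}) \<odot> X) \<odot> \<Phi> (indicator {real j / 2 ^ N..1})" .
qed

lemma TN_M: "TN b N \<in> M"
  unfolding TN_def by (intro M_sum) (auto intro: M_intros cell_M X_M)

lemma adj_sum:
  "(\<And>i. i \<in> I \<Longrightarrow> f i \<in> M) \<Longrightarrow> adj (\<Sum>i\<in>I. f i) = (\<Sum>i\<in>I. adj (f i))"
proof (induction I rule: infinite_finite_induct)
  case (insert x F)
  then show ?case by (simp add: adj_add M_clinear M_sum)
qed (simp_all add: adj_zero)

lemma TN_False: "TN False N = adj (TN True N)"
proof -
  have "adj (TN True N) = (\<Sum>j = 1..2 ^ N. \<Sum>k = 1..2 ^ N. adj (if rel True j k then cell N j \<odot> (X \<odot> cell N k) else 0))"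
    unfolding TN_def by (subst adj_sum, intro M_sum, auto intro!: M_intros cell_M X_M sum.cong adj_sum)
  also have "\<dots> = (\<Sum>j = 1..2 ^ N. \<Sum>k = 1..2 ^ N. if rel False k j then cell N k \<odot> (X \<odot> cell N j) else 0)"
    by (intro sum.cong refl)
      (simp add: rel_def adj_zero adj_mult M_clinear M_mult cell_M X_M cell_adj adj_selfadjoint[OF X_sa] op_assoc)
  also have "\<dots> = TN False N" unfolding TN_def by (rule sum.swap)
  finally show ?thesis by simp
qed

lemma tau_cell_cell:
  assumes "A \<in> M" shows "\<tau> (cell N k \<odot> (A \<odot> cell N m)) = (if m = k then \<tau> (A \<odot> cell N k) else 0)"
proof -
  have "\<tau> (cell N k \<odot> (A \<odot> cell N m)) = \<tau> (A \<odot> (cell N m \<odot> cell N k))"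
    using assms by (simp add: tau_commute[of "cell N k"] M_mult cell_M op_assoc)
  then show ?thesis by (auto simp: cell_idem cell_orthogonal tau_zero)
qed

end

section \<open>Words in the shifted operator and their limits\<close>

locale dt_operator = dt_pair M \<tau> D0 \<Phi> X
  for M :: "('h::complex_hilbert) op set" and \<tau> :: "'h op \<Rightarrow> complex"
    and D0 :: "'h op" and \<Phi> :: "(real \<Rightarrow> complex) \<Rightarrow> 'h op" and X :: "'h op" +
  fixes T :: "'h op" and l :: complex
  assumes T_lim: "DT_approx \<Phi> X \<longlonglongrightarrow> T"
begin

definition lam :: "bool \<Rightarrow> complex" where
  "lam b = (if b then l else cnj l)"

definition tb :: "bool \<Rightarrow> 'h op" where
  "tb b = (if b then T else adj T)"

definition aN :: "nat \<Rightarrow> bool \<Rightarrow> 'h op" where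
  "aN N b = TN b N + scalar_op (- lam b)"

definition a :: "bool \<Rightarrow> 'h op" where
  "a b = tb b + scalar_op (- lam b)"

definition WN :: "nat \<Rightarrow> bool list \<Rightarrow> 'h op" where
  "WN N w = op_prod (map (aN N) w)"

definition W :: "bool list \<Rightarrow> 'h op" where
  "W w = op_prod (map a w)"

lemma WN_simps [simp]: "WN N [] = id_blinfun" "WN N (b # w) = aN N b \<odot> WN N w"
  by (simp_all add: WN_def)

lemma W_simps [simp]: "W [] = id_blinfun" "W (b # w) = a b \<odot> W w"
  by (simp_all add: W_def)

lemma TN_True_lim: "TN True \<longlonglongrightarrow> T"
  using T_lim by (simp add: TN_True[abs_def])

lemma T_M: "T \<in> M"
  by (rule M_limit[OF TN_M TN_True_lim])

lemma TN_lim: "TN b \<longlonglongrightarrow> tb b"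
proof (cases b)
  case False
  have "(\<lambda>N. norm (TN True N - T)) \<longlonglongrightarrow> 0"
    using TN_True_lim by (simp add: LIM_zero_iff tendsto_norm_zero_iff)
  moreover have "norm (TN False N - adj T) \<le> norm (TN True N - T)" for N
    using norm_adj_le[OF M_clinear[OF M_diff[OF TN_M[of True N] T_M]]]
    by (simp add: TN_False adj_diff M_clinear TN_M T_M)
  ultimately have "(\<lambda>N. TN False N - adj T) \<longlonglongrightarrow> 0"
    by (metis (no_types, lifting) Lim_null_comparison always_eventually)
  then show ?thesis using False by (simp add: tb_def LIM_zero_iff)
qed (simp add: tb_def TN_True_lim)

lemma tb_M: "tb b \<in> M"
  by (simp add: tb_def T_M M_adj)

lemma aN_M: "aN N b \<in> M"
  by (simp add: aN_def M_intros TN_M)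

lemma a_M: "a b \<in> M"
  by (simp add: a_def M_intros tb_M)

lemma aN_lim: "(\<lambda>N. aN N b) \<longlonglongrightarrow> a b"
  unfolding aN_def a_def by (intro tendsto_add TN_lim tendsto_const)

lemma WN_M: "WN N w \<in> M"
  by (induction w) (auto intro: M_intros aN_M)

lemma W_M: "W w \<in> M"
  by (induction w) (auto intro: M_intros a_M)

lemma WN_lim: "(\<lambda>N. WN N w) \<longlonglongrightarrow> W w"
  by (induction w) (auto intro: tendsto_op_mult aN_lim)

lemma derivation_WN:
  "derivation (WN N w) (\<lambda>G H. \<Sum>i<length w. \<Sum>j = 1..2 ^ N. \<Sum>k = 1..2 ^ N.
     if rel (w ! i) j k then G (WN N (take i w) \<odot> cell N j) * H (cell N k \<odot> WN N (drop (Suc i) w)) else 0)"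
proof (induction w)
  case Nil
  show ?case using derivation_Phi[OF bdd_borel_const, of 1] by (simp add: Phi_one)
next
  case (Cons b w)
  have "derivation (aN N b) (\<lambda>G H. (\<Sum>j = 1..2 ^ N. \<Sum>k = 1..2 ^ N. if rel b j k then G (cell N j) * H (cell N k) else 0) + 0)"
    unfolding aN_def using derivation_add[OF derivation_TN derivation_Phi[OF bdd_borel_const, of "- lam b"]]
    by (simp add: Phi_const)
  from derivation_mult[OF this Cons]
  show ?case
    by (rule derivation_cong)
      (simp_all add: sum.lessThan_Suc_shift op_assoc del: sum.lessThan_Suc cong: if_cong)
qed

text \<open>Cyclicity brings the \<open>X\<close> of the first letter to the front, and the
  Schwinger-Dyson equation pairs it with each \<open>X\<close> of \<open>w\<close>. Cell
  orthogonality and the order of the cells then select the opposite letters.\<close>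

lemma tau_TN_WN:
  assumes f: "f \<in> BB"
  shows "\<tau> ((TN b N \<odot> WN N w) \<odot> \<Phi> f) = (\<Sum>i<length w. if w ! i = (\<not> b)
    then beta b N (WN N (take i w)) (WN N (drop (Suc i) w) \<odot> \<Phi> f) else 0)"
proof -
  let ?A = "{1..2 ^ N::nat}"
  let ?W1 = "\<lambda>i. WN N (take i w)" and ?W2 = "\<lambda>i. WN N (drop (Suc i) w)"
  note M = M_mult cell_M X_M WN_M Phi_M[OF f]
  have summand: "\<tau> (((cell N j \<odot> (X \<odot> cell N k)) \<odot> WN N w) \<odot> \<Phi> f)
      = (\<Sum>i<length w. if rel (w ! i) k j then \<tau> (?W1 i \<odot> cell N k) * \<tau> ((?W2 i \<odot> \<Phi> f) \<odot> cell N j) else 0)"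
    if jk: "j \<in> ?A" "k \<in> ?A" for j k
  proof -
    have "derivation (cell N k) (\<lambda>G H. 0)" "derivation (\<Phi> f \<odot> cell N j) (\<lambda>G H. 0)"
      unfolding cell_def iproj_def Phi_mult[OF f indicator_BB, symmetric]
      by (intro derivation_Phi bdd_borel_mult f indicator_BB)+
    from derivation_mult[OF this(1) derivation_mult[OF derivation_WN[of N w] this(2)]]
    have "\<tau> (X \<odot> (cell N k \<odot> (WN N w \<odot> (\<Phi> f \<odot> cell N j)))) = (\<Sum>i<length w. \<Sum>m\<in>?A. \<Sum>n\<in>?A.
        if rel (w ! i) m n then \<tau> (cell N k \<odot> (?W1 i \<odot> cell N m)) * \<tau> ((cell N n \<odot> ?W2 i) \<odot> (\<Phi> f \<odot> cell N j)) else 0)"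
      by (rule Schwinger_Dyson_derivation[THEN trans]) simp
    \<comment> \<open>The outer projections \<open>cell N k\<close> and \<open>cell N j\<close>
      force the cells of the contracted letter to be the same two, in reversed order.\<close>
    also have "\<dots> = (\<Sum>i<length w. \<Sum>m\<in>?A. \<Sum>n\<in>?A.
        if m = k \<and> n = j then (if rel (w ! i) k j then \<tau> (?W1 i \<odot> cell N k) * \<tau> ((?W2 i \<odot> \<Phi> f) \<odot> cell N j) else 0) else 0)"
    proof (intro sum.cong refl)
      fix i m n
      have "\<tau> (cell N k \<odot> (?W1 i \<odot> cell N m)) = (if m = k then \<tau> (?W1 i \<odot> cell N k) else 0)"
        by (rule tau_cell_cell[OF WN_M])
      moreover have "\<tau> ((cell N n \<odot> ?W2 i) \<odot> (\<Phi> f \<odot> cell N j)) = (if n = j then \<tau> ((?W2 i \<odot> \<Phi> f) \<odot> cell N j) else 0)"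
        using tau_cell_cell[OF M_mult[OF WN_M[of N "drop (Suc i) w"] Phi_M[OF f]], where N = N and k = n and m = j] by (auto simp: op_assoc)
      ultimately show "(if rel (w ! i) m n then \<tau> (cell N k \<odot> (?W1 i \<odot> cell N m)) * \<tau> ((cell N n \<odot> ?W2 i) \<odot> (\<Phi> f \<odot> cell N j)) else 0)
        = (if m = k \<and> n = j then (if rel (w ! i) k j then \<tau> (?W1 i \<odot> cell N k) * \<tau> ((?W2 i \<odot> \<Phi> f) \<odot> cell N j) else 0) else 0)"
        by auto
    qed
    also have "\<dots> = (\<Sum>i<length w. if rel (w ! i) k j then \<tau> (?W1 i \<odot> cell N k) * \<tau> ((?W2 i \<odot> \<Phi> f) \<odot> cell N j) else 0)"
    proof (rule sum.cong[OF refl])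
      fix i
      let ?c = "if rel (w ! i) k j then \<tau> (?W1 i \<odot> cell N k) * \<tau> ((?W2 i \<odot> \<Phi> f) \<odot> cell N j) else 0"
      have "(\<Sum>m\<in>?A. \<Sum>n\<in>?A. if m = k \<and> n = j then ?c else 0) = (\<Sum>m\<in>?A. if m = k then ?c else 0)"
        using jk by (intro sum.cong refl) (simp add: sum.delta)
      also have "\<dots> = ?c" using jk by (subst sum.delta) auto
      finally show "(\<Sum>m\<in>?A. \<Sum>n\<in>?A. if m = k \<and> n = j then ?c else 0) = ?c" .
    qed
    finally have 1: "\<tau> (X \<odot> (cell N k \<odot> (WN N w \<odot> (\<Phi> f \<odot> cell N j))))
      = (\<Sum>i<length w. if rel (w ! i) k j then \<tau> (?W1 i \<odot> cell N k) * \<tau> ((?W2 i \<odot> \<Phi> f) \<odot> cell N j) else 0)" .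
    have "((cell N j \<odot> (X \<odot> cell N k)) \<odot> WN N w) \<odot> \<Phi> f = cell N j \<odot> (X \<odot> (cell N k \<odot> (WN N w \<odot> \<Phi> f)))"
      by (simp only: op_assoc)
    then have "\<tau> (((cell N j \<odot> (X \<odot> cell N k)) \<odot> WN N w) \<odot> \<Phi> f) = \<tau> ((X \<odot> (cell N k \<odot> (WN N w \<odot> \<Phi> f))) \<odot> cell N j)"
      using tau_commute[of "cell N j" "X \<odot> (cell N k \<odot> (WN N w \<odot> \<Phi> f))"] by (simp add: M)
    also have "(X \<odot> (cell N k \<odot> (WN N w \<odot> \<Phi> f))) \<odot> cell N j = X \<odot> (cell N k \<odot> (WN N w \<odot> (\<Phi> f \<odot> cell N j)))"
      by (simp only: op_assoc)
    finally show ?thesis using 1 by simp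
  qed
  have inM: "(if rel b j k then ((cell N j \<odot> (X \<odot> cell N k)) \<odot> WN N w) \<odot> \<Phi> f else 0) \<in> M" for j k
    by (simp add: M M_zero)
  have "(TN b N \<odot> WN N w) \<odot> \<Phi> f = (\<Sum>j\<in>?A. \<Sum>k\<in>?A. if rel b j k then ((cell N j \<odot> (X \<odot> cell N k)) \<odot> WN N w) \<odot> \<Phi> f else 0)"
    unfolding TN_def op_sum_left by (intro sum.cong refl) simp
  then have "\<tau> ((TN b N \<odot> WN N w) \<odot> \<Phi> f)
      = (\<Sum>j\<in>?A. \<tau> (\<Sum>k\<in>?A. if rel b j k then ((cell N j \<odot> (X \<odot> cell N k)) \<odot> WN N w) \<odot> \<Phi> f else 0))"
    by (simp only:) (intro tau_sum M_sum inM)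
  also have "\<dots> = (\<Sum>j\<in>?A. \<Sum>k\<in>?A. \<tau> (if rel b j k then ((cell N j \<odot> (X \<odot> cell N k)) \<odot> WN N w) \<odot> \<Phi> f else 0))"
    by (intro sum.cong refl tau_sum inM)
  also have "\<dots> = (\<Sum>j\<in>?A. \<Sum>k\<in>?A. if rel b j k then \<tau> (((cell N j \<odot> (X \<odot> cell N k)) \<odot> WN N w) \<odot> \<Phi> f) else 0)"
    by (simp only: if_distrib[of \<tau>] tau_zero)
  also have "\<dots> = (\<Sum>j\<in>?A. \<Sum>k\<in>?A. \<Sum>i<length w. if w ! i = (\<not> b) then
      (if rel b j k then \<tau> (?W1 i \<odot> cell N k) else 0) * \<tau> ((?W2 i \<odot> \<Phi> f) \<odot> cell N j) else 0)"
  proof (intro sum.cong refl)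
    fix j k assume jk: "j \<in> ?A" "k \<in> ?A"
    \<comment> \<open>Reversing the pair of cells reverses the relation; hence a letter is never
      contracted with another copy of itself.\<close>
    have r: "rel b j k \<Longrightarrow> rel c k j \<longleftrightarrow> c = (\<not> b)" for c by (auto simp: rel_def split: if_splits)
    show "(if rel b j k then \<tau> (((cell N j \<odot> (X \<odot> cell N k)) \<odot> WN N w) \<odot> \<Phi> f) else 0)
       = (\<Sum>i<length w. if w ! i = (\<not> b) then
          (if rel b j k then \<tau> (?W1 i \<odot> cell N k) else 0) * \<tau> ((?W2 i \<odot> \<Phi> f) \<odot> cell N j) else 0)"
      unfolding summand[OF jk] by (cases "rel b j k") (simp_all add: r cong: if_cong)
  qed
  also have "\<dots> = (\<Sum>i<length w. \<Sum>j\<in>?A. \<Sum>k\<in>?A. if w ! i = (\<not> b) then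
      (if rel b j k then \<tau> (?W1 i \<odot> cell N k) else 0) * \<tau> ((?W2 i \<odot> \<Phi> f) \<odot> cell N j) else 0)"
    by (rule trans[OF sum.cong[OF refl sum.swap] sum.swap])
  also have "\<dots> = (\<Sum>i<length w. if w ! i = (\<not> b) then beta b N (?W1 i) (?W2 i \<odot> \<Phi> f) else 0)"
  proof (rule sum.cong[OF refl])
    fix i
    have "(\<Sum>k\<in>?A. if rel b j k then \<tau> (?W1 i \<odot> cell N k) else 0) = \<tau> (?W1 i \<odot> side b (gridpt b N j))"
      if j: "j \<in> ?A" for j
    proof -
      have "\<tau> (?W1 i \<odot> side b (gridpt b N j)) = \<tau> (\<Sum>k\<in>?A. ?W1 i \<odot> (if rel b j k then cell N k else 0))"
        by (simp only: rel_sum[OF j, symmetric] op_sum_right)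
      also have "\<dots> = (\<Sum>k\<in>?A. \<tau> (?W1 i \<odot> (if rel b j k then cell N k else 0)))"
        by (rule tau_sum) (auto simp: M M_zero)
      also have "\<dots> = (\<Sum>k\<in>?A. if rel b j k then \<tau> (?W1 i \<odot> cell N k) else 0)"
        by (intro sum.cong) (auto simp: tau_zero)
      finally show ?thesis by simp
    qed
    then show "(\<Sum>j\<in>?A. \<Sum>k\<in>?A. if w ! i = (\<not> b) then
        (if rel b j k then \<tau> (?W1 i \<odot> cell N k) else 0) * \<tau> ((?W2 i \<odot> \<Phi> f) \<odot> cell N j) else 0)
      = (if w ! i = (\<not> b) then beta b N (?W1 i) (?W2 i \<odot> \<Phi> f) else 0)"
      unfolding beta_def by (auto simp: sum_distrib_right[symmetric] intro!: sum.cong)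
  qed
  finally show ?thesis .
qed

text \<open>The covariance of the DT-operator: only pairs \<open>T \<dots> T\<^sup>*\<close> and \<open>T\<^sup>* \<dots> T\<close> contribute, and the inner
  word enters through the integral of its density over \<open>[x,1]\<close> or \<open>[0,x]\<close>.\<close>
lemma dens_tb_W:
  assumes F: "\<And>i. i < length w \<Longrightarrow> w ! i = (\<not> b) \<Longrightarrow> dens (W (take i w)) (F i)"
    and G: "\<And>i. i < length w \<Longrightarrow> w ! i = (\<not> b) \<Longrightarrow> dens (W (drop (Suc i) w)) (G i)"
    and S: "\<And>i. i < length w \<Longrightarrow> w ! i = (\<not> b) \<Longrightarrow> S i \<in> BB"
    and side: "\<And>i c. i < length w \<Longrightarrow> w ! i = (\<not> b) \<Longrightarrow> c \<in> {0..1} \<Longrightarrow> \<tau> (\<Phi> (F i) \<odot> side b c) = S i c"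
    and lip: "\<And>i x y. i < length w \<Longrightarrow> w ! i = (\<not> b) \<Longrightarrow> x \<in> {0..1} \<Longrightarrow> y \<in> {0..1} \<Longrightarrow>
      cmod (S i x - S i y) \<le> K i * \<bar>x - y\<bar>"
  shows "dens (tb b \<odot> W w) (\<lambda>t. \<Sum>i<length w. if w ! i = (\<not> b) then S i t * G i t else 0)"
proof -
  have GB: "G i \<in> BB" if "i < length w" "w ! i = (\<not> b)" for i using G[OF that] by (simp add: dens_def)
  have part: "(\<lambda>t. if w ! i = (\<not> b) then S i t * G i t else 0) \<in> BB" if "i < length w" for i
    using S[OF that] GB[OF that] by (cases "w ! i = (\<not> b)") (auto intro: bdd_borel_mult bdd_borel_const)
  have BB: "(\<lambda>t. \<Sum>i<length w. if w ! i = (\<not> b) then S i t * G i t else 0) \<in> BB"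
    using part by (intro bdd_borel_sum) auto
  show ?thesis unfolding dens_def
  proof (intro conjI ballI BB)
    fix f assume f: "f \<in> BB"
    have "(\<lambda>N. \<tau> ((TN b N \<odot> WN N w) \<odot> \<Phi> f)) \<longlonglongrightarrow> \<tau> ((tb b \<odot> W w) \<odot> \<Phi> f)"
      by (intro tau_tendsto tendsto_op_mult TN_lim WN_lim tendsto_const M_mult TN_M WN_M Phi_M f)
    moreover have "(\<lambda>N. \<tau> ((TN b N \<odot> WN N w) \<odot> \<Phi> f)) \<longlonglongrightarrow>
        (\<Sum>i<length w. if w ! i = (\<not> b) then \<tau> (\<Phi> (\<lambda>t. S i t * G i t) \<odot> \<Phi> f) else 0)"
      unfolding tau_TN_WN[OF f]
    proof (intro tendsto_sum)
      fix i assume "i \<in> {..<length w}"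
      then have i: "i < length w" by simp
      show "(\<lambda>N. if w ! i = (\<not> b) then beta b N (WN N (take i w)) (WN N (drop (Suc i) w) \<odot> \<Phi> f) else 0)
          \<longlonglongrightarrow> (if w ! i = (\<not> b) then \<tau> (\<Phi> (\<lambda>t. S i t * G i t) \<odot> \<Phi> f) else 0)"
      proof (cases "w ! i = (\<not> b)")
        case True
        \<comment> \<open>The limit is computed for the limiting words; \<open>beta_tendsto\<close>
          then lets the words vary with \<open>N\<close>.\<close>
        have "(\<lambda>N. beta b N (W (take i w)) (W (drop (Suc i) w) \<odot> \<Phi> f)) \<longlonglongrightarrow> \<tau> (\<Phi> (\<lambda>t. S i t * G i t) \<odot> \<Phi> f)"
          by (rule beta_dens_tendsto[OF F[OF i True] G[OF i True] f S[OF i True] side[OF i True] lip[OF i True]])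
        then have "(\<lambda>N. beta b N (WN N (take i w)) (WN N (drop (Suc i) w) \<odot> \<Phi> f)) \<longlonglongrightarrow> \<tau> (\<Phi> (\<lambda>t. S i t * G i t) \<odot> \<Phi> f)"
          by (rule beta_tendsto[rotated 4])
            (intro WN_M WN_lim M_mult tendsto_op_mult tendsto_const Phi_M f)+
        then show ?thesis using True by simp
      qed simp
    qed
    ultimately have "\<tau> ((tb b \<odot> W w) \<odot> \<Phi> f) =
        (\<Sum>i<length w. if w ! i = (\<not> b) then \<tau> (\<Phi> (\<lambda>t. S i t * G i t) \<odot> \<Phi> f) else 0)"
      by (rule LIMSEQ_unique)
    also have "\<dots> = (\<Sum>i<length w. \<tau> (\<Phi> (\<lambda>t. if w ! i = (\<not> b) then S i t * G i t else 0) \<odot> \<Phi> f))"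
      by (intro sum.cong) (auto simp: Phi_const scalar_zero tau_zero)
    also have "\<dots> = \<tau> (\<Phi> (\<lambda>t. \<Sum>i<length w. if w ! i = (\<not> b) then S i t * G i t else 0) \<odot> \<Phi> f)"
    proof -
      have "\<Phi> (\<lambda>t. \<Sum>i\<in>I. g i t) = (\<Sum>i\<in>I. \<Phi> (g i))" if "finite I" "\<And>i. i \<in> I \<Longrightarrow> g i \<in> BB" for I :: "nat set" and g
        using that
      proof (induction I rule: finite_induct)
        case (insert x I)
        then show ?case by (simp add: Phi_add bdd_borel_sum)
      qed (simp add: Phi_const scalar_zero)
      from this[of "{..<length w}"] have "\<Phi> (\<lambda>t. \<Sum>i<length w. if w ! i = (\<not> b) then S i t * G i t else 0)
          = (\<Sum>i<length w. \<Phi> (\<lambda>t. if w ! i = (\<not> b) then S i t * G i t else 0))"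
        using part by simp
      then show ?thesis
        using part by (simp only: op_sum_left) (rule tau_sum[symmetric], auto intro: M_mult Phi_M f)
    qed
    finally show "\<tau> ((tb b \<odot> W w) \<odot> \<Phi> f)
        = \<tau> (\<Phi> (\<lambda>t. \<Sum>i<length w. if w ! i = (\<not> b) then S i t * G i t else 0) \<odot> \<Phi> f)" .
  qed
qed

lemma dens_W_Cons:
  assumes "dens (tb b \<odot> W w) F" "dens (W w) G"
  shows "dens (W (b # w)) (\<lambda>t. F t + - lam b * G t)"
proof -
  have "W (b # w) = tb b \<odot> W w + scalar_op (- lam b) \<odot> W w" by (simp add: a_def op_add_left)
  moreover have "dens (tb b \<odot> W w + scalar_op (- lam b) \<odot> W w) (\<lambda>t. F t + - lam b * G t)"
    by (intro dens_add dens_scalar_mult assms M_mult M_scalar tb_M W_M)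
  ultimately show ?thesis by (simp only:)
qed

end

unbundle no vec_syntax
unbundle fps_syntax

section \<open>The generating function of the polynomials\<close>

text \<open>\<open>kappa c\<close> is the power series \<open>\<kappa>(s)\<close> with \<open>\<kappa> = s (1 + c \<kappa>) e\<^sup>\<kappa>\<close>; the generating function of
  the polynomials is \<open>\<Sum> Q\<^sub>n(x) s\<^sup>n = (1 + c \<kappa>) e\<^bsup>\<kappa> x\<^esup>\<close>.\<close>

definition kappa :: "real \<Rightarrow> real fps" where
  "kappa c = fps_inv (fps_X * inverse (fps_exp 1 * (1 + fps_const c * fps_X)))"

definition exp_kappa :: "real \<Rightarrow> real \<Rightarrow> real fps" where
  "exp_kappa c x = fps_exp x oo kappa c"

definition gen_fun :: "real \<Rightarrow> real \<Rightarrow> real fps" where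
  "gen_fun c x = (1 + fps_const c * kappa c) * exp_kappa c x"

lemma kappa_0: "kappa c $ 0 = 0"
  by (simp add: kappa_def fps_inv_def)

lemma exp_kappa_add: "exp_kappa c (x + y) = exp_kappa c x * exp_kappa c y"
  by (simp add: exp_kappa_def fps_exp_add_mult fps_compose_mult_distrib kappa_0)

lemma exp_kappa_0: "exp_kappa c 0 = 1"
  by (simp add: exp_kappa_def)

lemma kappa_eq: "kappa c = fps_X * gen_fun c 1"
proof -
  let ?d = "fps_exp 1 * (1 + fps_const c * fps_X) :: real fps"
  let ?a = "fps_X * inverse ?d"
  have d0: "?d $ 0 = 1" by simp
  have a0: "?a $ 0 = 0" and a1: "?a $ 1 \<noteq> 0" by (simp_all add: fps_X_mult_nth)
  have "?a oo kappa c = fps_X"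
    unfolding kappa_def by (rule fps_inv_right[OF a0 a1])
  moreover have "?a oo kappa c = kappa c * inverse (?d oo kappa c)"
    using d0 by (simp add: fps_compose_mult_distrib kappa_0 fps_inverse_compose)
  moreover have dk: "?d oo kappa c = gen_fun c 1"
    by (simp add: gen_fun_def exp_kappa_def fps_compose_mult_distrib kappa_0 fps_compose_add_distrib mult.commute)
  ultimately have "kappa c * inverse (gen_fun c 1) = fps_X" by simp
  moreover have "gen_fun c 1 $ 0 \<noteq> 0" using d0 unfolding dk[symmetric] by simp
  ultimately show ?thesis
    by (metis inverse_mult_eq_1 mult.assoc mult.commute mult.right_neutral)
qed

lemma gen_fun_add: "gen_fun c (x + y) = gen_fun c x * exp_kappa c y"
  by (simp add: gen_fun_def exp_kappa_add mult.assoc)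

text \<open>The mechanism behind the recursion: differentiation in \<open>x\<close> multiplies by
  \<open>kappa\<close>, and this identity trades that factor for one power of the variable and the
  shift to \<open>x + 1\<close>.\<close>

lemma kappa_exp_kappa: "kappa c * exp_kappa c x = fps_X * gen_fun c (x + 1)"
  by (subst kappa_eq) (simp add: gen_fun_add[symmetric] add.commute mult.assoc)

lemma kappa_exp_kappa_nth: "(kappa c * exp_kappa c x) $ Suc n = gen_fun c (x + 1) $ n"
  by (simp add: kappa_exp_kappa)

lemma fps_exp_coeff_deriv:
  "((\<lambda>x. fps_exp (x + a :: real) $ i) has_real_derivative (fps_X * fps_exp (x + a)) $ i) (at x)"
proof (cases i)
  case (Suc k)
  have "((\<lambda>x. (x + a) ^ Suc k) has_real_derivative (1 + real k) * ((1 + 0) * (x + a) ^ k)) (at x)"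
    by (rule DERIV_power_Suc DERIV_add DERIV_ident DERIV_const)+
  from DERIV_cdivide[OF this, of "fact (Suc k)"]
  have "((\<lambda>x. (x + a) ^ Suc k / fact (Suc k)) has_real_derivative
      ((1 + real k) * (x + a) ^ k) / fact (Suc k)) (at x)"
    by simp
  moreover have "((1 + real k) * (x + a) ^ k) / fact (Suc k) = (x + a) ^ k / fact k"
  proof -
    have nz: "1 + real k \<noteq> 0" by linarith
    show ?thesis by (simp only: fact_Suc of_nat_Suc nonzero_mult_divide_mult_cancel_left[OF nz])
  qed
  ultimately show ?thesis by (simp add: Suc fps_X_mult_nth del: power_Suc fact_Suc)
qed simp

lemma exp_kappa_nth_deriv:
  "((\<lambda>x. exp_kappa c x $ n) has_real_derivative (kappa c * exp_kappa c x) $ n) (at x)"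
proof -
  have "(kappa c * exp_kappa c x) = (fps_X * fps_exp x) oo kappa c"
    by (simp add: exp_kappa_def fps_compose_mult_distrib kappa_0)
  then have eq: "(kappa c * exp_kappa c x) $ n = (\<Sum>i=0..n. (fps_X * fps_exp x) $ i * (kappa c ^ i $ n))"
    by (simp add: fps_compose_nth)
  show ?thesis unfolding eq unfolding exp_kappa_def fps_compose_nth
    by (intro DERIV_sum DERIV_cmult_right) (use fps_exp_coeff_deriv[of 0] in simp)
qed

lemma gen_fun_nth_deriv:
  "((\<lambda>x. gen_fun c x $ n) has_real_derivative (kappa c * gen_fun c x) $ n) (at x)"
proof -
  have "kappa c * gen_fun c x = (1 + fps_const c * kappa c) * (kappa c * exp_kappa c x)"
    by (simp add: gen_fun_def algebra_simps)
  then show ?thesis unfolding gen_fun_def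
    by (simp only: fps_mult_nth[of "1 + fps_const c * kappa c"]) (intro DERIV_sum DERIV_cmult exp_kappa_nth_deriv)
qed

lemma gen_fun_nth_continuous: "continuous_on S (\<lambda>x. gen_fun c x $ n)"
  using gen_fun_nth_deriv by (intro continuous_at_imp_continuous_on ballI DERIV_isCont) blast

lemma exp_kappa_nth_continuous: "continuous_on S (\<lambda>x. exp_kappa c x $ n)"
  using exp_kappa_nth_deriv by (intro continuous_at_imp_continuous_on ballI DERIV_isCont) blast

lemma gen_fun_eq: "gen_fun c x = exp_kappa c x + fps_const c * (kappa c * exp_kappa c x)"
  by (simp add: gen_fun_def algebra_simps)

lemma exp_kappa_0_nth_Suc: "exp_kappa c 0 $ Suc n = 0"
  by (simp add: exp_kappa_0)

lemma gen_fun_Suc: "gen_fun c x $ Suc n = c * gen_fun c (x + 1) $ n + exp_kappa c x $ Suc n"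
  by (subst gen_fun_eq) (simp add: kappa_exp_kappa_nth)

lemma one_minus_exp_kappa_mult_nth:
  "((1 - exp_kappa c z) * G) $ Suc n = (\<Sum>j\<le>n. - (exp_kappa c z $ Suc j) * G $ (n - j))"
proof -
  have 0: "exp_kappa c z $ 0 = 1" by (simp add: exp_kappa_def)
  show ?thesis
    unfolding fps_mult_nth sum.atLeast0_atMost_Suc_shift
    by (simp add: 0 atLeast0AtMost del: sum.atMost_Suc)
qed

text \<open>Multiplication by \<open>exp_kappa c (- y)\<close> removes the dependence on
  \<open>y\<close>. Written with \<open>1 - exp_kappa c (- y)\<close>, which has no constant term,
  the relation takes the shape of the contraction recursion; this one serves words of even length
  and \<open>kappa_convolution\<close> those of odd length.\<close>

lemma gen_fun_convolution:
  "gen_fun c y $ Suc n = c * kappa c $ Suc n + (\<Sum>j\<le>n. - (exp_kappa c (- y) $ Suc j) * gen_fun c y $ (n - j))"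
proof -
  have "exp_kappa c (- y) * gen_fun c y = 1 + fps_const c * kappa c"
    using gen_fun_add[of c y "- y"] by (simp add: mult.commute gen_fun_def exp_kappa_0)
  then have "gen_fun c y = (1 + fps_const c * kappa c) + (1 - exp_kappa c (- y)) * gen_fun c y"
    by (simp add: left_diff_distrib)
  then have "gen_fun c y $ Suc n = ((1 + fps_const c * kappa c) + (1 - exp_kappa c (- y)) * gen_fun c y) $ Suc n"
    by simp
  then show ?thesis by (simp add: one_minus_exp_kappa_mult_nth)
qed

lemma kappa_convolution:
  "kappa c $ Suc n = gen_fun c (1 - y) $ n + (\<Sum>j\<le>n. - (exp_kappa c (- y) $ Suc j) * kappa c $ (n - j))"
proof -
  have "kappa c = fps_X * gen_fun c (1 - y) + (1 - exp_kappa c (- y)) * kappa c"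
    using kappa_exp_kappa[of c "- y"] by (simp add: algebra_simps)
  then have "kappa c $ Suc n = (fps_X * gen_fun c (1 - y) + (1 - exp_kappa c (- y)) * kappa c) $ Suc n"
    by simp
  then show ?thesis by (simp add: one_minus_exp_kappa_mult_nth)
qed

section \<open>The polynomials as coefficients of the generating function\<close>

definition Qpoly :: "real \<Rightarrow> nat \<Rightarrow> real poly" where
  "Qpoly c n = (\<Sum>m=0..n. smult ((1 + fps_const c * kappa c) $ m)
     (\<Sum>i=0..n - m. monom ((kappa c ^ i) $ (n - m) / fact i) i))"

lemma poly_Qpoly: "poly (Qpoly c n) x = gen_fun c x $ n"
  unfolding Qpoly_def gen_fun_def exp_kappa_def fps_mult_nth[of "1 + fps_const c * kappa c"] fps_compose_nth
  by (simp add: poly_sum poly_monom mult.commute)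

text \<open>The coefficient of index \<open>n + 1\<close> of \<open>exp_kappa c\<close> is the
  antiderivative of \<open>poly (Qpoly c n) (y + 1)\<close> that vanishes at 0, so the integral in
  the recursion is this coefficient itself.\<close>

lemma moment_recursion_Qpoly: "moment_recursion l (Qpoly ((cmod l)\<^sup>2))"
  unfolding moment_recursion_def
proof (intro conjI allI)
  let ?c = "(cmod l)\<^sup>2"
  show "Qpoly ?c 0 = 1"
    by (simp add: poly_eq_poly_eq_iff[symmetric] fun_eq_iff poly_Qpoly) (simp add: gen_fun_def exp_kappa_def kappa_0)
  fix n x
  have "(LBINT y=ereal 0..ereal x. poly (Qpoly ?c n) (y + 1)) = exp_kappa ?c x $ Suc n - exp_kappa ?c 0 $ Suc n"
  proof (rule interval_integral_FTC_finite)
    fix y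
    show "((\<lambda>y. exp_kappa ?c y $ Suc n) has_vector_derivative poly (Qpoly ?c n) (y + 1))
        (at y within {min 0 x..max 0 x})"
      using exp_kappa_nth_deriv[of ?c "Suc n" y]
      by (simp add: poly_Qpoly kappa_exp_kappa_nth has_real_derivative_iff_has_vector_derivative
          has_vector_derivative_at_within)
  qed (intro continuous_intros)
  then show "poly (Qpoly ?c (Suc n)) x
      = ?c * poly (Qpoly ?c n) (x + 1) + (LBINT y=0..x. poly (Qpoly ?c n) (y + 1))"
    by (simp add: poly_Qpoly gen_fun_Suc exp_kappa_0_nth_Suc zero_ereal_def)
qed

lemma moment_recursion_unique:
  assumes "moment_recursion l Q" "moment_recursion l R" shows "Q = R"
proof
  fix n
  show "Q n = R n"
  proof (induction n)
    case (Suc n)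
    have "poly (Q (Suc n)) x = poly (R (Suc n)) x" for x
      using assms Suc by (simp add: moment_recursion_def)
    then show ?case by (simp add: poly_eq_poly_eq_iff[symmetric] fun_eq_iff)
  qed (use assms in \<open>simp add: moment_recursion_def\<close>)
qed

section \<open>The explicit moments\<close>

text \<open>Lagrange inversion gives \<open>Q\<^sub>n(x) = [z\<^sup>n] e\<^bsup>(x+n)z\<^esup> (1 + cz)\<^sup>n (1 - z(1 + cz))\<close>, which is verified
  directly here.\<close>

definition linear_factor :: "real \<Rightarrow> real fps" where
  "linear_factor c = 1 + fps_const c * fps_X"

definition lagrange_factor :: "real \<Rightarrow> nat \<Rightarrow> real fps" where
  "lagrange_factor c n = linear_factor c ^ n * (1 - fps_X * linear_factor c)"

lemma fps_nth_X_deriv: "(fps_X * fps_deriv f) $ n = real n * f $ n" for f :: "real fps"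
  by (cases n) (simp_all add: fps_X_mult_nth)

lemma deriv_exp_linear_factor_power:
  assumes "B = linear_factor c" "C = fps_const c" "N = fps_const (real (Suc k))" "e = fps_exp (real (Suc k))"
  shows "fps_deriv (e * B ^ Suc k) = N * (e * B ^ k * (B + C))"
proof -
  have "fps_deriv B = C" by (simp add: assms linear_factor_def)
  then have 1: "fps_deriv (B ^ Suc k) = N * (C * B ^ k)"
    by (simp add: fps_deriv_power assms fps_of_nat[symmetric] mult.assoc del: power_Suc of_nat_Suc)
  have 2: "fps_deriv e = N * e" by (simp add: assms)
  show ?thesis unfolding fps_deriv_mult 1 2 by (simp add: algebra_simps)
qed

text \<open>With \<open>H = e * B ^ Suc n\<close> and \<open>z\<close> for the variable,
  \<open>Suc n\<close> times the series equals \<open>(n + 1) H - z H'\<close>, and the coefficient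
  of index \<open>n + 1\<close> of such an expression vanishes.\<close>

lemma exp_lagrange_factor_0: "(fps_exp (real (Suc n)) * lagrange_factor c n) $ Suc n = 0"
proof -
  define B C N e where d: "B = linear_factor c" "C = fps_const c" "N = fps_const (real (Suc n))" "e = fps_exp (real (Suc n))"
  have B: "B = 1 + C * fps_X" by (simp add: d linear_factor_def)
  have key: "1 - fps_X * B = B - fps_X * (B + C)"
    using B by (simp add: algebra_simps)
  have "N * (e * (B ^ n * (1 - fps_X * B))) = N * (e * B ^ Suc n) - fps_X * (N * (e * B ^ n * (B + C)))"
    unfolding key by (simp add: algebra_simps)
  also have "\<dots> = N * (e * B ^ Suc n) - fps_X * fps_deriv (e * B ^ Suc n)"
    by (simp only: deriv_exp_linear_factor_power[OF d])
  finally have "(N * (e * (B ^ n * (1 - fps_X * B)))) $ Suc n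
      = (N * (e * B ^ Suc n)) $ Suc n - (fps_X * fps_deriv (e * B ^ Suc n)) $ Suc n"
    by simp
  then have "real (Suc n) * (e * (B ^ n * (1 - fps_X * B))) $ Suc n = 0"
    unfolding fps_nth_X_deriv by (simp add: d(3) del: of_nat_Suc power_Suc)
  then show ?thesis by (simp add: d(1,4) lagrange_factor_def del: of_nat_Suc)
qed

lemma exp_lagrange_factor_nth_deriv:
  "((\<lambda>y. (fps_exp (y + a) * lagrange_factor c n) $ Suc n) has_real_derivative (fps_exp (y + a) * lagrange_factor c n) $ n) (at y)"
proof -
  have "(fps_exp (y + a) * lagrange_factor c n) $ n = ((fps_X * fps_exp (y + a)) * lagrange_factor c n) $ Suc n"
    by (simp add: mult.assoc)
  then show ?thesis
    by (simp only: fps_mult_nth[of "fps_exp _"] fps_mult_nth[of "fps_X * fps_exp _"])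
      (intro DERIV_sum DERIV_cmult_right fps_exp_coeff_deriv)
qed

text \<open>Integration in \<open>x\<close> raises the coefficient index by one, with vanishing
  constant of integration by \<open>exp_lagrange_factor_0\<close>. Adding \<open>c\<close> times the
  old coefficient then amounts to multiplication by \<open>1 + c z\<close>.\<close>

lemma moment_recursion_explicit:
  assumes Q: "moment_recursion l Q"
  shows "poly (Q n) x = (fps_exp (x + real n) * lagrange_factor ((cmod l)\<^sup>2) n) $ n"
proof (induction n arbitrary: x)
  case 0
  show ?case using Q by (simp add: moment_recursion_def lagrange_factor_def)
next
  case (Suc n)
  let ?c = "(cmod l)\<^sup>2"
  let ?Z = "\<lambda>y. (fps_exp (y + real (Suc n)) * lagrange_factor ?c n) $ Suc n"
  have "(LBINT y=ereal 0..ereal x. poly (Q n) (y + 1)) = ?Z x - ?Z 0"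
  proof (rule interval_integral_FTC_finite)
    fix y
    show "(?Z has_vector_derivative poly (Q n) (y + 1)) (at y within {min 0 x..max 0 x})"
      using exp_lagrange_factor_nth_deriv[of "real (Suc n)" ?c n y]
      by (simp add: Suc has_real_derivative_iff_has_vector_derivative has_vector_derivative_at_within
          algebra_simps)
  qed (intro continuous_intros)
  moreover have "?Z 0 = 0" using exp_lagrange_factor_0[of n ?c] by simp
  ultimately have "poly (Q (Suc n)) x = ?c * (fps_exp (x + real (Suc n)) * lagrange_factor ?c n) $ n + ?Z x"
    using Q by (simp add: moment_recursion_def Suc zero_ereal_def algebra_simps)
  also have "\<dots> = (linear_factor ?c * (fps_exp (x + real (Suc n)) * lagrange_factor ?c n)) $ Suc n"
    by (simp add: linear_factor_def distrib_right mult.assoc fps_mult_left_const_nth)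
  also have "linear_factor ?c * (fps_exp (x + real (Suc n)) * lagrange_factor ?c n) = fps_exp (x + real (Suc n)) * lagrange_factor ?c (Suc n)"
    by (simp add: lagrange_factor_def mult_ac)
  finally show ?case .
qed

lemma linear_factor_power_nth: "(linear_factor c ^ n) $ i = real (n choose i) * c ^ i"
proof -
  have "linear_factor c ^ n = (\<Sum>k\<le>n. of_nat (n choose k) * (fps_const c * fps_X) ^ k * 1 ^ (n - k))"
    unfolding linear_factor_def by (subst add.commute) (rule binomial_ring)
  also have "\<dots> = (\<Sum>k\<le>n. fps_const (real (n choose k) * c ^ k) * fps_X ^ k)"
    by (intro sum.cong refl) (simp add: power_mult_distrib fps_of_nat[symmetric] fps_const_power mult.assoc)
  finally show ?thesis
    by (simp add: fps_sum_nth fps_X_power_iff if_distrib[of "\<lambda>z. _ * z"] not_le binomial_eq_0 cong: if_cong)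
qed

text \<open>For \<open>n \<ge> 1\<close> the left side is \<open>1 / n\<close> times the coefficient
  of index \<open>n + 1\<close> of \<open>fps_exp (real n) * linear_factor c ^ n\<close>, a form of
  Lagrange inversion; the product is then expanded. The division by \<open>n\<close> makes
  \<open>n = 0\<close> a separate case.\<close>

lemma neg_exp_lagrange_factor_nth:
  "- (fps_exp (real n) * lagrange_factor c n) $ Suc n
    = (\<Sum>k = 0..n. real n ^ k / fact (k + 1) * real (n choose k) * c ^ (n - k))"
proof (cases "n = 0")
  case True
  then show ?thesis by (simp add: lagrange_factor_def linear_factor_def)
next
  case False
  let ?e = "fps_exp (real n) * linear_factor c ^ n"
  obtain m where m: "n = Suc m" using False by (cases n) auto
  define B C N e where d: "B = linear_factor c" "C = fps_const c" "N = fps_const (real (Suc m))" "e = fps_exp (real (Suc m))"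
  \<comment> \<open>The product is completed to the derivative of \<open>e * B ^ Suc m\<close>; the
    term with \<open>C\<close> corrects for the extra factor \<open>B\<close> and cancels in the
    coefficient of index \<open>n + 1\<close>.\<close>
  have "N * (e * (B ^ Suc m * (1 - fps_X * B)))
      = N * (e * B ^ Suc m) - (B * (fps_X * (N * (e * B ^ m * (B + C)))) - C * (N * (fps_X * (e * B ^ Suc m))))"
    by (simp add: algebra_simps)
  also have "\<dots> = N * (e * B ^ Suc m) - (B * (fps_X * fps_deriv (e * B ^ Suc m)) - C * (N * (fps_X * (e * B ^ Suc m))))"
    by (simp only: deriv_exp_linear_factor_power[OF d])
  finally have "(N * (e * (B ^ Suc m * (1 - fps_X * B)))) $ Suc n = (N * (e * B ^ Suc m)) $ Suc n
      - ((B * (fps_X * fps_deriv (e * B ^ Suc m))) $ Suc n - (C * (N * (fps_X * (e * B ^ Suc m)))) $ Suc n)"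
    by simp
  moreover have "(B * (fps_X * fps_deriv (e * B ^ Suc m))) $ Suc n
      = real (Suc n) * (e * B ^ Suc m) $ Suc n + c * (real n * (e * B ^ Suc m) $ n)"
  proof -
    have "(B * G) $ Suc n = G $ Suc n + c * G $ n" for G
      by (simp add: d(1) linear_factor_def distrib_right mult.assoc)
    then show ?thesis by (simp only: fps_nth_X_deriv)
  qed
  moreover have "(C * (N * (fps_X * (e * B ^ Suc m)))) $ Suc n = c * (real n * (e * B ^ Suc m) $ n)"
    by (simp add: d(2,3) m del: of_nat_Suc power_Suc)
  moreover have "(N * G) $ Suc n = real n * G $ Suc n" for G
    by (simp add: d(3) m del: of_nat_Suc)
  ultimately have "real n * (e * (B ^ Suc m * (1 - fps_X * B))) $ Suc n
      = real n * (e * B ^ Suc m) $ Suc n - real (Suc n) * (e * B ^ Suc m) $ Suc n"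
    by (simp only:)
  then have "real n * (fps_exp (real n) * lagrange_factor c n) $ Suc n = real n * ?e $ Suc n - real (Suc n) * ?e $ Suc n"
    by (simp only: d(1,4) lagrange_factor_def m)
  then have "real n * - (fps_exp (real n) * lagrange_factor c n) $ Suc n = ?e $ Suc n"
    by (simp add: algebra_simps)
  then have "- (fps_exp (real n) * lagrange_factor c n) $ Suc n = ?e $ Suc n / real n"
    using False by (simp add: field_simps)
  also have "?e $ Suc n = (\<Sum>i=0..Suc n. fps_exp (real n) $ i * (linear_factor c ^ n) $ (Suc n - i))"
    by (rule fps_mult_nth)
  also have "\<dots> = (\<Sum>k=0..n. fps_exp (real n) $ Suc k * (linear_factor c ^ n) $ (n - k))"
  proof -
    \<comment> \<open>The power has degree \<open>n\<close>, so the constant term of the exponential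
      does not contribute. The shifted index gives \<open>n ^ (k + 1) / fact (k + 1)\<close>, and
      one factor \<open>n\<close> cancels.\<close>
    have "(linear_factor c ^ n) $ (Suc n - 0) = 0" by (simp add: linear_factor_power_nth binomial_eq_0)
    then show ?thesis
      by (simp only: sum.atLeast0_atMost_Suc_shift mult_zero_right add_0_left diff_Suc_Suc o_def)
  qed
  also have "\<dots> / real n = (\<Sum>k = 0..n. real n ^ k / fact (k + 1) * real (n choose k) * c ^ (n - k))"
    unfolding sum_divide_distrib
  proof (rule sum.cong[OF refl])
    fix k assume "k \<in> {0..n}"
    then have "n choose (n - k) = n choose k" by (simp add: binomial_symmetric[symmetric])
    then show "fps_exp (real n) $ Suc k * (linear_factor c ^ n) $ (n - k) / real n
        = real n ^ k / fact (k + 1) * real (n choose k) * c ^ (n - k)"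
      using False by (simp add: linear_factor_power_nth del: fact_Suc)
  qed
  finally show ?thesis .
qed

text \<open>The antiderivative \<open>?Z\<close> of the explicit formula vanishes at 1 by
  \<open>exp_lagrange_factor_0\<close>, so the integral is minus its value at 0.\<close>

lemma moment_recursion_integral:
  assumes Q: "moment_recursion l Q"
  shows "(LINT t:{0..1}|lborel. poly (Q n) t)
    = (\<Sum>k = 0..n. real n ^ k / fact (k + 1) * real (n choose k) * cmod l ^ (2 * n - 2 * k))"
proof -
  let ?c = "(cmod l)\<^sup>2"
  let ?Z = "\<lambda>y. (fps_exp (y + real n) * lagrange_factor ?c n) $ Suc n"
  have "(LINT t|lborel. poly (Q n) t * indicator {0..1} t) = ?Z 1 - ?Z 0"
  proof (rule integral_FTC_Icc_real)
    show "DERIV ?Z y :> poly (Q n) y" for y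
      using exp_lagrange_factor_nth_deriv[of "real n" ?c n y] by (simp add: moment_recursion_explicit[OF Q])
  qed (auto intro: continuous_intros)
  moreover have "?Z 1 = 0" using exp_lagrange_factor_0[of n ?c] by (simp add: add.commute)
  moreover have "cmod l ^ (2 * n - 2 * k) = ?c ^ (n - k)" for k
    by (simp add: power_mult[symmetric] diff_mult_distrib2)
  ultimately show ?thesis
    using neg_exp_lagrange_factor_nth[of n ?c] by (simp add: set_lebesgue_integral_def mult.commute)
qed

section \<open>Densities of alternating words\<close>

fun alternate :: "bool \<Rightarrow> nat \<Rightarrow> bool list" where
  "alternate b 0 = []"
| "alternate b (Suc m) = b # alternate (\<not> b) m"

lemma length_alternate [simp]: "length (alternate b m) = m"
  by (induction b m rule: alternate.induct) auto

lemma nth_alternate: "i < m \<Longrightarrow> alternate b m ! i = (b = even i)"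
proof (induction b m arbitrary: i rule: alternate.induct)
  case (2 b m)
  then show ?case by (cases i) auto
qed simp

lemma take_alternate: "i \<le> m \<Longrightarrow> take i (alternate b m) = alternate b i"
proof (induction b m arbitrary: i rule: alternate.induct)
  case (2 b m)
  then show ?case by (cases i) auto
qed simp

lemma drop_alternate: "i \<le> m \<Longrightarrow> drop i (alternate b m) = alternate (b = even i) (m - i)"
proof (induction b m arbitrary: i rule: alternate.induct)
  case (2 b m)
  show ?case
  proof (cases i)
    case (Suc j)
    then have "drop j (alternate (\<not> b) m) = alternate ((\<not> b) = even j) (m - j)" using 2 by simp
    moreover have "((\<not> b) = even j) = (b = even i)" using Suc by auto
    ultimately show ?thesis using Suc by simp
  qed simp
qed simp

lemma sum_even_shift:
  "(\<Sum>i<m::nat. if even i then f i else (0::'a::comm_monoid_add)) = (\<Sum>j<(m + 1) div 2. f (2 * j))"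
proof (induction m)
  case (Suc m)
  show ?case
  proof (cases "even m")
    case True
    then obtain k where "m = 2 * k" by blast
    then show ?thesis using Suc by simp
  next
    case False
    then obtain k where "m = 2 * k + 1" using oddE by blast
    then show ?thesis using Suc by simp
  qed
qed simp

text \<open>Passing from \<open>T\<close> to its adjoint reverses the order of the cells, which for
  densities is the substitution \<open>x \<mapsto> 1 - x\<close>.\<close>

definition reflect :: "bool \<Rightarrow> real \<Rightarrow> real" where
  "reflect b x = (if b then 1 - x else x)"

section \<open>Closed forms of the densities\<close>

context dt_operator
begin

abbreviation "cc \<equiv> (cmod l)\<^sup>2"

text \<open>The solution of the contraction recursion. Even words carry the coefficients of the
  generating function; for odd words the dependence on \<open>x\<close> cancels and a coefficient of
  \<kappa> remains.\<close>

definition word_density :: "bool \<Rightarrow> nat \<Rightarrow> real \<Rightarrow> complex" where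
  "word_density b m x = (if even m then complex_of_real (fps_nth (gen_fun cc (reflect b x)) (m div 2))
     else - lam b * complex_of_real (fps_nth (kappa cc) (Suc (m div 2))))"

text \<open>A coefficient of \<open>1 - exp_kappa cc (- y)\<close> at
  \<open>y = reflect b x\<close>: the integral of the density of an even word, beginning with the
  opposite letter, over the side of \<open>x\<close>.\<close>

definition inner_integral :: "bool \<Rightarrow> nat \<Rightarrow> real \<Rightarrow> complex" where
  "inner_integral b j x = complex_of_real (- fps_nth (exp_kappa cc (- reflect b x)) (Suc j))"

lemma continuous_BB:
  assumes "continuous_on UNIV f" shows "(\<lambda>t. complex_of_real (f t)) \<in> BB"
proof -
  have "continuous_on {- norm D0..norm D0} f" by (rule continuous_on_subset[OF assms]) simp
  then have "bounded (f ` {- norm D0..norm D0})"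
    by (intro compact_imp_bounded compact_continuous_image compact_Icc)
  then obtain B where "\<forall>y\<in>f ` {- norm D0..norm D0}. norm y \<le> B" unfolding bounded_iff by blast
  then show ?thesis
    by (intro bdd_borel_of_real[of _ _ B] borel_measurable_continuous_onI assms) auto
qed

lemma reflect_continuous: "continuous_on S (reflect b)"
  by (cases b) (auto simp: reflect_def[abs_def] intro!: continuous_intros)

lemma gen_fun_refl_continuous: "continuous_on UNIV (\<lambda>x. fps_nth (gen_fun c (reflect b x)) n)"
  by (rule continuous_on_compose2[OF gen_fun_nth_continuous[of UNIV] reflect_continuous]) simp

lemma exp_kappa_refl_continuous: "continuous_on UNIV (\<lambda>x. - fps_nth (exp_kappa c (- reflect b x)) n)"
  by (intro continuous_on_minus
      continuous_on_compose2[OF exp_kappa_nth_continuous[of UNIV] continuous_on_minus[OF reflect_continuous]]) simp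

lemma exp_kappa_refl_deriv:
  "((\<lambda>x. - fps_nth (exp_kappa c (- reflect b x)) (Suc j)) has_real_derivative
     (if b then -1 else 1) * fps_nth (gen_fun c (reflect (\<not> b) x)) j) (at x)"
proof -
  have "((\<lambda>x. - reflect b x) has_real_derivative (if b then 1 else -1)) (at x)"
    unfolding reflect_def by (auto intro!: derivative_eq_intros)
  from DERIV_minus[OF DERIV_chain2[OF exp_kappa_nth_deriv[of c "Suc j"] this]]
  have "((\<lambda>x. - fps_nth (exp_kappa c (- reflect b x)) (Suc j)) has_real_derivative
     - (fps_nth (gen_fun c (- reflect b x + 1)) j * (if b then 1 else -1))) (at x)"
    by (simp only: kappa_exp_kappa_nth)
  moreover have "- reflect b x + 1 = reflect (\<not> b) x" by (simp add: reflect_def)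
  ultimately show ?thesis by (cases b) simp_all
qed

lemma word_density_BB: "word_density b m \<in> BB"
proof (cases "even m")
  case True
  then have "word_density b m = (\<lambda>x. complex_of_real (fps_nth (gen_fun cc (reflect b x)) (m div 2)))"
    by (auto simp: word_density_def)
  then show ?thesis using continuous_BB[OF gen_fun_refl_continuous] by simp
next
  case False
  then have "word_density b m = (\<lambda>x. - lam b * complex_of_real (fps_nth (kappa cc) (Suc (m div 2))))"
    by (auto simp: word_density_def)
  then show ?thesis by (simp add: bdd_borel_const)
qed

lemma inner_integral_BB: "inner_integral b j \<in> BB"
  unfolding inner_integral_def[abs_def] by (rule continuous_BB[OF exp_kappa_refl_continuous])

lemma inner_integral_side:
  assumes c: "c \<in> {0..1}"
  shows "\<tau> (\<Phi> (word_density (\<not> b) (2 * j)) \<odot> side b c) = inner_integral b j c"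
proof -
  let ?f = "\<lambda>x. fps_nth (gen_fun cc (reflect (\<not> b) x)) j" and ?G = "\<lambda>x. - fps_nth (exp_kappa cc (- reflect b x)) (Suc j)"
  define lo hi where "lo = (if b then c else 0)" and "hi = (if b then 1 else c)"
  have lh: "lo \<le> hi" "0 \<le> lo" "hi \<le> 1" using c by (auto simp: lo_def hi_def)
  have F: "word_density (\<not> b) (2 * j) = (\<lambda>x. complex_of_real (?f x))" by (auto simp: word_density_def)
  have FB: "(\<lambda>x. complex_of_real (?f x)) \<in> BB" using word_density_BB[of "\<not> b" "2 * j"] by (simp only: F)
  have side: "side b c = \<Phi> (indicator {lo..hi})" by (simp add: side_def iproj_def lo_def hi_def)
  have "\<tau> (\<Phi> (word_density (\<not> b) (2 * j)) \<odot> side b c) = (LINT t:{0..1}|lborel. complex_of_real (?f t) * indicator {lo..hi} t)"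
    unfolding F side Phi_mult[OF FB indicator_BB, symmetric]
    by (rule tau_Phi[OF bdd_borel_mult[OF FB indicator_BB]])
  also have "\<dots> = (LINT t|lborel. complex_of_real (?f t * indicator {lo..hi} t))"
    unfolding set_lebesgue_integral_def
    by (intro Bochner_Integration.integral_cong) (use lh in \<open>auto simp: indicator_def\<close>)
  also have "\<dots> = complex_of_real (LINT t|lborel. ?f t * indicator {lo..hi} t)"
    by (rule integral_complex_of_real)
  also have "(LINT t|lborel. ?f t * indicator {lo..hi} t)
      = (if b then -1 else 1) * ?G hi - (if b then -1 else 1) * ?G lo"
  proof (rule integral_FTC_Icc_real[OF lh(1)])
    show "DERIV (\<lambda>x. (if b then -1 else 1) * ?G x) x :> ?f x" for x
      using DERIV_cmult[OF exp_kappa_refl_deriv[of cc b j x], of "if b then -1 else 1"]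
      by (cases b) simp_all
    show "isCont ?f x" for x
      using gen_fun_refl_continuous[of cc "\<not> b" j] by (simp add: continuous_on_eq_continuous_at)
  qed
  also have "\<dots> = ?G c"
    by (cases b) (simp_all add: lo_def hi_def reflect_def exp_kappa_0_nth_Suc)
  finally show ?thesis by (simp only: inner_integral_def)
qed

lemma inner_integral_lipschitz:
  "\<exists>K. \<forall>x\<in>{0..1}. \<forall>y\<in>{0..1}. cmod (inner_integral b j x - inner_integral b j y) \<le> K * \<bar>x - y\<bar>"
proof -
  let ?f = "\<lambda>x. fps_nth (gen_fun cc (reflect (\<not> b) x)) j" and ?G = "\<lambda>x. - fps_nth (exp_kappa cc (- reflect b x)) (Suc j)"
  have "continuous_on {0..1} ?f" by (rule continuous_on_subset[OF gen_fun_refl_continuous]) simp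
  then have "bounded (?f ` {0..1})" by (intro compact_imp_bounded compact_continuous_image compact_Icc)
  then obtain K where K: "\<forall>y\<in>?f ` {0..1}. norm y \<le> K" unfolding bounded_iff by blast
  have "norm (?G x - ?G y) \<le> K * norm (x - y)" if "x \<in> {0..1}" "y \<in> {0..1}" for x y
  proof (rule field_differentiable_bound[of "{0..1}"])
    show "(?G has_field_derivative (if b then -1 else 1) * ?f z) (at z within {0..1})" for z
      using exp_kappa_refl_deriv by (rule has_field_derivative_at_within)
    show "norm ((if b then -1 else 1) * ?f z) \<le> K" if "z \<in> {0..1}" for z
      using K that by (auto simp: norm_mult)
  qed (use that in auto)
  moreover have "cmod (inner_integral b j x - inner_integral b j y) = norm (?G x - ?G y)" for x y
    unfolding inner_integral_def of_real_diff[symmetric] norm_of_real real_norm_def ..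
  ultimately show ?thesis unfolding real_norm_def by (intro exI[of _ K]) auto
qed

lemma lam_mult: "lam b * lam (\<not> b) = complex_of_real cc"
  using complex_norm_square[of l] by (cases b) (simp_all add: lam_def mult.commute)

text \<open>For even \<open>m\<close> a common factor \<open>- lam b\<close> comes out and
  \<open>kappa_convolution\<close> remains. For odd \<open>m\<close> it is
  \<open>gen_fun_convolution\<close>, whose term \<open>c * kappa c $ Suc n\<close> arises from the
  product of \<open>lam b\<close> and \<open>lam (\<not> b)\<close>.\<close>

lemma word_density_Suc:
  "word_density b (Suc m) x = (\<Sum>i<m. if even i then inner_integral b (i div 2) x * word_density b (m - Suc i) x else 0) + - lam b * word_density (\<not> b) m x"
proof -
  let ?y = "reflect b x"
  have S: "inner_integral b j x = complex_of_real (- fps_nth (exp_kappa cc (- ?y)) (Suc j))" for j by (simp add: inner_integral_def)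
  have sum: "(\<Sum>i<m. if even i then inner_integral b (i div 2) x * word_density b (m - Suc i) x else 0)
      = (\<Sum>j<(m + 1) div 2. inner_integral b j x * word_density b (m - Suc (2 * j)) x)"
    using sum_even_shift[of "\<lambda>i. inner_integral b (i div 2) x * word_density b (m - Suc i) x" m] by simp
  show ?thesis
  proof (cases "even m")
    case True
    then obtain n where m: "m = 2 * n" by blast
    have F: "word_density b (m - Suc (2 * j)) x = - lam b * complex_of_real (fps_nth (kappa cc) (n - j))" if "j < n" for j
    proof -
      have "m - Suc (2 * j) = 2 * (n - Suc j) + 1" using that m by simp
      then have "word_density b (m - Suc (2 * j)) x = - lam b * complex_of_real (fps_nth (kappa cc) (Suc (n - Suc j)))"
        by (simp add: word_density_def)
      also have "Suc (n - Suc j) = n - j" using that by simp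
      finally show ?thesis .
    qed
    have "(\<Sum>j<(m + 1) div 2. inner_integral b j x * word_density b (m - Suc (2 * j)) x)
        = - lam b * complex_of_real (\<Sum>j<n. - fps_nth (exp_kappa cc (- ?y)) (Suc j) * fps_nth (kappa cc) (n - j))"
      unfolding of_real_sum sum_distrib_left
      by (rule sum.cong) (use m F S in \<open>auto simp: mult_ac\<close>)
    moreover obtain z where z: "z = (\<Sum>j<n. - fps_nth (exp_kappa cc (- ?y)) (Suc j) * fps_nth (kappa cc) (n - j))"
      by simp
    \<comment> \<open>The convolution runs up to \<open>j = n\<close>, the sum \<open>z\<close> only
      below \<open>n\<close>; the missing term contains the zero constant coefficient of
      \<open>kappa\<close>.\<close>
    moreover have "fps_nth (kappa cc) (Suc n) = fps_nth (gen_fun cc (1 - ?y)) n + z"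
      unfolding kappa_convolution[of cc n ?y] z by (simp add: lessThan_Suc_atMost[symmetric] kappa_0)
    moreover have "word_density (\<not> b) m x = complex_of_real (fps_nth (gen_fun cc (1 - ?y)) n)"
      by (simp add: word_density_def m reflect_def)
    moreover have "word_density b (Suc m) x = - lam b * complex_of_real (fps_nth (kappa cc) (Suc n))"
      by (simp add: word_density_def m)
    ultimately show ?thesis
      unfolding sum z[symmetric] by (simp add: algebra_simps)
  next
    case False
    then obtain n where m: "m = 2 * n + 1" using oddE by blast
    have F: "word_density b (m - Suc (2 * j)) x = complex_of_real (fps_nth (gen_fun cc ?y) (n - j))" if "j \<le> n" for j
    proof -
      have "m - Suc (2 * j) = 2 * (n - j)" using that m by simp
      then show ?thesis by (simp add: word_density_def)
    qed
    have "(\<Sum>j<(m + 1) div 2. inner_integral b j x * word_density b (m - Suc (2 * j)) x)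
        = complex_of_real (\<Sum>j\<le>n. - fps_nth (exp_kappa cc (- ?y)) (Suc j) * fps_nth (gen_fun cc ?y) (n - j))"
      unfolding of_real_sum
      by (rule sum.cong) (use m F S in \<open>auto simp: lessThan_Suc_atMost[symmetric]\<close>)
    moreover have "- lam b * word_density (\<not> b) m x = complex_of_real (cc * fps_nth (kappa cc) (Suc n))"
      using lam_mult[of b] by (simp add: word_density_def m mult.assoc[symmetric])
    moreover have "word_density b (Suc m) x = complex_of_real (fps_nth (gen_fun cc ?y) (Suc n))"
      by (simp add: word_density_def m)
    ultimately show ?thesis
      unfolding sum gen_fun_convolution[of cc ?y n] by (simp add: add.commute)
  qed
qed

text \<open>Strong induction on the length, since a contraction leaves two shorter words of
  unrelated lengths. The scalar part of the first letter gives the additional term with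
  \<open>lam b\<close>.\<close>

lemma dens_alternate: "dens (W (alternate b m)) (word_density b m)"
proof (induction m arbitrary: b rule: less_induct)
  case (less m)
  show ?case
  proof (cases m)
    case 0
    have "word_density b 0 = (\<lambda>_. 1)" by (auto simp: word_density_def gen_fun_def exp_kappa_def kappa_0)
    then show ?thesis using 0 dens_id by simp
  next
    case (Suc k)
    let ?w = "alternate (\<not> b) k"
    obtain K where K: "\<And>j x y. x \<in> {0..1} \<Longrightarrow> y \<in> {0..1} \<Longrightarrow> cmod (inner_integral b j x - inner_integral b j y) \<le> K j * \<bar>x - y\<bar>"
      using inner_integral_lipschitz[of b] by metis
    have nth: "?w ! i = (\<not> b) \<longleftrightarrow> even i" if "i < k" for i using nth_alternate[OF that] by auto
    have "dens (tb b \<odot> W ?w) (\<lambda>t. \<Sum>i<length ?w. if ?w ! i = (\<not> b) then inner_integral b (i div 2) t * word_density b (k - Suc i) t else 0)"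
    proof (rule dens_tb_W[where F = "\<lambda>i. word_density (\<not> b) i" and K = "\<lambda>i. K (i div 2)"])
      fix i assume i: "i < length ?w" "?w ! i = (\<not> b)"
      then have ik: "i < k" and ev: "even i" using nth by auto
      show "dens (W (take i ?w)) (word_density (\<not> b) i)"
        using less.IH[of i "\<not> b"] ik Suc by (simp add: take_alternate)
      have "drop (Suc i) ?w = alternate b (k - Suc i)"
        using ik ev drop_alternate[of "Suc i" k "\<not> b"] by simp
      then show "dens (W (drop (Suc i) ?w)) (word_density b (k - Suc i))"
        using less.IH[of "k - Suc i" b] Suc by simp
      show "inner_integral b (i div 2) \<in> BB" by (rule inner_integral_BB)
      show "\<tau> (\<Phi> (word_density (\<not> b) i) \<odot> side b c) = inner_integral b (i div 2) c" if "c \<in> {0..1}" for c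
        using inner_integral_side[OF that, of b "i div 2"] ev by simp
    qed (rule K)
    from dens_W_Cons[OF this less.IH[of k "\<not> b"]] Suc
    have "dens (W (alternate b m)) (\<lambda>t. (\<Sum>i<length ?w. if ?w ! i = (\<not> b) then inner_integral b (i div 2) t * word_density b (k - Suc i) t else 0)
        + - lam b * word_density (\<not> b) k t)"
      by simp
    moreover have "(\<lambda>t. (\<Sum>i<length ?w. if ?w ! i = (\<not> b) then inner_integral b (i div 2) t * word_density b (k - Suc i) t else 0)
        + - lam b * word_density (\<not> b) k t) = word_density b m"
    proof (rule ext)
      fix t
      have "(\<Sum>i<length ?w. if ?w ! i = (\<not> b) then inner_integral b (i div 2) t * word_density b (k - Suc i) t else 0)
          = (\<Sum>i<k. if even i then inner_integral b (i div 2) t * word_density b (k - Suc i) t else 0)"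
        by (rule sum.cong) (auto simp: nth)
      then show "(\<Sum>i<length ?w. if ?w ! i = (\<not> b) then inner_integral b (i div 2) t * word_density b (k - Suc i) t else 0)
          + - lam b * word_density (\<not> b) k t = word_density b m t"
        unfolding Suc word_density_Suc[of b k t] by simp
    qed
    ultimately show ?thesis by simp
  qed
qed

section \<open>Moments and the conditional expectation\<close>

lemma a_True: "a True = T - scalar_op l"
proof -
  have "scalar_op (- l) = - (scalar_op l :: 'h op)"
    by (rule blinfun_eqI) (simp add: scaleC_minus_left blinfun.minus_left)
  then show ?thesis by (simp add: a_def tb_def lam_def)
qed

lemma a_False: "a False = adj (T - scalar_op l)"
proof -
  have "scalar_op (- cnj l) = - (scalar_op (cnj l) :: 'h op)"
    by (rule blinfun_eqI) (simp add: scaleC_minus_left blinfun.minus_left)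
  then show ?thesis
    by (simp add: a_def tb_def lam_def adj_diff M_clinear T_M clinear_scalar adj_scalar)
qed

lemma W_alternate: "W (alternate False (2 * n)) = op_pow (adj (T - scalar_op l) \<odot> (T - scalar_op l)) n"
proof (induction n)
  case (Suc n)
  then show ?case by (simp add: op_pow_Suc op_assoc a_True a_False)
qed simp

lemma dens_moment:
  "dens (op_pow (adj (T - scalar_op l) \<odot> (T - scalar_op l)) n) (\<lambda>x. complex_of_real (poly (Qpoly cc n) x))"
proof -
  have "word_density False (2 * n) = (\<lambda>x. complex_of_real (poly (Qpoly cc n) x))"
    by (auto simp: word_density_def reflect_def poly_Qpoly)
  then show ?thesis using dens_alternate[of False "2 * n"] by (simp add: W_alternate)
qed

lemma tau_moment:
  assumes Q: "moment_recursion l Q"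
  shows "\<tau> (op_pow (adj (T - scalar_op l) \<odot> (T - scalar_op l)) n) = complex_of_real
    (\<Sum>k = 0..n. real n ^ k / fact (k + 1) * real (n choose k) * cmod l ^ (2 * n - 2 * k))"
proof -
  have Qp: "Q = Qpoly cc" by (rule moment_recursion_unique[OF Q moment_recursion_Qpoly])
  let ?F = "\<lambda>x. complex_of_real (poly (Q n) x)"
  have d: "dens (op_pow (adj (T - scalar_op l) \<odot> (T - scalar_op l)) n) ?F"
    unfolding Qp by (rule dens_moment)
  then have "\<tau> (op_pow (adj (T - scalar_op l) \<odot> (T - scalar_op l)) n \<odot> \<Phi> (\<lambda>_. 1)) = \<tau> (\<Phi> ?F \<odot> \<Phi> (\<lambda>_. 1))"
    unfolding dens_def using bdd_borel_const[of 1] by blast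
  then have "\<tau> (op_pow (adj (T - scalar_op l) \<odot> (T - scalar_op l)) n) = \<tau> (\<Phi> ?F)"
    by (simp add: Phi_one)
  also have "\<dots> = (LINT t:{0..1}|lborel. ?F t)" using d by (intro tau_Phi) (simp add: dens_def)
  also have "\<dots> = complex_of_real (LINT t:{0..1}|lborel. poly (Q n) t)"
    by (rule set_integral_complex_of_real)
  finally show ?thesis by (simp only: moment_recursion_integral[OF Q])
qed

text \<open>The module property and the invariance of the trace give \<open>E A\<close> the same
  pairings with all \<open>\<Phi> h\<close> as \<open>\<Phi> F\<close>. Both lie in the bicommutant
  of \<open>D0\<close>, where \<open>N2_eq_0\<close> makes such pairings decisive.\<close>

lemma cond_exp_eq:
  assumes E: "trace_preserving_cond_exp \<tau> (vN_generated {D0, X}) (vN_generated {D0}) E"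
    and A: "A \<in> vN_generated {D0, X}" and F: "dens A F"
  shows "E A = \<Phi> F"
proof -
  have FB: "F \<in> BB" using F by (simp add: dens_def)
  have sub: "vN_generated {D0} \<subseteq> N2"
    by (rule vN_generated_subset_bicommutant) (auto simp: D0_clinear adj_D0)
  have EA: "E A \<in> vN_generated {D0}" using E A by (simp add: trace_preserving_cond_exp_def)
  have id: "id_blinfun \<in> vN_generated {D0}"
    by (auto simp: vN_generated_def intro: vN_id)
  have "E A - \<Phi> F = 0"
  proof (rule N2_eq_0)
    show "E A - \<Phi> F \<in> N2" using sub EA Phi_N2[OF FB] commutant_diff by blast
    fix h assume h: "h \<in> BB"
    have Ph: "\<Phi> h \<in> vN_generated {D0}" by (rule Phi_vN_generated) (simp_all add: h)
    have AP: "A \<odot> \<Phi> h \<in> vN_generated {D0, X}"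
      using A Phi_vN_generated[of "{D0, X}", OF _ h] by (auto simp: vN_generated_def intro: vN_mult)
    have "E (id_blinfun \<odot> A \<odot> \<Phi> h) = id_blinfun \<odot> E A \<odot> \<Phi> h"
      using E A id Ph unfolding trace_preserving_cond_exp_def by blast
    then have "E (A \<odot> \<Phi> h) = E A \<odot> \<Phi> h" by simp
    moreover have "\<tau> (E (A \<odot> \<Phi> h)) = \<tau> (A \<odot> \<Phi> h)"
      using E AP unfolding trace_preserving_cond_exp_def by blast
    moreover have "\<tau> (A \<odot> \<Phi> h) = \<tau> (\<Phi> F \<odot> \<Phi> h)" using F h by (simp add: dens_def)
    ultimately have "\<tau> (E A \<odot> \<Phi> h) = \<tau> (\<Phi> F \<odot> \<Phi> h)" by simp
    moreover have "E A \<in> M" using EA sub N2_M by blast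
    ultimately show "\<tau> ((E A - \<Phi> F) \<odot> \<Phi> h) = 0"
      by (simp add: op_diff_left tau_diff M_mult Phi_M FB h)
  qed
  then show ?thesis by simp
qed

lemma T_vN_generated: "T \<in> vN_generated {D0, X}"
  unfolding vN_generated_def
proof (intro InterI)
  fix N assume "N \<in> {N. von_neumann_algebra N \<and> {D0, X} \<subseteq> N}"
  then have N: "von_neumann_algebra N" "D0 \<in> N" "X \<in> N" by auto
  have "cell n j \<in> N" for n j unfolding cell_def iproj_def by (rule Phi_vN[OF N(1,2) indicator_BB])
  then have "TN True n \<in> N" for n
    unfolding TN_def by (intro vN_sum N) (auto intro: vN_mult vN_zero N)
  then show "T \<in> N" by (rule vN_limit[OF N(1) _ TN_True_lim])
qed

lemma moment_vN_generated:
  "op_pow (adj (T - scalar_op l) \<odot> (T - scalar_op l)) n \<in> vN_generated {D0, X}"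
  using T_vN_generated unfolding vN_generated_def
  by (auto intro!: vN_op_pow vN_mult vN_adj vN_diff vN_scalar)

end

theorem theorem3p2:
  fixes M :: "('h::complex_hilbert) op set"
    and \<tau> :: "'h op \<Rightarrow> complex"
    and D0 X T :: "'h op"
    and \<Phi> :: "(real \<Rightarrow> complex) \<Rightarrow> 'h op"
    and E :: "'h op \<Rightarrow> 'h op"
    and l :: complex
  assumes "von_neumann_algebra M"
    and "faithful_normal_tracial_state M \<tau>"
    and "D0 \<in> M" and "selfadjoint D0" and "has_distribution \<tau> D0 uniform_01"
    and "X \<in> M" and "selfadjoint X" and "has_distribution \<tau> X standard_semicircle"
    and "free_pair \<tau> D0 X"
    and "borel_functional_calculus D0 \<Phi>"
    and "DT_approx \<Phi> X \<longlonglongrightarrow> T"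
    and "trace_preserving_cond_exp \<tau> (vN_generated {D0, X}) (vN_generated {D0}) E"
  shows "(\<exists>!Q. moment_recursion l Q) \<and>
    (\<forall>Q n. moment_recursion l Q \<longrightarrow>
       E (op_pow (adj (T - scalar_op l) o\<^sub>L (T - scalar_op l)) n)
         = \<Phi> (\<lambda>x. complex_of_real (poly (Q n) x))) \<and>
    (\<forall>n. \<tau> (op_pow (adj (T - scalar_op l) o\<^sub>L (T - scalar_op l)) n)
         = complex_of_real
             (\<Sum>k = 0..n. real n ^ k / fact (k + 1) * real (n choose k) * cmod l ^ (2 * n - 2 * k)))"
proof -
  interpret dt_operator M \<tau> D0 \<Phi> X T l
    using assms by unfold_locales
  have Q: "moment_recursion l Q \<longleftrightarrow> Q = Qpoly cc" for Q
    using moment_recursion_unique moment_recursion_Qpoly by metis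
  show ?thesis
    unfolding Q
    using cond_exp_eq[OF assms(12) moment_vN_generated dens_moment] tau_moment[OF moment_recursion_Qpoly]
    by blast
qed

end
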